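(* There exists an infinite family of transitive Boolean functions $F_i:\{0,1\}^{N_i}\to\{0,1\}$ ($i\in\mathbb{N}$), with $N_i\to\infty$ and $Q(F_i)\to\infty$, such that $$Q(F_i)=\widetilde{\Omega}\big(C(F_i)^2\big).$$
   Context: A subgroup $G\le S_N$ is transitive if for all $i,j\in[N]$ there is $\sigma\in G$ with $\sigma(i)=j$. A function $f:\{0,1\}^N\to\{0,1\}$ is transitive if there is a transitive group $G\le S_N$ such that $f(x_1,\dots,x_N)=f(x_{\sigma(1)},\dots,x_{\sigma(N)})$ for all $x\in\{0,1\}^N$ and all $\sigma\in G$. For total $f:\{0,1\}^N\to\{0,1\}$: - $Q(f)$, quantum query complexity, is the minimum number of queries of a quantum query algorithm (standard quantum oracle model for the input bits) that outputs $f(x)$ with error probability at most $1/3$ on every input $x$. - A partial assignment $p:S\to\{0,1\}$, $S\subseteq[N]$, of size $|S|$, is a $b$-certificate if every $y\in\{0,1\}^N$ with $y|_S=p$ satisfies $f(y)=b$. $C(f,x)$ is the minimum size of an $f(x)$-certificate $p$ consistent with $x$ (i.e. $x|_S=p$), and the certificate complexity is $C(f)=\max_{x\in\{0,1\}^N}C(f,x)$. Notation: for quantities $A_i,B_i$ attached to $F_i$, $A_i=\widetilde{\Omega}(B_i)$ means that there are constants $c>0$ and $C'\ge 0$ with $A_i\ge c\,B_i/(\log N_i)^{C'}$ for all sufficiently large $i$. *)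

theory Defs
  imports
    Complex_Main
    "HOL-Library.FuncSet"
    "HOL-Algebra.Sym_Groups"
    "Jordan_Normal_Form.Schur_Decomposition"
begin

(* The library's sym_group N permutes {1..N}, so the coordinates are numbered 1..N.  An input
   is an extensional function on {1..N}; a Boolean function on N variables is a predicate of
   which only the values on cube N are ever used. *)

definition cube :: "nat \<Rightarrow> (nat \<Rightarrow> bool) set" where
  "cube N = {1..N} \<rightarrow>\<^sub>E UNIV"

definition transitive_group :: "nat \<Rightarrow> (nat \<Rightarrow> nat) set \<Rightarrow> bool" where
  "transitive_group N G \<longleftrightarrow>
     subgroup G (sym_group N) \<and> (\<forall>i\<in>{1..N}. \<forall>j\<in>{1..N}. \<exists>\<sigma>\<in>G. \<sigma> i = j)"

(* Each sigma in G fixes every point outside {1..N}, so x o sigma is again in cube N. *)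
definition transitive_function :: "nat \<Rightarrow> ((nat \<Rightarrow> bool) \<Rightarrow> bool) \<Rightarrow> bool" where
  "transitive_function N f \<longleftrightarrow>
     (\<exists>G. transitive_group N G \<and> (\<forall>x\<in>cube N. \<forall>\<sigma>\<in>G. f x = f (x \<circ> \<sigma>)))"

definition consistent :: "(nat \<rightharpoonup> bool) \<Rightarrow> (nat \<Rightarrow> bool) \<Rightarrow> bool" where
  "consistent p x \<longleftrightarrow> (\<forall>i\<in>dom p. p i = Some (x i))"

definition certificate ::
  "nat \<Rightarrow> ((nat \<Rightarrow> bool) \<Rightarrow> bool) \<Rightarrow> bool \<Rightarrow> (nat \<rightharpoonup> bool) \<Rightarrow> bool" where
  "certificate N f b p \<longleftrightarrow>
     dom p \<subseteq> {1..N} \<and> (\<forall>y\<in>cube N. consistent p y \<longrightarrow> f y = b)"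

definition certificate_complexity_at ::
  "nat \<Rightarrow> ((nat \<Rightarrow> bool) \<Rightarrow> bool) \<Rightarrow> (nat \<Rightarrow> bool) \<Rightarrow> nat" where
  "certificate_complexity_at N f x =
     (LEAST k. \<exists>p. certificate N f (f x) p \<and> consistent p x \<and> card (dom p) = k)"

definition certificate_complexity :: "nat \<Rightarrow> ((nat \<Rightarrow> bool) \<Rightarrow> bool) \<Rightarrow> nat" where
  "certificate_complexity N f = Max (certificate_complexity_at N f ` cube N)"

definition unitary_mat :: "nat \<Rightarrow> complex mat \<Rightarrow> bool" where
  "unitary_mat d U \<longleftrightarrow>
     U \<in> carrier_mat d d \<and> mat_adjoint U * U = 1\<^sub>m d \<and> U * mat_adjoint U = 1\<^sub>m d"

(* The state space has a query register i in {1..N}, an answer bit b and an m-dimensional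
   workspace w, hence dimension d = 2 * N * m.  The basis vector |i, b, w> has index
   2 * (w * N + (i - 1)) + b. *)
definition query_index :: "nat \<Rightarrow> nat \<Rightarrow> nat" where
  "query_index N k = Suc (k div 2 mod N)"

(* |i, b, w>  is mapped to  |i, b xor x_i, w> *)
definition query_mat :: "nat \<Rightarrow> nat \<Rightarrow> (nat \<Rightarrow> bool) \<Rightarrow> complex mat" where
  "query_mat N m x = mat (2 * N * m) (2 * N * m)
     (\<lambda>(r, c). if r div 2 = c div 2 \<and> odd r = (odd c \<noteq> x (query_index N c)) then 1 else 0)"

(* State after t queries: U t * O * U (t-1) * ... * O * U 0, with O = query_mat N m x, applied to the first
   basis vector |1, 0, 0>. *)
fun query_state ::
  "nat \<Rightarrow> nat \<Rightarrow> (nat \<Rightarrow> complex mat) \<Rightarrow> (nat \<Rightarrow> bool) \<Rightarrow> nat \<Rightarrow> complex vec" where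
  "query_state N m U x 0 = U 0 *\<^sub>v unit_vec (2 * N * m) 0"
| "query_state N m U x (Suc t) = U (Suc t) *\<^sub>v (query_mat N m x *\<^sub>v query_state N m U x t)"

(* The final state is measured in the computational basis; the output is 1 iff the outcome
   lies in A. *)
definition output_prob ::
  "nat \<Rightarrow> nat \<Rightarrow> (nat \<Rightarrow> complex mat) \<Rightarrow> nat set \<Rightarrow> nat \<Rightarrow> (nat \<Rightarrow> bool) \<Rightarrow> bool \<Rightarrow> real" where
  "output_prob N m U A T x b =
     (\<Sum>k | k < 2 * N * m \<and> (k \<in> A) = b. (cmod (query_state N m U x T $ k))\<^sup>2)"

definition quantum_computes ::
  "nat \<Rightarrow> ((nat \<Rightarrow> bool) \<Rightarrow> bool) \<Rightarrow> nat \<Rightarrow> bool" where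
  "quantum_computes N f T \<longleftrightarrow>
     (\<exists>m U A. m > 0 \<and> (\<forall>t\<le>T. unitary_mat (2 * N * m) (U t)) \<and>
        (\<forall>x\<in>cube N. output_prob N m U A T x (\<not> f x) \<le> 1 / 3))"

definition quantum_query_complexity :: "nat \<Rightarrow> ((nat \<Rightarrow> bool) \<Rightarrow> bool) \<Rightarrow> nat" where
  "quantum_query_complexity N f = (LEAST T. quantum_computes N f T)"

definition tilde_Omega :: "(nat \<Rightarrow> nat) \<Rightarrow> (nat \<Rightarrow> real) \<Rightarrow> (nat \<Rightarrow> real) \<Rightarrow> bool" where
  "tilde_Omega N A B \<longleftrightarrow>
     (\<exists>c C'. c > 0 \<and> C' \<ge> 0 \<and>
        (\<forall>\<^sub>F i in sequentially. A i \<ge> c * B i / ln (real (N i)) powr C'))"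

end

theory Submission
  imports Defs "HOL-Analysis.Function_Topology"
begin



text \<open>
  Let \<open>f\<close> ask whether, with one letter of \<open>{0,1}\<^sup>L\<close> picked from each of \<open>k\<close> groups of \<open>r\<close> letters,
  the \<open>k\<close> letters can sum to zero; here \<open>k\<close> and \<open>L\<close> are polylogarithmic in \<open>r\<close>. The input lists, for each
  letter, bit and value, whether that value is excluded. So \<open>f\<close> is antitone: value 1 is certified by
  \<open>k L\<close> zeros, and value 0 by at most \<open>2 k r L\<close> ones. In \<open>F = f \<circ> f\<close> each outer zero costs an inner
  0-certificate and each outer one an inner 1-certificate, so that both kinds of certificates of \<open>F\<close>
  have size \<open>O(r k\<^sup>2 L\<^sup>2)\<close>, about the square root of the number of variables.

  The quantum lower bound is the adversary method with negative weights. It multiplies under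
  composition, so it suffices that the adversary value of \<open>f\<close> is at least \<open>r / 2\<close>. As in the
  Belovs-Spalek bound for k-sum, the rows of the adversary matrix are pairs of a choice \<open>S\<close> of letters
  and an input on which \<open>S\<close> sums to zero, and in the row block of \<open>S\<close> a character that touches \<open>m\<close>
  letters has weight \<open>max (r - m) 0\<close>, or 0 if it touches more than \<open>h\<close> letters of \<open>S\<close>. Since
  \<open>2 h < k\<close>, the remaining characters are still orthogonal on the solutions of \<open>S\<close>, and only a
  fraction of about \<open>1 / 2\<^sup>h\<close> of the choices meets a given set of \<open>r\<close> letters in \<open>h\<close> places.
\<close>

section \<open>Operator norm bounds for bilinear forms\<close>

text \<open>Where row and column differ in a bit of a letter, the characters of that letter sum to
  zero, so a query to the bit sees only how the weight changes when the letter is added. Lowering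
  the weight by 1 per touched letter makes this change 1 as a rule, against \<open>r\<close> at the
  trivial character, and this gap is the source of the value \<open>r / 2\<close>.

  The obstacle is that on the solutions of \<open>S\<close> a character coincides with its
  translates by the \<open>2 ^ L\<close> parity characters of \<open>S\<close>, so the weights of
  translates cannot be chosen independently. Two distinct translates of each other together touch
  all \<open>k\<close> letters of \<open>S\<close>; cutting the weights off above \<open>h\<close>
  hits, with \<open>2 * h < k\<close>, leaves at most one of them. The cut creates jumps of up to
  \<open>r\<close> at the threshold. They enter squared, so they are harmless once they concern a
  fraction of at most \<open>1 / r ^ 2\<close> of the choices; hence \<open>3 * r ^ 2\<close>
  against \<open>2 ^ h\<close>.

  The composition is needed because \<open>f\<close> alone shows no gap: its number of variables,
  which bounds its quantum query complexity, is also the bound on its 0-certificates. Composing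
  squares the adversary value, while a certificate multiplies one short and one long size.\<close>

definition bil :: "'r set \<Rightarrow> 'c set \<Rightarrow> ('r \<Rightarrow> 'c \<Rightarrow> real) \<Rightarrow> ('r \<Rightarrow> real) \<Rightarrow> ('c \<Rightarrow> real) \<Rightarrow> real" where
  "bil R C M u v = (\<Sum>r\<in>R. \<Sum>c\<in>C. u r * M r c * v c)"

text \<open>For \<open>\<beta> \<ge> 0\<close> this says that \<open>M\<close> has operator norm at most \<open>\<beta>\<close>: rescaling \<open>u\<close> and \<open>v\<close> turns
  the sum of the squared norms into twice their product. It is also the positivity of the block
  matrix with \<open>\<beta> I\<close> on the diagonal and \<open>M\<close> off the diagonal.\<close>

definition form_le :: "'r set \<Rightarrow> 'c set \<Rightarrow> ('r \<Rightarrow> 'c \<Rightarrow> real) \<Rightarrow> real \<Rightarrow> bool" where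
  "form_le R C M \<beta> \<longleftrightarrow>
     (\<forall>u v. 2 * bil R C M u v \<le> \<beta> * ((\<Sum>r\<in>R. (u r)\<^sup>2) + (\<Sum>c\<in>C. (v c)\<^sup>2)))"

lemma form_leI:
  assumes "\<And>u v. 2 * bil R C M u v \<le> \<beta> * ((\<Sum>r\<in>R. (u r)\<^sup>2) + (\<Sum>c\<in>C. (v c)\<^sup>2))"
  shows "form_le R C M \<beta>"
  using assms by (simp add: form_le_def)

lemma form_leD:
  assumes "form_le R C M \<beta>"
  shows "2 * bil R C M u v \<le> \<beta> * ((\<Sum>r\<in>R. (u r)\<^sup>2) + (\<Sum>c\<in>C. (v c)\<^sup>2))"
  using assms by (simp add: form_le_def)

lemma bil_scale: "bil R C M (\<lambda>r. a * u r) (\<lambda>c. b * v c) = a * b * bil R C M u v"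
  by (simp add: bil_def sum_distrib_left mult_ac)

lemma bil_uminus: "bil R C M (\<lambda>r. - u r) v = - bil R C M u v"
  by (simp add: bil_def sum_negf)

lemma bil_cong:
  assumes "\<And>r c. r \<in> R \<Longrightarrow> c \<in> C \<Longrightarrow> M r c = M' r c" 
    "\<And>r. r \<in> R \<Longrightarrow> u r = u' r" "\<And>c. c \<in> C \<Longrightarrow> v c = v' c"
  shows "bil R C M u v = bil R C M' u' v'"
  unfolding bil_def using assms by (intro sum.cong) auto

lemma form_le_scaled:
  assumes "form_le R C M \<beta>" "s > 0"
  shows "2 * bil R C M u v \<le> \<beta> * (s * (\<Sum>r\<in>R. (u r)\<^sup>2) + (\<Sum>c\<in>C. (v c)\<^sup>2) / s)"
proof -
  have "2 * bil R C M (\<lambda>r. sqrt s * u r) (\<lambda>c. (1 / sqrt s) * v c)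
      \<le> \<beta> * ((\<Sum>r\<in>R. (sqrt s * u r)\<^sup>2) + (\<Sum>c\<in>C. ((1 / sqrt s) * v c)\<^sup>2))"
    by (rule form_leD[OF assms(1)])
  moreover have "(\<Sum>r\<in>R. (sqrt s * u r)\<^sup>2) = s * (\<Sum>r\<in>R. (u r)\<^sup>2)"
    using assms(2) by (simp add: power_mult_distrib sum_distrib_left)
  moreover have "(\<Sum>c\<in>C. ((1 / sqrt s) * v c)\<^sup>2) = (\<Sum>c\<in>C. (v c)\<^sup>2) / s"
    using assms(2) by (simp add: power_divide sum_divide_distrib)
  moreover have "sqrt s * (1 / sqrt s) = 1" using assms(2) by simp
  ultimately show ?thesis unfolding bil_scale by simp
qed

lemma form_le_abs:
  assumes "form_le R C M \<beta>"
  shows "2 * \<bar>bil R C M u v\<bar> \<le> \<beta> * ((\<Sum>r\<in>R. (u r)\<^sup>2) + (\<Sum>c\<in>C. (v c)\<^sup>2))"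
  using form_leD[OF assms, of u v] form_leD[OF assms, of "\<lambda>r. - u r" v]
  by (simp add: bil_uminus abs_if)

text \<open>Induction on the index set as in a Cholesky factorisation: a zero pivot at
  \<open>i\<close> forces the whole row of \<open>i\<close> to vanish, a positive one leaves a
  positive semidefinite Schur complement on \<open>F\<close>. Taking \<open>E\<close> itself as the
  set of coordinates provides one new coordinate per step.\<close>

lemma psd_gram:
  fixes B :: "'d \<Rightarrow> 'd \<Rightarrow> real"
  assumes "finite E"
    and "\<And>x y. x \<in> E \<Longrightarrow> y \<in> E \<Longrightarrow> B x y = B y x"
    and "\<And>z. 0 \<le> (\<Sum>x\<in>E. \<Sum>y\<in>E. z x * B x y * z y)"
  shows "\<exists>\<phi>::'d \<Rightarrow> 'd \<Rightarrow> real. \<forall>x\<in>E. \<forall>y\<in>E. B x y = (\<Sum>e\<in>E. \<phi> x e * \<phi> y e)"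
  using assms
proof (induction E arbitrary: B rule: finite_induct)
  case empty
  then show ?case by simp
next
  case (insert i F)
  note sym = insert.prems(1) and psd = insert.prems(2)
  have expand: "(\<Sum>x\<in>insert i F. \<Sum>y\<in>insert i F. z x * B x y * z y) =
     (z i)\<^sup>2 * B i i + 2 * z i * (\<Sum>y\<in>F. B i y * z y) + (\<Sum>x\<in>F. \<Sum>y\<in>F. z x * B x y * z y)" for z
  proof -
    have "(\<Sum>x\<in>F. z x * B x i * z i) = z i * (\<Sum>y\<in>F. B i y * z y)"
      unfolding sum_distrib_left by (rule sum.cong) (simp_all add: sym[of _ i])
    moreover have "(\<Sum>y\<in>F. z i * B i y * z y) = z i * (\<Sum>y\<in>F. B i y * z y)"
      unfolding sum_distrib_left by (rule sum.cong) auto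
    ultimately show ?thesis
      using insert.hyps by (simp add: sum.distrib power2_eq_square)
  qed
  show ?case
  proof (cases "B i i = 0")
    case True
    have zero: "B i y = 0" if "y \<in> F" for y
    proof (rule ccontr)
      assume ne: "B i y \<noteq> 0"
      \<comment> \<open>At the vector with entries \<open>t\<close> at \<open>i\<close> and 1 at
        \<open>y\<close> the form is \<open>2 * t * B i y + B y y\<close>; this \<open>t\<close>
        makes it -1.\<close>
      define t where "t = - (B y y + 1) / (2 * B i y)"
      have "0 \<le> 2 * t * B i y + B y y"
      proof -
        let ?z = "\<lambda>x. if x = i then t else if x = y then 1 else 0 :: real"
        have "(\<Sum>w\<in>F. B i w * ?z w) = (\<Sum>w\<in>F. if w = y then B i y else 0)"
          by (rule sum.cong) (use insert.hyps in auto)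
        moreover have "(\<Sum>x\<in>F. \<Sum>w\<in>F. ?z x * B x w * ?z w) = (\<Sum>x\<in>F. if x = y then B y y else 0)"
        proof (intro sum.cong refl)
          fix x assume "x \<in> F"
          then have "(\<Sum>w\<in>F. ?z x * B x w * ?z w) = (\<Sum>w\<in>F. if w = y then (if x = y then B y y else 0) else 0)"
            by (intro sum.cong) (use insert.hyps in auto)
          then show "(\<Sum>w\<in>F. ?z x * B x w * ?z w) = (if x = y then B y y else 0)"
            using insert.hyps that by simp
        qed
        ultimately show ?thesis
          using psd[of ?z] unfolding expand using insert.hyps that True by (simp add: sum.delta)
      qed
      also have "\<dots> = - 1" using ne by (simp add: t_def field_simps)
      finally show False by simp
    qed
    have zero': "B y i = 0" if "y \<in> F" for y
      using zero[OF that] sym[of y i] that by simp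
    have "0 \<le> (\<Sum>x\<in>F. \<Sum>y\<in>F. z x * B x y * z y)" for z
    proof -
      have "(\<Sum>y\<in>F. B i y * z y) = 0" using zero by simp
      then show ?thesis using psd[of z] unfolding expand by (simp add: True)
    qed
    then have "\<exists>\<phi>::'d \<Rightarrow> 'd \<Rightarrow> real. \<forall>x\<in>F. \<forall>y\<in>F. B x y = (\<Sum>e\<in>F. \<phi> x e * \<phi> y e)"
      by (intro insert.IH sym) auto
    then obtain \<phi> where \<phi>: "\<forall>x\<in>F. \<forall>y\<in>F. B x y = (\<Sum>e\<in>F. \<phi> x e * \<phi> y e)" ..
    let ?\<phi> = "\<lambda>x e. if x = i \<or> e = i then 0 else \<phi> x e"
    have "B x y = (\<Sum>e\<in>insert i F. ?\<phi> x e * ?\<phi> y e)" if "x \<in> insert i F" "y \<in> insert i F" for x y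
    proof -
      have "(\<Sum>e\<in>insert i F. ?\<phi> x e * ?\<phi> y e) = (\<Sum>e\<in>F. ?\<phi> x e * ?\<phi> y e)"
        using insert.hyps by simp
      also have "\<dots> = (\<Sum>e\<in>F. if x = i \<or> y = i then 0 else \<phi> x e * \<phi> y e)"
        using insert.hyps(2) by (intro sum.cong) auto
      also have "\<dots> = (if x = i \<or> y = i then 0 else (\<Sum>e\<in>F. \<phi> x e * \<phi> y e))"
        by simp
      finally have *: "(\<Sum>e\<in>insert i F. ?\<phi> x e * ?\<phi> y e) =
          (if x = i \<or> y = i then 0 else (\<Sum>e\<in>F. \<phi> x e * \<phi> y e))" .
      show ?thesis
      proof (cases "x = i \<or> y = i")
        case True
        then have "B x y = 0" using that zero zero' \<open>B i i = 0\<close> by blast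
        with True show ?thesis unfolding * by (simp only: if_True)
      next
        case False
        then have "B x y = (\<Sum>e\<in>F. \<phi> x e * \<phi> y e)" using that \<phi> by blast
        with False show ?thesis unfolding * by (simp only: if_False)
      qed
    qed
    then show ?thesis by (intro exI[of _ ?\<phi>] ballI)
  next
    case False
    define b where "b = B i i"
    have "0 \<le> b"
    proof -
      have "(\<Sum>y\<in>F. B i y * (if y = i then 1 else 0)) = 0"
        using insert.hyps by (intro sum.neutral) auto
      moreover have "(\<Sum>x\<in>F. \<Sum>y\<in>F. (if x = i then 1 else 0) * B x y * (if y = i then 1 else 0)) = 0"
        using insert.hyps by (intro sum.neutral ballI) auto
      ultimately show ?thesis
        using psd[of "\<lambda>x. if x = i then 1 else 0"] unfolding expand by (simp add: b_def)
    qed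
    with False have b: "b > 0" by (simp add: b_def)
    \<comment> \<open>The Schur complement of the pivot \<open>b\<close>.\<close>
    define B' where "B' = (\<lambda>x y. B x y - B x i * B i y / b)"
    have "0 \<le> (\<Sum>x\<in>F. \<Sum>y\<in>F. z x * B' x y * z y)" for z
    proof -
      define s where "s = (\<Sum>y\<in>F. B i y * z y)"
      have "(\<Sum>x\<in>F. \<Sum>y\<in>F. z x * B' x y * z y) =
            (\<Sum>x\<in>F. \<Sum>y\<in>F. z x * B x y * z y) - (\<Sum>x\<in>F. \<Sum>y\<in>F. (B i x * z x) * (B i y * z y) / b)"
        unfolding sum_subtractf[symmetric] B'_def
        by (intro sum.cong refl) (simp add: algebra_simps sym[of _ i])
      also have "(\<Sum>x\<in>F. \<Sum>y\<in>F. (B i x * z x) * (B i y * z y) / b) = s\<^sup>2 / b"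
        unfolding s_def power2_eq_square sum_product by (simp add: sum_divide_distrib)
      finally have 1: "(\<Sum>x\<in>F. \<Sum>y\<in>F. z x * B' x y * z y) =
            (\<Sum>x\<in>F. \<Sum>y\<in>F. z x * B x y * z y) - s\<^sup>2 / b" .
      \<comment> \<open>The entry \<open>- s / b\<close> at \<open>i\<close> minimises the form for
        given entries on \<open>F\<close>, and the minimum is the form of the Schur
        complement.\<close>
      let ?z = "\<lambda>x. if x = i then - s / b else z x"
      have "(\<Sum>y\<in>F. B i y * ?z y) = s"
        unfolding s_def using insert.hyps by (intro sum.cong) auto
      moreover have "(\<Sum>x\<in>F. \<Sum>y\<in>F. ?z x * B x y * ?z y) = (\<Sum>x\<in>F. \<Sum>y\<in>F. z x * B x y * z y)"
        using insert.hyps by (intro sum.cong) auto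
      ultimately have "0 \<le> (s / b)\<^sup>2 * b - 2 * (s / b) * s + (\<Sum>x\<in>F. \<Sum>y\<in>F. z x * B x y * z y)"
        using psd[of ?z] unfolding expand by (simp add: b_def)
      also have "(s / b)\<^sup>2 * b - 2 * (s / b) * s = - (s\<^sup>2 / b)"
        using b by (simp add: power2_eq_square)
      finally show ?thesis unfolding 1 by simp
    qed
    moreover have "B' x y = B' y x" if "x \<in> F" "y \<in> F" for x y
      using sym[of x y] sym[of x i] sym[of y i] that by (simp add: B'_def)
    ultimately have "\<exists>\<phi>::'d \<Rightarrow> 'd \<Rightarrow> real. \<forall>x\<in>F. \<forall>y\<in>F. B' x y = (\<Sum>e\<in>F. \<phi> x e * \<phi> y e)"
      by (intro insert.IH) auto
    then obtain \<phi> where \<phi>: "\<forall>x\<in>F. \<forall>y\<in>F. B' x y = (\<Sum>e\<in>F. \<phi> x e * \<phi> y e)" ..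
    let ?\<phi> = "\<lambda>x e. if e = i then B x i / sqrt b else if x = i then 0 else \<phi> x e"
    have "B x y = (\<Sum>e\<in>insert i F. ?\<phi> x e * ?\<phi> y e)" if "x \<in> insert i F" "y \<in> insert i F" for x y
    proof -
      have "(\<Sum>e\<in>insert i F. ?\<phi> x e * ?\<phi> y e) = B x i * B y i / b + (\<Sum>e\<in>F. ?\<phi> x e * ?\<phi> y e)"
        using insert.hyps b by simp
      also have "(\<Sum>e\<in>F. ?\<phi> x e * ?\<phi> y e) = (\<Sum>e\<in>F. if x = i \<or> y = i then 0 else \<phi> x e * \<phi> y e)"
        using insert.hyps(2) by (intro sum.cong) auto
      also have "\<dots> = (if x = i \<or> y = i then 0 else (\<Sum>e\<in>F. \<phi> x e * \<phi> y e))"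
        by simp
      finally have *: "(\<Sum>e\<in>insert i F. ?\<phi> x e * ?\<phi> y e) =
          B x i * B y i / b + (if x = i \<or> y = i then 0 else (\<Sum>e\<in>F. \<phi> x e * \<phi> y e))" .
      have yi: "B y i = B i y" using sym that by blast
      have "B x y = B x i * B i y / b" if "x = i \<or> y = i"
        using that b by (auto simp: b_def)
      moreover have "B x y = B x i * B i y / b + (\<Sum>e\<in>F. \<phi> x e * \<phi> y e)" if "x \<noteq> i" "y \<noteq> i"
      proof -
        have "B' x y = (\<Sum>e\<in>F. \<phi> x e * \<phi> y e)"
          using \<phi> that \<open>x \<in> insert i F\<close> \<open>y \<in> insert i F\<close> by blast
        then show ?thesis by (simp add: B'_def)
      qed
      ultimately have "B x y = B x i * B i y / b +
          (if x = i \<or> y = i then 0 else (\<Sum>e\<in>F. \<phi> x e * \<phi> y e))"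
        by (cases "x = i \<or> y = i") (simp_all only: if_True if_False add_0_right simp_thms de_Morgan_disj)
      then show ?thesis by (intro trans[OF _ *[symmetric]]) (simp only: yi)
    qed
    then show ?thesis by (intro exI[of _ ?\<phi>] ballI)
  qed
qed

text \<open>In a composition this is the factor of one outer coordinate: a multiple of the identity
  where the outer labels agree, \<open>G\<close> or its transpose where they differ.\<close>

definition block_kernel :: "'d set \<Rightarrow> 'd set \<Rightarrow> ('d \<Rightarrow> 'd \<Rightarrow> real) \<Rightarrow> real \<Rightarrow> 'd \<Rightarrow> 'd \<Rightarrow> real" where
  "block_kernel R C G \<beta> x y =
     (if x \<in> R \<and> y \<in> C then G x y else if x \<in> C \<and> y \<in> R then G y x
      else if x = y then \<beta> else 0)"

text \<open>The form of the kernel at \<open>z\<close> is \<beta> times the squared norms plus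
  \<open>2 * bil R C G z z\<close>; the bound \<open>form_le\<close> with the sign of one argument
  reversed makes it nonnegative.\<close>

lemma block_kernel_gram:
  assumes fin: "finite R" "finite C" and disj: "R \<inter> C = {}" and le: "form_le R C G \<beta>"
  shows "\<exists>\<phi>::'d \<Rightarrow> 'd \<Rightarrow> real. \<forall>x\<in>R \<union> C. \<forall>y\<in>R \<union> C.
           block_kernel R C G \<beta> x y = (\<Sum>e\<in>R \<union> C. \<phi> x e * \<phi> y e)"
proof (rule psd_gram)
  have K: "block_kernel R C G \<beta> x y = G x y" "block_kernel R C G \<beta> y x = G x y"
    if "x \<in> R" "y \<in> C" for x y
    using that disj by (auto simp: block_kernel_def disjoint_iff)
  have K': "block_kernel R C G \<beta> x y = (if x = y then \<beta> else 0)"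
    if "x \<in> R \<and> y \<in> R \<or> x \<in> C \<and> y \<in> C" for x y
  proof -
    have "(x \<in> R \<and> y \<in> C) = False" "(x \<in> C \<and> y \<in> R) = False" using that disj by auto
    then show ?thesis unfolding block_kernel_def by (simp only: if_False)
  qed
  show "finite (R \<union> C)" using fin by simp
  show "block_kernel R C G \<beta> x y = block_kernel R C G \<beta> y x"
    if "x \<in> R \<union> C" "y \<in> R \<union> C" for x y
  proof -
    consider "x \<in> R" "y \<in> C" | "x \<in> C" "y \<in> R" | "x \<in> R \<and> y \<in> R \<or> x \<in> C \<and> y \<in> C"
      using \<open>x \<in> R \<union> C\<close> \<open>y \<in> R \<union> C\<close> by blast
    then show ?thesis
    proof cases
      case 1 then show ?thesis by (simp only: K)
    next
      case 2 then show ?thesis by (simp only: K)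
    next
      case 3
      then have "y \<in> R \<and> x \<in> R \<or> y \<in> C \<and> x \<in> C" by blast
      with 3 show ?thesis unfolding K'[OF 3] by (subst K') (simp_all add: eq_commute)
    qed
  qed
  show "0 \<le> (\<Sum>x\<in>R \<union> C. \<Sum>y\<in>R \<union> C. z x * block_kernel R C G \<beta> x y * z y)" for z
  proof -
    let ?B = "block_kernel R C G \<beta>"
    have U: "(\<Sum>x\<in>R \<union> C. g x) = (\<Sum>x\<in>R. g x) + (\<Sum>x\<in>C. g x)" for g :: "'d \<Rightarrow> real"
      using fin disj by (intro sum.union_disjoint)
    have RR: "(\<Sum>x\<in>R. \<Sum>y\<in>R. z x * ?B x y * z y) = \<beta> * (\<Sum>x\<in>R. (z x)\<^sup>2)"
    proof -
      have "(\<Sum>x\<in>R. \<Sum>y\<in>R. z x * ?B x y * z y) = (\<Sum>x\<in>R. \<Sum>y\<in>R. if x = y then \<beta> * (z x)\<^sup>2 else 0)"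
        by (intro sum.cong refl) (simp add: K' power2_eq_square)
      then show ?thesis using fin by (simp add: sum_distrib_left)
    qed
    have CC: "(\<Sum>x\<in>C. \<Sum>y\<in>C. z x * ?B x y * z y) = \<beta> * (\<Sum>x\<in>C. (z x)\<^sup>2)"
    proof -
      have "(\<Sum>x\<in>C. \<Sum>y\<in>C. z x * ?B x y * z y) = (\<Sum>x\<in>C. \<Sum>y\<in>C. if x = y then \<beta> * (z x)\<^sup>2 else 0)"
        by (intro sum.cong refl) (simp add: K' power2_eq_square)
      then show ?thesis using fin by (simp add: sum_distrib_left)
    qed
    have RC: "(\<Sum>x\<in>R. \<Sum>y\<in>C. z x * ?B x y * z y) = bil R C G z z"
      unfolding bil_def by (intro sum.cong refl) (simp add: K)
    have "(\<Sum>x\<in>C. \<Sum>y\<in>R. z x * ?B x y * z y) = (\<Sum>y\<in>R. \<Sum>x\<in>C. z x * ?B x y * z y)"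
      by (rule sum.swap)
    also have "\<dots> = bil R C G z z"
      unfolding bil_def by (intro sum.cong refl) (simp add: K)
    finally have CR: "(\<Sum>x\<in>C. \<Sum>y\<in>R. z x * ?B x y * z y) = bil R C G z z" .
    have "(\<Sum>x\<in>R \<union> C. \<Sum>y\<in>R \<union> C. z x * ?B x y * z y) =
       \<beta> * ((\<Sum>x\<in>R. (z x)\<^sup>2) + (\<Sum>x\<in>C. (z x)\<^sup>2)) + 2 * bil R C G z z"
      unfolding U sum.distrib RR CC RC CR by (simp add: algebra_simps)
    moreover have "- (2 * bil R C G z z) \<le> \<beta> * ((\<Sum>x\<in>R. (z x)\<^sup>2) + (\<Sum>x\<in>C. (z x)\<^sup>2))"
      using form_leD[OF le, of "\<lambda>x. - z x" z] by (simp add: bil_uminus)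
    ultimately show ?thesis by linarith
  qed
qed

text \<open>The Gram vectors of the kernels \<open>K p\<close> reduce the form to copies of \<open>A\<close>, and those belonging to
  one side of \<open>Z\<close> are orthogonal with squared length \<open>\<beta> p\<close>.\<close>

lemma form_le_tensor:
  fixes A :: "'a \<Rightarrow> 'b \<Rightarrow> real" and Z :: "bool \<Rightarrow> 'd set" and K :: "'p \<Rightarrow> 'd \<Rightarrow> 'd \<Rightarrow> real"
    and lf :: "'a \<Rightarrow> 'p \<Rightarrow> bool" and lg :: "'b \<Rightarrow> 'p \<Rightarrow> bool"
  assumes fin: "finite P" "finite R" "finite C" "\<And>b. finite (Z b)"
    and le: "form_le R C A \<alpha>"
    and gram: "\<And>p. p \<in> P \<Longrightarrow> \<exists>\<phi>::'d \<Rightarrow> 'd \<Rightarrow> real. \<forall>x\<in>Z True \<union> Z False. \<forall>y\<in>Z True \<union> Z False.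
           K p x y = (\<Sum>e\<in>Z True \<union> Z False. \<phi> x e * \<phi> y e)"
    and diag: "\<And>p b x y. p \<in> P \<Longrightarrow> x \<in> Z b \<Longrightarrow> y \<in> Z b \<Longrightarrow> K p x y = (if x = y then \<beta> p else 0)"
  shows "form_le (SIGMA a:R. PiE P (\<lambda>p. Z (lf a p))) (SIGMA b:C. PiE P (\<lambda>p. Z (lg b p)))
           (\<lambda>ax by. A (fst ax) (fst by) * (\<Prod>p\<in>P. K p (snd ax p) (snd by p))) (\<alpha> * (\<Prod>p\<in>P. \<beta> p))"
proof (rule form_leI)
  fix u :: "'a \<times> ('p \<Rightarrow> 'd) \<Rightarrow> real" and v :: "'b \<times> ('p \<Rightarrow> 'd) \<Rightarrow> real"
  define E where "E = Z True \<union> Z False"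
  have finE: "finite E" using fin by (simp add: E_def)
  have ZE: "Z b \<subseteq> E" for b by (cases b) (auto simp: E_def)
  obtain \<phi> where \<phi>: "\<And>p x y. p \<in> P \<Longrightarrow> x \<in> E \<Longrightarrow> y \<in> E \<Longrightarrow> K p x y = (\<Sum>e\<in>E. \<phi> p x e * \<phi> p y e)"
    using gram unfolding E_def[symmetric] by metis
  define \<Phi> where "\<Phi> = (\<lambda>X e. \<Prod>p\<in>P. \<phi> p (X p) (e p))"
  define EE where "EE = PiE P (\<lambda>_. E)"
  have finEE: "finite EE" unfolding EE_def by (intro finite_PiE) (use fin finE in auto)
  define XX where "XX = (\<lambda>L::'p \<Rightarrow> bool. PiE P (\<lambda>p. Z (L p)))"
  have finXX: "finite (XX L)" for L unfolding XX_def by (intro finite_PiE) (use fin in auto)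
  have prodK: "(\<Prod>p\<in>P. K p (X p) (Y p)) = (\<Sum>e\<in>EE. \<Phi> X e * \<Phi> Y e)"
    if "X \<in> XX L" "Y \<in> XX L'" for X Y L L'
  proof -
    have "(\<Prod>p\<in>P. K p (X p) (Y p)) = (\<Prod>p\<in>P. \<Sum>e\<in>E. \<phi> p (X p) e * \<phi> p (Y p) e)"
      using that ZE by (intro prod.cong refl \<phi>) (auto simp: XX_def PiE_iff subset_iff)
    also have "\<dots> = (\<Sum>e\<in>EE. \<Prod>p\<in>P. \<phi> p (X p) (e p) * \<phi> p (Y p) (e p))"
      unfolding EE_def by (intro prod_sum_PiE) (use fin finE in auto)
    finally show ?thesis by (simp add: \<Phi>_def prod.distrib)
  qed
  have norm: "(\<Sum>e\<in>EE. (\<Sum>X\<in>XX L. w X * \<Phi> X e)\<^sup>2) = (\<Prod>p\<in>P. \<beta> p) * (\<Sum>X\<in>XX L. (w X)\<^sup>2)"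
    for L and w :: "('p \<Rightarrow> 'd) \<Rightarrow> real"
  proof -
    have "(\<Sum>e\<in>EE. (\<Sum>X\<in>XX L. w X * \<Phi> X e)\<^sup>2) =
        (\<Sum>e\<in>EE. \<Sum>X\<in>XX L. \<Sum>Y\<in>XX L. w X * w Y * (\<Phi> X e * \<Phi> Y e))"
      unfolding power2_eq_square sum_product by (intro sum.cong) (auto simp: mult_ac)
    also have "\<dots> = (\<Sum>X\<in>XX L. \<Sum>e\<in>EE. \<Sum>Y\<in>XX L. w X * w Y * (\<Phi> X e * \<Phi> Y e))"
      by (rule sum.swap)
    also have "\<dots> = (\<Sum>X\<in>XX L. \<Sum>Y\<in>XX L. \<Sum>e\<in>EE. w X * w Y * (\<Phi> X e * \<Phi> Y e))"
      by (rule sum.cong[OF refl], rule sum.swap)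
    also have "\<dots> = (\<Sum>X\<in>XX L. \<Sum>Y\<in>XX L. w X * w Y * (\<Prod>p\<in>P. K p (X p) (Y p)))"
      by (intro sum.cong refl) (simp add: prodK sum_distrib_left)
    also have "\<dots> = (\<Sum>X\<in>XX L. \<Sum>Y\<in>XX L. if X = Y then (\<Prod>p\<in>P. \<beta> p) * (w X)\<^sup>2 else 0)"
    proof (intro sum.cong refl)
      fix X Y assume X: "X \<in> XX L" and Y: "Y \<in> XX L"
      have K: "K p (X p) (Y p) = (if X p = Y p then \<beta> p else 0)" if "p \<in> P" for p
        using X Y that by (intro diag[of p _ "L p"]) (auto simp: XX_def)
      show "w X * w Y * (\<Prod>p\<in>P. K p (X p) (Y p)) = (if X = Y then (\<Prod>p\<in>P. \<beta> p) * (w X)\<^sup>2 else 0)"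
      proof (cases "X = Y")
        case True
        then have "(\<Prod>p\<in>P. K p (X p) (Y p)) = (\<Prod>p\<in>P. \<beta> p)" using K by (intro prod.cong) auto
        with True show ?thesis by (simp add: power2_eq_square)
      next
        case False
        then obtain p where "p \<in> P" "X p \<noteq> Y p" using X Y unfolding XX_def by (metis PiE_ext)
        then have "(\<Prod>p\<in>P. K p (X p) (Y p)) = 0"
          using K fin by (intro prod_zero) auto
        with False show ?thesis by simp
      qed
    qed
    also have "\<dots> = (\<Prod>p\<in>P. \<beta> p) * (\<Sum>X\<in>XX L. (w X)\<^sup>2)"
      using finXX by (simp add: sum_distrib_left)
    finally show ?thesis .
  qed
  \<comment> \<open>For each \<open>e\<close> the form of \<open>A\<close> is evaluated at the
    contractions of \<open>u\<close> and \<open>v\<close> with the Gram vectors. The set contracted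
    over varies with \<open>a\<close> through \<open>lf\<close>, so the rows need not form a product
    set.\<close>
  define s where "s = (\<lambda>e a. \<Sum>X\<in>XX (lf a). u (a, X) * \<Phi> X e)"
  define t where "t = (\<lambda>e b. \<Sum>Y\<in>XX (lg b). v (b, Y) * \<Phi> Y e)"
  let ?M = "\<lambda>ax by. A (fst ax) (fst by) * (\<Prod>p\<in>P. K p (snd ax p) (snd by p))"
  have S: "(\<Sum>z\<in>(SIGMA a:R. XX (lf a)). g z) = (\<Sum>a\<in>R. \<Sum>X\<in>XX (lf a). g (a, X))"
    for g :: "_ \<Rightarrow> real" by (subst sum.Sigma) (use fin finXX in auto)
  have S': "(\<Sum>z\<in>(SIGMA b:C. XX (lg b)). g z) = (\<Sum>b\<in>C. \<Sum>Y\<in>XX (lg b). g (b, Y))"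
    for g :: "_ \<Rightarrow> real" by (subst sum.Sigma) (use fin finXX in auto)
  have ab: "(\<Sum>X\<in>XX (lf a). \<Sum>Y\<in>XX (lg b). u (a, X) * ?M (a, X) (b, Y) * v (b, Y)) =
      (\<Sum>e\<in>EE. s e a * A a b * t e b)" for a b
  proof -
    have "(\<Sum>X\<in>XX (lf a). \<Sum>Y\<in>XX (lg b). u (a, X) * ?M (a, X) (b, Y) * v (b, Y)) =
       (\<Sum>X\<in>XX (lf a). \<Sum>Y\<in>XX (lg b). \<Sum>e\<in>EE. A a b * ((u (a, X) * \<Phi> X e) * (v (b, Y) * \<Phi> Y e)))"
      by (intro sum.cong refl) (simp add: prodK sum_distrib_left sum_distrib_right mult_ac)
    also have "\<dots> = (\<Sum>X\<in>XX (lf a). \<Sum>e\<in>EE. \<Sum>Y\<in>XX (lg b). A a b * ((u (a, X) * \<Phi> X e) * (v (b, Y) * \<Phi> Y e)))"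
      by (rule sum.cong[OF refl], rule sum.swap)
    also have "\<dots> = (\<Sum>e\<in>EE. \<Sum>X\<in>XX (lf a). \<Sum>Y\<in>XX (lg b). A a b * ((u (a, X) * \<Phi> X e) * (v (b, Y) * \<Phi> Y e)))"
      by (rule sum.swap)
    also have "\<dots> = (\<Sum>e\<in>EE. A a b * (s e a * t e b))"
      unfolding s_def t_def sum_product by (simp add: sum_distrib_left)
    finally show ?thesis by (simp add: mult_ac)
  qed
  have "bil (SIGMA a:R. XX (lf a)) (SIGMA b:C. XX (lg b)) ?M u v =
     (\<Sum>a\<in>R. \<Sum>X\<in>XX (lf a). \<Sum>b\<in>C. \<Sum>Y\<in>XX (lg b). u (a, X) * ?M (a, X) (b, Y) * v (b, Y))"
    unfolding bil_def S S' by simp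
  also have "\<dots> = (\<Sum>a\<in>R. \<Sum>b\<in>C. \<Sum>X\<in>XX (lf a). \<Sum>Y\<in>XX (lg b). u (a, X) * ?M (a, X) (b, Y) * v (b, Y))"
    by (rule sum.cong[OF refl], rule sum.swap)
  also have "\<dots> = (\<Sum>a\<in>R. \<Sum>b\<in>C. \<Sum>e\<in>EE. s e a * A a b * t e b)"
    unfolding ab ..
  also have "\<dots> = (\<Sum>a\<in>R. \<Sum>e\<in>EE. \<Sum>b\<in>C. s e a * A a b * t e b)"
    by (rule sum.cong[OF refl], rule sum.swap)
  also have "\<dots> = (\<Sum>e\<in>EE. bil R C A (s e) (t e))"
    unfolding bil_def by (rule sum.swap)
  finally have "2 * bil (SIGMA a:R. XX (lf a)) (SIGMA b:C. XX (lg b)) ?M u v = (\<Sum>e\<in>EE. 2 * bil R C A (s e) (t e))"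
    by (simp add: sum_distrib_left)
  also have "\<dots> \<le> (\<Sum>e\<in>EE. \<alpha> * ((\<Sum>a\<in>R. (s e a)\<^sup>2) + (\<Sum>b\<in>C. (t e b)\<^sup>2)))"
    by (intro sum_mono form_leD[OF le])
  also have "\<dots> = \<alpha> * ((\<Sum>e\<in>EE. \<Sum>a\<in>R. (s e a)\<^sup>2) + (\<Sum>e\<in>EE. \<Sum>b\<in>C. (t e b)\<^sup>2))"
    by (simp add: sum_distrib_left[symmetric] sum.distrib)
  also have "(\<Sum>e\<in>EE. \<Sum>a\<in>R. (s e a)\<^sup>2) = (\<Sum>a\<in>R. (\<Prod>p\<in>P. \<beta> p) * (\<Sum>X\<in>XX (lf a). (u (a, X))\<^sup>2))"
    by (subst sum.swap) (simp add: s_def norm)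
  also have "(\<Sum>e\<in>EE. \<Sum>b\<in>C. (t e b)\<^sup>2) = (\<Sum>b\<in>C. (\<Prod>p\<in>P. \<beta> p) * (\<Sum>Y\<in>XX (lg b). (v (b, Y))\<^sup>2))"
    by (subst sum.swap) (simp add: t_def norm)
  finally show "2 * bil (SIGMA a:R. PiE P (\<lambda>p. Z (lf a p))) (SIGMA b:C. PiE P (\<lambda>p. Z (lg b p))) ?M u v
     \<le> \<alpha> * (\<Prod>p\<in>P. \<beta> p) * ((\<Sum>z\<in>(SIGMA a:R. PiE P (\<lambda>p. Z (lf a p))). (u z)\<^sup>2) + (\<Sum>z\<in>(SIGMA b:C. PiE P (\<lambda>p. Z (lg b p))). (v z)\<^sup>2))"
    using S[of "\<lambda>z. (u z)\<^sup>2"] S'[of "\<lambda>z. (v z)\<^sup>2"] unfolding XX_def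
    by (simp add: sum_distrib_left mult_ac distrib_left)
qed



lemma form_le_cong:
  assumes "\<And>r c. r \<in> R \<Longrightarrow> c \<in> C \<Longrightarrow> M r c = M' r c"
  shows "form_le R C M \<beta> \<longleftrightarrow> form_le R C M' \<beta>"
  unfolding form_le_def using bil_cong[of R C M M', OF assms] by simp

section \<open>Adversary matrices and their composition\<close>

text \<open>The Hadamard product of \<open>G\<close> with the 0-1 matrix of the pairs that a query
  to \<open>p\<close> tells apart.\<close>

definition query_part :: "('c \<Rightarrow> 'p \<Rightarrow> bool) \<Rightarrow> 'p \<Rightarrow> ('c \<Rightarrow> 'c \<Rightarrow> real) \<Rightarrow> 'c \<Rightarrow> 'c \<Rightarrow> real" where
  "query_part lab p G r c = (if lab r p \<noteq> lab c p then G r c else 0)"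

text \<open>Rows and columns are indexed by abstract objects, of which several may be labelled by the same
  input.\<close>

locale adversary =
  fixes P :: "'p set" and f :: "('p \<Rightarrow> bool) \<Rightarrow> bool" and R C :: "'c set"
    and lab :: "'c \<Rightarrow> 'p \<Rightarrow> bool" and G :: "'c \<Rightarrow> 'c \<Rightarrow> real" and w :: "'c \<Rightarrow> real"
    and \<beta> \<mu> :: real
  assumes finite: "finite P" "finite R" "finite C"
    and lab_R: "\<And>r. r \<in> R \<Longrightarrow> f (lab r)"
    and lab_C: "\<And>c. c \<in> C \<Longrightarrow> \<not> f (lab c)"
    and norm_R: "(\<Sum>r\<in>R. (w r)\<^sup>2) = 1"
    and norm_C: "(\<Sum>c\<in>C. (w c)\<^sup>2) = 1"
    and attained: "bil R C G w w = \<beta>"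
    and le: "form_le R C G \<beta>"
    and le_query: "\<And>p. p \<in> P \<Longrightarrow> form_le R C (query_part lab p G) \<mu>"
begin

lemma disjoint: "R \<inter> C = {}"
  using lab_R lab_C by blast

end

definition side :: "'d set \<Rightarrow> 'd set \<Rightarrow> bool \<Rightarrow> 'd set" where
  "side R C b = (if b then R else C)"

lemma side_simps [simp]: "side R C True = R" "side R C False = C"
  by (simp_all add: side_def)

lemma block_kernel_side:
  assumes "R \<inter> C = {}"
  shows "x \<in> side R C b \<Longrightarrow> y \<in> side R C b \<Longrightarrow> block_kernel R C G \<beta> x y = (if x = y then \<beta> else 0)"
    and "x \<in> R \<Longrightarrow> y \<in> C \<Longrightarrow> block_kernel R C G \<beta> x y = G x y"
    and "x \<in> R \<Longrightarrow> y \<in> C \<Longrightarrow> block_kernel R C G \<beta> y x = G x y"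
proof -
  show "block_kernel R C G \<beta> x y = (if x = y then \<beta> else 0)" if "x \<in> side R C b" "y \<in> side R C b"
  proof -
    have "(x \<in> R \<and> y \<in> C) = False" "(x \<in> C \<and> y \<in> R) = False"
      using that assms by (auto simp: side_def split: if_splits)
    then show ?thesis unfolding block_kernel_def by (simp only: if_False)
  qed
  show "block_kernel R C G \<beta> x y = G x y" if "x \<in> R" "y \<in> C"
    using that by (simp add: block_kernel_def)
  show "block_kernel R C G \<beta> y x = G x y" if "x \<in> R" "y \<in> C"
    using that assms by (auto simp: block_kernel_def)
qed

lemma sum_sum_prod_PiE:
  fixes h :: "'p \<Rightarrow> 'd \<Rightarrow> 'd \<Rightarrow> real"
  assumes "finite P" "\<And>p. p \<in> P \<Longrightarrow> finite (S p)" "\<And>p. p \<in> P \<Longrightarrow> finite (T p)"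
  shows "(\<Sum>X\<in>PiE P S. \<Sum>Y\<in>PiE P T. \<Prod>p\<in>P. h p (X p) (Y p)) = (\<Prod>p\<in>P. \<Sum>x\<in>S p. \<Sum>y\<in>T p. h p x y)"
proof -
  have "(\<Sum>X\<in>PiE P S. \<Sum>Y\<in>PiE P T. \<Prod>p\<in>P. h p (X p) (Y p)) = (\<Sum>X\<in>PiE P S. \<Prod>p\<in>P. \<Sum>y\<in>T p. h p (X p) y)"
    using assms by (intro sum.cong refl prod_sum_PiE[symmetric]) auto
  also have "\<dots> = (\<Prod>p\<in>P. \<Sum>x\<in>S p. \<Sum>y\<in>T p. h p x y)"
    using assms by (intro prod_sum_PiE[symmetric, where f = "\<lambda>p x. \<Sum>y\<in>T p. h p x y"]) auto
  finally show ?thesis .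
qed

text \<open>A composed row is an outer row \<open>a\<close> together with, for each
  \<open>p\<close>, an inner row or column as \<open>lab a p\<close> prescribes. At the inner
  weights the block kernel has value \<open>\<beta>'\<close> on every pair of sides, so the values
  multiply, and \<open>form_le_tensor\<close> shows that the norms do too. A query to
  \<open>(i, q)\<close> replaces the outer matrix by its part at \<open>i\<close> and the factor
  \<open>i\<close> by the inner part at \<open>q\<close>. The powers of \<open>\<beta>'\<close>
  cancel up to one factor in the ratio of value to query norm, which is therefore the product of the
  two ratios.\<close>

lemma adversary_compose:
  fixes P :: "'p set" and Q :: "'q set" and R :: "'a set" and R' :: "'d set"
  assumes F: "adversary P f R C lab G w \<beta> \<mu>" and H: "adversary Q g R' C' lab' G' w' \<beta>' \<mu>'"
    and dep: "\<And>x y. (\<And>p. p \<in> P \<Longrightarrow> x p = y p) \<Longrightarrow> f x = f y"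
  defines "S \<equiv> \<lambda>a. PiE P (\<lambda>p. side R' C' (lab a p))"
  shows "adversary (P \<times> Q) (\<lambda>x. f (\<lambda>p. g (\<lambda>q. x (p, q)))) (Sigma R S) (Sigma C S)
     (\<lambda>ax pq. lab' (snd ax (fst pq)) (snd pq))
     (\<lambda>ax by. G (fst ax) (fst by) * (\<Prod>p\<in>P. block_kernel R' C' G' \<beta>' (snd ax p) (snd by p)))
     (\<lambda>ax. w (fst ax) * (\<Prod>p\<in>P. w' (snd ax p)))
     (\<beta> * \<beta>' ^ card P) (\<mu> * (\<mu>' * \<beta>' ^ (card P - 1)))"
proof -
  interpret F: adversary P f R C lab G w \<beta> \<mu> by fact
  interpret H: adversary Q g R' C' lab' G' w' \<beta>' \<mu>' by fact
  note disj = H.disjoint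
  note bk = block_kernel_side[OF disj]
  let ?B = "block_kernel R' C' G' \<beta>'"
  let ?Z = "side R' C'"
  let ?lab = "\<lambda>(ax :: 'a \<times> ('p \<Rightarrow> 'd)) pq. lab' (snd ax (fst pq)) (snd pq)"
  let ?G = "\<lambda>ax by. G (fst ax) (fst by) * (\<Prod>p\<in>P. ?B (snd ax p) (snd by p))"
  let ?w = "\<lambda>ax. w (fst ax) * (\<Prod>p\<in>P. w' (snd ax p))"
  have finZ: "finite (?Z b)" for b using H.finite by (cases b) auto
  have finS: "finite (S a)" for a unfolding S_def by (intro finite_PiE) (use F.finite finZ in auto)
  have sumS: "(\<Sum>z\<in>Sigma R S. h z) = (\<Sum>a\<in>R. \<Sum>X\<in>S a. h (a, X))"
       "(\<Sum>z\<in>Sigma C S. h z) = (\<Sum>a\<in>C. \<Sum>X\<in>S a. h (a, X))" for h :: "_ \<Rightarrow> real"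
    by (subst sum.Sigma; use F.finite finS in auto)+
  have val: "f (\<lambda>p. g (\<lambda>q. ?lab (a, X) (p, q))) = f (lab a)" if "X \<in> S a" for a X
  proof (rule dep)
    fix p assume p: "p \<in> P"
    have "X p \<in> ?Z (lab a p)" using that p by (auto simp: S_def)
    then show "g (\<lambda>q. ?lab (a, X) (p, q)) = lab a p"
      using H.lab_R H.lab_C by (cases "lab a p") auto
  qed
  have Znorm: "(\<Sum>x\<in>?Z b. (w' x)\<^sup>2) = 1" for b
    using H.norm_R H.norm_C by (cases b) auto
  have norm: "(\<Sum>X\<in>S a. (\<Prod>p\<in>P. w' (X p))\<^sup>2) = 1" for a
  proof -
    have "(\<Sum>X\<in>S a. (\<Prod>p\<in>P. w' (X p))\<^sup>2) = (\<Sum>X\<in>S a. \<Prod>p\<in>P. (w' (X p))\<^sup>2)"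
      by (simp add: prod_power_distrib)
    also have "\<dots> = (\<Prod>p\<in>P. \<Sum>x\<in>?Z (lab a p). (w' x)\<^sup>2)"
      unfolding S_def by (rule prod_sum_PiE[symmetric]) (use F.finite finZ in auto)
    finally show ?thesis by (simp add: Znorm)
  qed
  have norm': "(\<Sum>a\<in>A. \<Sum>X\<in>S a. (?w (a, X))\<^sup>2) = (\<Sum>a\<in>A. (w a)\<^sup>2)" for A
    by (simp add: power_mult_distrib sum_distrib_left[symmetric] norm)
  have Zval: "(\<Sum>x\<in>?Z b. \<Sum>y\<in>?Z b'. w' x * ?B x y * w' y) = \<beta>'" for b b'
  proof (cases "b = b'")
    case True
    have "(\<Sum>x\<in>?Z b. \<Sum>y\<in>?Z b. w' x * ?B x y * w' y) = (\<Sum>x\<in>?Z b. \<Sum>y\<in>?Z b. if x = y then \<beta>' * (w' x)\<^sup>2 else 0)"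
      by (intro sum.cong refl) (simp add: bk(1) power2_eq_square)
    also have "\<dots> = \<beta>'" using finZ Znorm by (simp add: sum_distrib_left[symmetric])
    finally show ?thesis using True by simp
  next
    case False
    have 1: "(\<Sum>x\<in>R'. \<Sum>y\<in>C'. w' x * ?B x y * w' y) = \<beta>'"
      unfolding H.attained[symmetric] bil_def by (intro sum.cong refl) (simp add: bk)
    have "(\<Sum>x\<in>C'. \<Sum>y\<in>R'. w' x * ?B x y * w' y) = (\<Sum>y\<in>R'. \<Sum>x\<in>C'. w' x * ?B x y * w' y)"
      by (rule sum.swap)
    also have "\<dots> = \<beta>'"
      unfolding H.attained[symmetric] bil_def by (intro sum.cong refl) (simp add: bk)
    finally show ?thesis using 1 False by (cases b; cases b') auto
  qed
  have XY: "(\<Sum>X\<in>S a. \<Sum>Y\<in>S b. ?w (a, X) * ?G (a, X) (b, Y) * ?w (b, Y)) = w a * G a b * w b * \<beta>' ^ card P" for a b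
  proof -
    have "(\<Sum>X\<in>S a. \<Sum>Y\<in>S b. ?w (a, X) * ?G (a, X) (b, Y) * ?w (b, Y)) =
       (\<Sum>X\<in>S a. \<Sum>Y\<in>S b. w a * G a b * w b * (\<Prod>p\<in>P. w' (X p) * ?B (X p) (Y p) * w' (Y p)))"
      by (simp add: prod.distrib mult_ac)
    also have "\<dots> = w a * G a b * w b * (\<Sum>X\<in>S a. \<Sum>Y\<in>S b. \<Prod>p\<in>P. w' (X p) * ?B (X p) (Y p) * w' (Y p))"
      by (simp add: sum_distrib_left)
    also have "(\<Sum>X\<in>S a. \<Sum>Y\<in>S b. \<Prod>p\<in>P. w' (X p) * ?B (X p) (Y p) * w' (Y p)) = 
        (\<Prod>p\<in>P. \<Sum>x\<in>?Z (lab a p). \<Sum>y\<in>?Z (lab b p). w' x * ?B x y * w' y)"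
      unfolding S_def by (rule sum_sum_prod_PiE) (use F.finite finZ in auto)
    also have "\<dots> = \<beta>' ^ card P" by (simp add: Zval)
    finally show ?thesis .
  qed
  show ?thesis
  proof
    show "finite (P \<times> Q)" "finite (Sigma R S)" "finite (Sigma C S)"
      using F.finite H.finite finS by auto
    show "f (\<lambda>p. g (\<lambda>q. ?lab r (p, q)))" if "r \<in> Sigma R S" for r
      using that val F.lab_R by (cases r) auto
    show "\<not> f (\<lambda>p. g (\<lambda>q. ?lab r (p, q)))" if "r \<in> Sigma C S" for r
      using that val F.lab_C by (cases r) auto
    show "(\<Sum>r\<in>Sigma R S. (?w r)\<^sup>2) = 1" unfolding sumS norm' by (rule F.norm_R)
    show "(\<Sum>r\<in>Sigma C S. (?w r)\<^sup>2) = 1" unfolding sumS norm' by (rule F.norm_C)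
    have "bil (Sigma R S) (Sigma C S) ?G ?w ?w =
       (\<Sum>a\<in>R. \<Sum>X\<in>S a. \<Sum>b\<in>C. \<Sum>Y\<in>S b. ?w (a, X) * ?G (a, X) (b, Y) * ?w (b, Y))"
      unfolding bil_def sumS ..
    also have "\<dots> = (\<Sum>a\<in>R. \<Sum>b\<in>C. \<Sum>X\<in>S a. \<Sum>Y\<in>S b. ?w (a, X) * ?G (a, X) (b, Y) * ?w (b, Y))"
      by (rule sum.cong[OF refl], rule sum.swap)
    also have "\<dots> = bil R C G w w * \<beta>' ^ card P"
      unfolding XY bil_def by (simp add: sum_distrib_right)
    finally show "bil (Sigma R S) (Sigma C S) ?G ?w ?w = \<beta> * \<beta>' ^ card P" by (simp add: F.attained)
    have gram: "\<exists>\<phi>::'d \<Rightarrow> 'd \<Rightarrow> real. \<forall>x\<in>?Z True \<union> ?Z False. \<forall>y\<in>?Z True \<union> ?Z False.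
        block_kernel R' C' M b x y = (\<Sum>e\<in>?Z True \<union> ?Z False. \<phi> x e * \<phi> y e)"
      if "form_le R' C' M b" for M b
      unfolding side_simps by (rule block_kernel_gram[OF H.finite(2,3) disj that])
    have "form_le (Sigma R S) (Sigma C S) ?G (\<beta> * (\<Prod>p\<in>P. \<beta>'))"
      unfolding S_def
      by (rule form_le_tensor[where K = "\<lambda>_. ?B", OF F.finite finZ F.le gram bk(1)]) (rule H.le)
    then show "form_le (Sigma R S) (Sigma C S) ?G (\<beta> * \<beta>' ^ card P)" by simp
    fix iq assume iq: "iq \<in> P \<times> Q"
    define i q where "i = fst iq" and "q = snd iq"
    have i: "i \<in> P" and q: "q \<in> Q" using iq by (auto simp: i_def q_def)
    define K where "K = (\<lambda>p. if p = i then block_kernel R' C' (query_part lab' q G') \<mu>' else ?B)"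
    have gramK: "\<exists>\<phi>::'d \<Rightarrow> 'd \<Rightarrow> real. \<forall>x\<in>?Z True \<union> ?Z False. \<forall>y\<in>?Z True \<union> ?Z False.
        K p x y = (\<Sum>e\<in>?Z True \<union> ?Z False. \<phi> x e * \<phi> y e)" if "p \<in> P" for p
      by (cases "p = i") (simp_all only: K_def if_True if_False gram[OF H.le] gram[OF H.le_query[OF q]] simp_thms)
    have diagK: "K p x y = (if x = y then (if p = i then \<mu>' else \<beta>') else 0)"
      if "p \<in> P" "x \<in> ?Z b" "y \<in> ?Z b" for p b x y
      by (cases "p = i") (simp_all only: K_def simp_thms if_True if_False bk(1)[OF that(2,3)])
    have le: "form_le (Sigma R S) (Sigma C S)
          (\<lambda>ax by. query_part lab i G (fst ax) (fst by) * (\<Prod>p\<in>P. K p (snd ax p) (snd by p)))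
          (\<mu> * (\<Prod>p\<in>P. if p = i then \<mu>' else \<beta>'))"
      unfolding S_def by (rule form_le_tensor[OF F.finite finZ F.le_query[OF i] gramK diagK])
    have "(\<Prod>p\<in>P. if p = i then \<mu>' else \<beta>') = \<mu>' * (\<Prod>p\<in>P - {i}. if p = i then \<mu>' else \<beta>')"
      using F.finite i by (subst prod.remove[of P i]) auto
    also have "(\<Prod>p\<in>P - {i}. if p = i then \<mu>' else \<beta>') = (\<Prod>p\<in>P - {i}. \<beta>')" by (rule prod.cong) auto
    also have "\<dots> = \<beta>' ^ (card P - 1)" using F.finite i by simp
    finally have pr: "(\<Prod>p\<in>P. if p = i then \<mu>' else \<beta>') = \<mu>' * \<beta>' ^ (card P - 1)" .
    \<comment> \<open>If the outer labels agree at \<open>i\<close>, the block kernel is diagonal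
      there: either \<open>X i = Y i\<close>, and the query sees no difference, or the factor is 0.
      So both sides vanish.\<close>
    have eq: "query_part ?lab iq ?G ax cy = query_part lab i G (fst ax) (fst cy) * (\<Prod>p\<in>P. K p (snd ax p) (snd cy p))"
      if "ax \<in> Sigma R S" "cy \<in> Sigma C S" for ax cy
    proof -
      obtain a X b Y where ax: "ax = (a, X)" and cy: "cy = (b, Y)" by (metis prod.exhaust)
      have X: "X p \<in> ?Z (lab a p)" and Y: "Y p \<in> ?Z (lab b p)" if "p \<in> P" for p
        using that \<open>ax \<in> Sigma R S\<close> \<open>cy \<in> Sigma C S\<close> by (auto simp: ax cy S_def)
      have split: "(\<Prod>p\<in>P. M p) = M i * (\<Prod>p\<in>P - {i}. M p)" for M :: "'p \<Rightarrow> real"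
        using F.finite(1) i by (rule prod.remove)
      have rest: "(\<Prod>p\<in>P - {i}. K p (X p) (Y p)) = (\<Prod>p\<in>P - {i}. ?B (X p) (Y p))"
        by (rule prod.cong) (auto simp: K_def)
      show ?thesis
      proof (cases "lab a i = lab b i")
        case True
        then have "?B (X i) (Y i) = (if X i = Y i then \<beta>' else 0)" using X[OF i] Y[OF i] by (intro bk(1)) auto
        then have "query_part ?lab iq ?G ax cy = 0"
          unfolding query_part_def ax cy split by (auto simp: i_def[symmetric])
        moreover have "query_part lab i G a b = 0" using True by (simp add: query_part_def)
        ultimately show ?thesis by (simp add: ax cy)
      next
        case False
        have "K i (X i) (Y i) = (if lab' (X i) q \<noteq> lab' (Y i) q then ?B (X i) (Y i) else 0)"
          using X[OF i] Y[OF i] False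
          by (cases "lab a i"; cases "lab b i") (simp_all add: K_def bk query_part_def)
        then show ?thesis
          using False unfolding query_part_def ax cy split fst_conv snd_conv rest i_def[symmetric] q_def[symmetric]
          by simp
      qed
    qed
    show "form_le (Sigma R S) (Sigma C S) (query_part ?lab iq ?G) (\<mu> * (\<mu>' * \<beta>' ^ (card P - 1)))"
      using le unfolding pr 
      by (subst form_le_cong[where M' = "\<lambda>ax by. query_part lab i G (fst ax) (fst by) * (\<Prod>p\<in>P. K p (snd ax p) (snd by p))"])
         (simp_all only: eq)
  qed
qed



section \<open>The adversary bound for quantum query algorithms\<close>

lemma adversary_rate_nonneg:
  assumes "adversary P f R C lab G w \<beta> \<mu>"
  shows "0 \<le> \<beta>" and "p \<in> P \<Longrightarrow> 0 \<le> \<mu>"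
proof -
  interpret adversary P f R C lab G w \<beta> \<mu> by fact
  show "0 \<le> \<beta>" using form_le_abs[OF le, of w w] by (simp add: norm_R norm_C)
  show "0 \<le> \<mu>" if "p \<in> P" using form_le_abs[OF le_query[OF that], of w w] by (simp add: norm_R norm_C)
qed

section \<open>Unitaries and the oracle in coordinates\<close>

definition ip :: "nat \<Rightarrow> complex vec \<Rightarrow> complex vec \<Rightarrow> complex" where
  "ip d x y = (\<Sum>k<d. cnj (x $ k) * y $ k)"

lemma mat_adjoint_index:
  fixes U :: "complex mat"
  assumes "U \<in> carrier_mat d d" "i < d" "j < d"
  shows "mat_adjoint U $$ (i, j) = cnj (U $$ (j, i))"
  using assms unfolding mat_adjoint_def by (simp add: mat_of_rows_index)

lemma unitary_ip:
  assumes U: "unitary_mat d U" and x: "x \<in> carrier_vec d" and y: "y \<in> carrier_vec d"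
  shows "ip d (U *\<^sub>v x) (U *\<^sub>v y) = ip d x y"
proof -
  have Uc: "U \<in> carrier_mat d d" using U by (simp add: unitary_mat_def)
  have orth: "(\<Sum>k<d. cnj (U $$ (k, i)) * U $$ (k, j)) = (if i = j then 1 else 0)"
    if "i < d" "j < d" for i j
  proof -
    have "(mat_adjoint U * U) $$ (i, j) = (\<Sum>k<d. cnj (U $$ (k, i)) * U $$ (k, j))"
    proof -
      have "dim_row (mat_adjoint U) = d" "dim_col (mat_adjoint U) = d"
        using Uc by (simp_all add: mat_adjoint_def)
      then show ?thesis
        using Uc that by (simp add: scalar_prod_def mat_adjoint_index atLeast0LessThan)
    qed
    then show ?thesis using U that by (simp add: unitary_mat_def)
  qed
  have entry: "(U *\<^sub>v z) $ k = (\<Sum>i<d. U $$ (k, i) * z $ i)" if "z \<in> carrier_vec d" "k < d" for z k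
    using Uc that by (simp add: scalar_prod_def atLeast0LessThan)
  have "ip d (U *\<^sub>v x) (U *\<^sub>v y) =
      (\<Sum>k<d. \<Sum>i<d. \<Sum>j<d. (cnj (x $ i) * y $ j) * (cnj (U $$ (k, i)) * U $$ (k, j)))"
    unfolding ip_def
  proof (intro sum.cong refl)
    fix k assume "k \<in> {..<d}"
    then have "cnj ((U *\<^sub>v x) $ k) * (U *\<^sub>v y) $ k =
        (\<Sum>i<d. cnj (U $$ (k, i)) * cnj (x $ i)) * (\<Sum>j<d. U $$ (k, j) * y $ j)"
      by (simp add: entry x y)
    also have "\<dots> = (\<Sum>i<d. \<Sum>j<d. (cnj (x $ i) * y $ j) * (cnj (U $$ (k, i)) * U $$ (k, j)))"
      unfolding sum_product by (intro sum.cong refl) (simp only: mult_ac)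
    finally show "cnj ((U *\<^sub>v x) $ k) * (U *\<^sub>v y) $ k =
        (\<Sum>i<d. \<Sum>j<d. (cnj (x $ i) * y $ j) * (cnj (U $$ (k, i)) * U $$ (k, j)))" .
  qed
  also have "\<dots> = (\<Sum>i<d. \<Sum>k<d. \<Sum>j<d. (cnj (x $ i) * y $ j) * (cnj (U $$ (k, i)) * U $$ (k, j)))"
    by (rule sum.swap)
  also have "\<dots> = (\<Sum>i<d. \<Sum>j<d. \<Sum>k<d. (cnj (x $ i) * y $ j) * (cnj (U $$ (k, i)) * U $$ (k, j)))"
    by (rule sum.cong[OF refl], rule sum.swap)
  also have "\<dots> = (\<Sum>i<d. \<Sum>j<d. if i = j then cnj (x $ i) * y $ i else 0)"
    by (intro sum.cong refl) (simp add: sum_distrib_left[symmetric] orth)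
  also have "\<dots> = ip d x y" unfolding ip_def by simp
  finally show ?thesis .
qed

text \<open>On the index \<open>2 * (w * N + (i - 1)) + b\<close> this negates the answer bit
  \<open>b\<close>.\<close>

definition flip_bit :: "nat \<Rightarrow> nat" where
  "flip_bit k = (if even k then Suc k else k - 1)"

lemma flip_bit_flip_bit [simp]: "flip_bit (flip_bit k) = k"
  by (auto simp: flip_bit_def)

lemma flip_bit_div [simp]: "flip_bit k div 2 = k div 2"
  by (auto simp: flip_bit_def elim!: evenE oddE)

lemma even_flip_bit [simp]: "even (flip_bit k) \<longleftrightarrow> odd k"
  by (auto simp: flip_bit_def elim!: evenE oddE)

lemma flip_bit_less: "k < 2 * a \<Longrightarrow> flip_bit k < 2 * a"
  by (auto simp: flip_bit_def elim!: evenE oddE)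

lemma query_index_flip_bit [simp]: "query_index N (flip_bit k) = query_index N k"
  by (simp add: query_index_def)

lemma eq_flip_bit: "r div 2 = c div 2 \<Longrightarrow> odd r = even c \<Longrightarrow> c = flip_bit r"
  by (cases "even r"; simp add: flip_bit_def; presburger)

lemma div_2_inj: "k div 2 = c div 2 \<Longrightarrow> odd k = odd c \<Longrightarrow> c = (k :: nat)"
  by (auto elim!: evenE oddE)

lemma query_mat_vec:
  assumes v: "v \<in> carrier_vec (2 * N * m)" and k: "k < 2 * N * m"
  shows "(query_mat N m x *\<^sub>v v) $ k = v $ (if x (query_index N k) then flip_bit k else k)"
proof -
  let ?k = "if x (query_index N k) then flip_bit k else k"
  have k': "?k < 2 * N * m" using k flip_bit_less[of k "N * m"] by simp
  have iff: "(k div 2 = c div 2 \<and> odd k = (odd c \<noteq> x (query_index N c))) \<longleftrightarrow> c = ?k" for c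
  proof
    assume a: "k div 2 = c div 2 \<and> odd k = (odd c \<noteq> x (query_index N c))"
    then have qi: "query_index N c = query_index N k" by (simp add: query_index_def)
    have "c = flip_bit k" if "x (query_index N k)"
      by (rule eq_flip_bit) (use a qi that in auto)
    moreover have "c = k" if "\<not> x (query_index N k)"
      by (rule div_2_inj) (use a qi that in auto)
    ultimately show "c = ?k" by simp
  qed auto
  have "(query_mat N m x *\<^sub>v v) $ k = (\<Sum>c<2 * N * m. query_mat N m x $$ (k, c) * v $ c)"
    using v k by (simp add: scalar_prod_def atLeast0LessThan query_mat_def)
  also have "\<dots> = (\<Sum>c<2 * N * m. if c = ?k then v $ c else 0)"
    by (intro sum.cong refl) (use k iff in \<open>simp add: query_mat_def\<close>)
  also have "\<dots> = v $ ?k" using k' by simp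
  finally show ?thesis .
qed

lemma query_mat_carrier [simp]: "query_mat N m x \<in> carrier_mat (2 * N * m) (2 * N * m)"
  by (simp add: query_mat_def)

lemma query_state_carrier:
  assumes "\<forall>t\<le>T. unitary_mat (2 * N * m) (U t)" "t \<le> T"
  shows "query_state N m U x t \<in> carrier_vec (2 * N * m)"
  using assms(2)
proof (induction t)
  case 0
  then show ?case using assms(1) by (auto simp: unitary_mat_def intro!: mult_mat_vec_carrier)
next
  case (Suc t)
  then show ?case using assms(1)
    by (auto simp: unitary_mat_def simp del: One_nat_def intro!: mult_mat_vec_carrier query_mat_carrier)
qed

lemma sum_flip_bit:
  fixes h :: "nat \<Rightarrow> 'a :: comm_monoid_add"
  shows "(\<Sum>k | k < 2 * N * m \<and> query_index N k = i. h (flip_bit k)) =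
         (\<Sum>k | k < 2 * N * m \<and> query_index N k = i. h k)"
  by (rule sum.reindex_bij_witness[where i = flip_bit and j = flip_bit])
     (auto simp: mult.assoc flip_bit_less)

lemma sum_query_index:
  fixes h :: "nat \<Rightarrow> 'a :: comm_monoid_add"
  shows "(\<Sum>k<2 * N * m. h k) = (\<Sum>i\<in>{1..N}. \<Sum>k | k < 2 * N * m \<and> query_index N k = i. h k)"
proof -
  have "query_index N k \<in> {1..N}" if "k < 2 * N * m" for k
    using that by (cases "N = 0") (auto simp: query_index_def Suc_le_eq)
  then have "query_index N ` {..<2 * N * m} \<subseteq> {1..N}" by auto
  then have "(\<Sum>k<2 * N * m. h k) = (\<Sum>i\<in>{1..N}. \<Sum>k | k \<in> {..<2 * N * m} \<and> query_index N k = i. h k)"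
    by (intro sum.group[symmetric]) auto
  then show ?thesis by simp
qed

text \<open>Reindexing by \<open>flip_bit\<close> cancels a flip that the oracles of
  \<open>x\<close> and \<open>y\<close> have in common and moves a flip of \<open>w\<close> alone to
  \<open>v\<close>. So the inner product changes only at query positions where \<open>x\<close> and
  \<open>y\<close> differ.\<close>

lemma query_ip:
  assumes v: "v \<in> carrier_vec (2 * N * m)" and w: "w \<in> carrier_vec (2 * N * m)"
  shows "ip (2 * N * m) (query_mat N m x *\<^sub>v v) (query_mat N m y *\<^sub>v w) =
    ip (2 * N * m) v w + (\<Sum>i\<in>{1..N}. if x i \<noteq> y i
       then \<Sum>k | k < 2 * N * m \<and> query_index N k = i. cnj (v $ flip_bit k - v $ k) * w $ k else 0)"
proof -
  let ?K = "\<lambda>i. {k. k < 2 * N * m \<and> query_index N k = i}"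
  have "(\<Sum>k\<in>?K i. cnj ((query_mat N m x *\<^sub>v v) $ k) * (query_mat N m y *\<^sub>v w) $ k) =
    (\<Sum>k\<in>?K i. cnj (v $ k) * w $ k) + (if x i \<noteq> y i
       then \<Sum>k\<in>?K i. cnj (v $ flip_bit k - v $ k) * w $ k else 0)" for i
  proof -
    have "(\<Sum>k\<in>?K i. cnj ((query_mat N m x *\<^sub>v v) $ k) * (query_mat N m y *\<^sub>v w) $ k) =
       (\<Sum>k\<in>?K i. cnj (v $ (if x i then flip_bit k else k)) * w $ (if y i then flip_bit k else k))"
      by (intro sum.cong refl) (auto simp: query_mat_vec v w)
    also have "\<dots> = (\<Sum>k\<in>?K i. cnj (v $ (if x i \<noteq> y i then flip_bit k else k)) * w $ k)"
      using sum_flip_bit[of "\<lambda>k. cnj (v $ (if x i then flip_bit k else k)) * w $ (if y i then flip_bit k else k)" N m i]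
      by (cases "x i"; cases "y i") simp_all
    also have "\<dots> = (\<Sum>k\<in>?K i. cnj (v $ k) * w $ k) + (if x i \<noteq> y i
       then \<Sum>k\<in>?K i. cnj (v $ flip_bit k - v $ k) * w $ k else 0)"
      by (simp add: sum.distrib[symmetric] algebra_simps)
    finally show ?thesis .
  qed
  then show ?thesis unfolding ip_def sum_query_index by (simp add: sum.distrib)
qed

text \<open>\<open>M\<close> and \<open>w\<close> are real, so the real part of the inner product
  splits into the forms of the real and of the imaginary parts of the amplitudes, one pair for each
  \<open>k\<close>.\<close>

lemma form_le_complex:
  fixes \<phi> \<psi> :: "'c \<Rightarrow> nat \<Rightarrow> complex"
  assumes le: "form_le R C M \<beta>" and s: "s > 0"
  shows "2 * (\<Sum>r\<in>R. \<Sum>c\<in>C. w r * M r c * w c * Re (\<Sum>k\<in>K. cnj (\<phi> r k) * \<psi> c k))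
    \<le> \<beta> * (s * (\<Sum>k\<in>K. \<Sum>r\<in>R. (w r)\<^sup>2 * (cmod (\<phi> r k))\<^sup>2) + (\<Sum>k\<in>K. \<Sum>c\<in>C. (w c)\<^sup>2 * (cmod (\<psi> c k))\<^sup>2) / s)"
proof -
  let ?b = "\<lambda>p k. 2 * bil R C M (\<lambda>r. w r * p (\<phi> r k)) (\<lambda>c. w c * p (\<psi> c k))"
  have Re: "Re (\<Sum>k\<in>K. cnj (\<phi> r k) * \<psi> c k) = (\<Sum>k\<in>K. Re (\<phi> r k) * Re (\<psi> c k) + Im (\<phi> r k) * Im (\<psi> c k))" for r c
    by simp
  have "(\<Sum>r\<in>R. \<Sum>c\<in>C. w r * M r c * w c * Re (\<Sum>k\<in>K. cnj (\<phi> r k) * \<psi> c k)) =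
     (\<Sum>r\<in>R. \<Sum>c\<in>C. \<Sum>k\<in>K. w r * M r c * w c * (Re (\<phi> r k) * Re (\<psi> c k) + Im (\<phi> r k) * Im (\<psi> c k)))"
    unfolding Re sum_distrib_left ..
  also have "\<dots> = (\<Sum>r\<in>R. \<Sum>k\<in>K. \<Sum>c\<in>C. w r * M r c * w c * (Re (\<phi> r k) * Re (\<psi> c k) + Im (\<phi> r k) * Im (\<psi> c k)))"
    by (rule sum.cong[OF refl], rule sum.swap)
  also have "\<dots> = (\<Sum>k\<in>K. \<Sum>r\<in>R. \<Sum>c\<in>C. w r * M r c * w c * (Re (\<phi> r k) * Re (\<psi> c k) + Im (\<phi> r k) * Im (\<psi> c k)))"
    by (rule sum.swap)
  finally have "2 * (\<Sum>r\<in>R. \<Sum>c\<in>C. w r * M r c * w c * Re (\<Sum>k\<in>K. cnj (\<phi> r k) * \<psi> c k)) =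
      (\<Sum>k\<in>K. ?b Re k + ?b Im k)"
    by (simp add: bil_def sum_distrib_left sum.distrib algebra_simps)
  also have "\<dots> \<le> (\<Sum>k\<in>K. \<beta> * (s * (\<Sum>r\<in>R. (w r * Re (\<phi> r k))\<^sup>2) + (\<Sum>c\<in>C. (w c * Re (\<psi> c k))\<^sup>2) / s)
       + \<beta> * (s * (\<Sum>r\<in>R. (w r * Im (\<phi> r k))\<^sup>2) + (\<Sum>c\<in>C. (w c * Im (\<psi> c k))\<^sup>2) / s))"
    by (intro sum_mono add_mono form_le_scaled[OF le s])
  also have "\<dots> = (\<Sum>k\<in>K. \<beta> * (s * (\<Sum>r\<in>R. (w r)\<^sup>2 * (cmod (\<phi> r k))\<^sup>2) + (\<Sum>c\<in>C. (w c)\<^sup>2 * (cmod (\<psi> c k))\<^sup>2) / s))"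
    by (intro sum.cong refl) (simp add: cmod_power2 power_mult_distrib distrib_left sum.distrib add_divide_distrib)
  also have "\<dots> = \<beta> * (s * (\<Sum>k\<in>K. \<Sum>r\<in>R. (w r)\<^sup>2 * (cmod (\<phi> r k))\<^sup>2) + (\<Sum>k\<in>K. \<Sum>c\<in>C. (w c)\<^sup>2 * (cmod (\<psi> c k))\<^sup>2) / s)"
    by (simp add: sum_distrib_left[symmetric] sum.distrib sum_divide_distrib[symmetric])
  finally show ?thesis .
qed

lemma Re_ip_self: "Re (ip d x x) = (\<Sum>k<d. (cmod (x $ k))\<^sup>2)"
  by (simp add: ip_def cmod_power2) (simp add: power2_eq_square)

section \<open>The progress of a query algorithm\<close>

locale query_algorithm = adversary "{1..N}" f R C lab G w \<beta> \<mu>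
  for N :: nat and f and R C :: "'c set" and lab G w \<beta> \<mu> +
  fixes m :: nat and U :: "nat \<Rightarrow> complex mat" and T :: nat
  assumes m: "m > 0" and N: "N > 0" and unitary: "\<forall>t\<le>T. unitary_mat (2 * N * m) (U t)"
begin

abbreviation "d \<equiv> 2 * N * m"

definition \<psi> :: "nat \<Rightarrow> 'c \<Rightarrow> complex vec" where
  "\<psi> t c = query_state N m U (lab c) t"

lemma \<psi>_carrier: "t \<le> T \<Longrightarrow> \<psi> t c \<in> carrier_vec d"
  unfolding \<psi>_def by (rule query_state_carrier[OF unitary])

lemma d_pos: "0 < d" using m N by simp

lemma ip_unit_vec: "ip d (unit_vec d 0) (unit_vec d 0) = 1"
proof -
  have "ip d (unit_vec d 0) (unit_vec d 0) = (\<Sum>k<d. if k = 0 then 1 else 0)"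
    unfolding ip_def using d_pos by (intro sum.cong) auto
  then show ?thesis using d_pos by simp
qed

lemma ip_start: "ip d (\<psi> 0 r) (\<psi> 0 c) = 1"
proof -
  have "ip d (\<psi> 0 r) (\<psi> 0 c) = ip d (unit_vec d 0) (unit_vec d 0)"
    unfolding \<psi>_def query_state.simps by (rule unitary_ip) (use unitary in auto)
  then show ?thesis by (simp add: ip_unit_vec)
qed

lemma ip_Suc:
  assumes "Suc t \<le> T"
  shows "ip d (\<psi> (Suc t) r) (\<psi> (Suc t) c) = ip d (\<psi> t r) (\<psi> t c) +
    (\<Sum>i\<in>{1..N}. if lab r i \<noteq> lab c i
       then \<Sum>k | k < d \<and> query_index N k = i. cnj (\<psi> t r $ flip_bit k - \<psi> t r $ k) * \<psi> t c $ k else 0)"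
proof -
  have c: "\<psi> t r \<in> carrier_vec d" "\<psi> t c \<in> carrier_vec d" using assms by (auto intro: \<psi>_carrier)
  have "ip d (\<psi> (Suc t) r) (\<psi> (Suc t) c) =
      ip d (query_mat N m (lab r) *\<^sub>v \<psi> t r) (query_mat N m (lab c) *\<^sub>v \<psi> t c)"
    unfolding \<psi>_def query_state.simps
    by (rule unitary_ip) (use unitary assms c in \<open>auto simp: \<psi>_def[symmetric] intro!: mult_mat_vec_carrier query_mat_carrier\<close>)
  also have "\<dots> = ip d (\<psi> t r) (\<psi> t c) +
    (\<Sum>i\<in>{1..N}. if lab r i \<noteq> lab c i
       then \<Sum>k | k < d \<and> query_index N k = i. cnj (\<psi> t r $ flip_bit k - \<psi> t r $ k) * \<psi> t c $ k else 0)"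
    by (rule query_ip[OF c])
  finally show ?thesis .
qed

lemma \<psi>_norm: "t \<le> T \<Longrightarrow> (\<Sum>k<d. (cmod (\<psi> t c $ k))\<^sup>2) = 1"
proof (induction t)
  case 0
  then show ?case using ip_start[of c c] by (simp add: Re_ip_self[symmetric])
next
  case (Suc t)
  then show ?case using ip_Suc[of t c c] by (simp add: Re_ip_self[symmetric])
qed

text \<open>The potential of the adversary method: overlaps of states on inputs of value 1 with
  states on inputs of value 0. It starts at \<beta> because the initial states coincide, each query
  moves it little, and correct outputs force it below a fixed fraction of \<beta>.\<close>

definition progress :: "nat \<Rightarrow> real" where
  "progress t = (\<Sum>r\<in>R. \<Sum>c\<in>C. w r * G r c * w c * Re (ip d (\<psi> t r) (\<psi> t c)))"

lemma progress_0: "progress 0 = \<beta>"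
  by (simp add: progress_def ip_start attained[symmetric] bil_def)

text \<open>By \<open>ip_Suc\<close> the loss is a sum of forms of \<open>query_part\<close>, one
  for each query position. The differences \<open>\<phi>\<close> have total squared norm at most 4
  and the states 1; with scaling 1 twice the loss is at most \<open>(4 + 1) * \<mu>\<close>.\<close>

lemma progress_Suc:
  assumes t: "Suc t \<le> T"
  shows "progress t - progress (Suc t) \<le> 5 / 2 * \<mu>"
proof -
  let ?K = "\<lambda>i. {k. k < d \<and> query_index N k = i}"
  define \<phi> where "\<phi> = (\<lambda>r k. \<psi> t r $ k - \<psi> t r $ flip_bit k)"
  have mu: "0 \<le> \<mu>"
    using adversary_rate_nonneg(2)[OF adversary_axioms, of 1] N by simp
  have "progress t - progress (Suc t) = (\<Sum>r\<in>R. \<Sum>c\<in>C. w r * G r c * w c *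
      (\<Sum>i\<in>{1..N}. if lab r i \<noteq> lab c i then Re (\<Sum>k\<in>?K i. cnj (\<phi> r k) * \<psi> t c $ k) else 0))"
    unfolding progress_def sum_subtractf[symmetric]
  proof (intro sum.cong refl)
    fix r c
    have "(\<Sum>i\<in>{1..N}. if lab r i \<noteq> lab c i then Re (\<Sum>k\<in>?K i. cnj (\<phi> r k) * \<psi> t c $ k) else 0)
       = - Re (\<Sum>i\<in>{1..N}. if lab r i \<noteq> lab c i
       then \<Sum>k\<in>?K i. cnj (\<psi> t r $ flip_bit k - \<psi> t r $ k) * \<psi> t c $ k else 0)"
      unfolding Re_sum sum_negf[symmetric] \<phi>_def
      by (intro sum.cong refl) (auto simp: Re_sum sum_negf[symmetric] algebra_simps intro!: sum.cong)
    then show "w r * G r c * w c * Re (ip d (\<psi> t r) (\<psi> t c)) - w r * G r c * w c * Re (ip d (\<psi> (Suc t) r) (\<psi> (Suc t) c))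
      = w r * G r c * w c * (\<Sum>i\<in>{1..N}. if lab r i \<noteq> lab c i then Re (\<Sum>k\<in>?K i. cnj (\<phi> r k) * \<psi> t c $ k) else 0)"
      unfolding ip_Suc[OF t] by (simp add: algebra_simps)
  qed
  also have "\<dots> = (\<Sum>r\<in>R. \<Sum>c\<in>C. \<Sum>i\<in>{1..N}. w r * query_part lab i G r c * w c * Re (\<Sum>k\<in>?K i. cnj (\<phi> r k) * \<psi> t c $ k))"
    unfolding sum_distrib_left by (intro sum.cong refl) (simp add: query_part_def)
  also have "\<dots> = (\<Sum>r\<in>R. \<Sum>i\<in>{1..N}. \<Sum>c\<in>C. w r * query_part lab i G r c * w c * Re (\<Sum>k\<in>?K i. cnj (\<phi> r k) * \<psi> t c $ k))"
    by (rule sum.cong[OF refl], rule sum.swap)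
  also have "\<dots> = (\<Sum>i\<in>{1..N}. \<Sum>r\<in>R. \<Sum>c\<in>C. w r * query_part lab i G r c * w c * Re (\<Sum>k\<in>?K i. cnj (\<phi> r k) * \<psi> t c $ k))"
    by (rule sum.swap)
  finally have "2 * (progress t - progress (Suc t)) = (\<Sum>i\<in>{1..N}. 
      2 * (\<Sum>r\<in>R. \<Sum>c\<in>C. w r * query_part lab i G r c * w c * Re (\<Sum>k\<in>?K i. cnj (\<phi> r k) * \<psi> t c $ k)))"
    by (simp only: sum_distrib_left)
  also have "\<dots> \<le> (\<Sum>i\<in>{1..N}. \<mu> * (1 * (\<Sum>k\<in>?K i. \<Sum>r\<in>R. (w r)\<^sup>2 * (cmod (\<phi> r k))\<^sup>2) +
      (\<Sum>k\<in>?K i. \<Sum>c\<in>C. (w c)\<^sup>2 * (cmod (\<psi> t c $ k))\<^sup>2) / 1))"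
    by (intro sum_mono form_le_complex le_query) auto
  also have "\<dots> = \<mu> * ((\<Sum>k<d. \<Sum>r\<in>R. (w r)\<^sup>2 * (cmod (\<phi> r k))\<^sup>2) + (\<Sum>k<d. \<Sum>c\<in>C. (w c)\<^sup>2 * (cmod (\<psi> t c $ k))\<^sup>2))"
    unfolding sum_query_index by (simp add: sum_distrib_left[symmetric] sum.distrib)
  also have "(\<Sum>k<d. \<Sum>c\<in>C. (w c)\<^sup>2 * (cmod (\<psi> t c $ k))\<^sup>2) = 1"
    using \<psi>_norm t by (subst sum.swap) (simp add: sum_distrib_left[symmetric] norm_C)
  also have "(\<Sum>k<d. \<Sum>r\<in>R. (w r)\<^sup>2 * (cmod (\<phi> r k))\<^sup>2) \<le> 4"
  proof -
    have "(\<Sum>k<d. (cmod (\<phi> r k))\<^sup>2) \<le> 4" for r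
    proof -
      have "(\<Sum>k<d. (cmod (\<phi> r k))\<^sup>2) \<le> (\<Sum>k<d. 2 * (cmod (\<psi> t r $ k))\<^sup>2 + 2 * (cmod (\<psi> t r $ flip_bit k))\<^sup>2)"
      proof (rule sum_mono)
        fix k
        have "(cmod (\<phi> r k))\<^sup>2 \<le> (cmod (\<psi> t r $ k) + cmod (\<psi> t r $ flip_bit k))\<^sup>2"
          unfolding \<phi>_def by (intro power_mono norm_triangle_ineq4) auto
        also have "\<dots> \<le> 2 * (cmod (\<psi> t r $ k))\<^sup>2 + 2 * (cmod (\<psi> t r $ flip_bit k))\<^sup>2"
          using sum_squares_bound[of "cmod (\<psi> t r $ k)" "cmod (\<psi> t r $ flip_bit k)"] by (simp add: power2_sum)
        finally show "(cmod (\<phi> r k))\<^sup>2 \<le> 2 * (cmod (\<psi> t r $ k))\<^sup>2 + 2 * (cmod (\<psi> t r $ flip_bit k))\<^sup>2" .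
      qed
      also have "\<dots> = 2 * (\<Sum>k<d. (cmod (\<psi> t r $ k))\<^sup>2) + 2 * (\<Sum>k<d. (cmod (\<psi> t r $ flip_bit k))\<^sup>2)"
        by (simp add: sum.distrib sum_distrib_left)
      also have "(\<Sum>k<d. (cmod (\<psi> t r $ flip_bit k))\<^sup>2) = (\<Sum>k<d. (cmod (\<psi> t r $ k))\<^sup>2)"
        unfolding sum_query_index by (simp only: sum_flip_bit[where h = "\<lambda>k. (cmod (\<psi> t r $ k))\<^sup>2"])
      finally show ?thesis using \<psi>_norm t by simp
    qed
    then have "(\<Sum>r\<in>R. (w r)\<^sup>2 * (\<Sum>k<d. (cmod (\<phi> r k))\<^sup>2)) \<le> (\<Sum>r\<in>R. (w r)\<^sup>2 * 4)"
      by (intro sum_mono mult_left_mono) auto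
    also have "\<dots> = 4" by (simp add: sum_distrib_right[symmetric] norm_R)
    finally show ?thesis by (subst sum.swap) (simp add: sum_distrib_left[symmetric])
  qed
  finally show ?thesis using mu by (simp add: mult_left_mono)
qed

lemma progress_le: "t \<le> T \<Longrightarrow> \<beta> - progress t \<le> 5 / 2 * \<mu> * real t"
proof (induction t)
  case 0
  then show ?case by (simp add: progress_0)
next
  case (Suc t)
  then show ?case using progress_Suc[of t] by (simp add: algebra_simps)
qed

text \<open>The constant 943/1000 is just above \<open>2 * sqrt (1/3 * 2/3)\<close>; the optimal scaling \<open>sqrt (1/2)\<close> of the
  two sides is replaced by 7/10.\<close>

lemma progress_final:
  assumes R: "\<And>r. r \<in> R \<Longrightarrow> output_prob N m U A T (lab r) False \<le> 1 / 3"
    and C: "\<And>c. c \<in> C \<Longrightarrow> output_prob N m U A T (lab c) True \<le> 1 / 3"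
  shows "progress T \<le> 943 / 1000 * \<beta>"
proof -
  have \<beta>: "0 \<le> \<beta>" using adversary_rate_nonneg(1)[OF adversary_axioms] .
  let ?K = "\<lambda>b. {k. k < d \<and> (k \<in> A) = b}"
  have split: "(\<Sum>k<d. h k) = (\<Sum>k\<in>?K True. h k) + (\<Sum>k\<in>?K False. h k)" for h :: "nat \<Rightarrow> 'z :: comm_monoid_add"
  proof -
    have "{..<d} = ?K True \<union> ?K False" by auto
    then show ?thesis by (simp add: sum.union_disjoint[symmetric] Int_def)
  qed
  define a where "a = (\<lambda>b. \<Sum>k\<in>?K b. \<Sum>r\<in>R. (w r)\<^sup>2 * (cmod (\<psi> T r $ k))\<^sup>2)"
  define e where "e = (\<lambda>b. \<Sum>k\<in>?K b. \<Sum>c\<in>C. (w c)\<^sup>2 * (cmod (\<psi> T c $ k))\<^sup>2)"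
  let ?W = "\<lambda>b. \<Sum>r\<in>R. \<Sum>c\<in>C. w r * G r c * w c * Re (\<Sum>k\<in>?K b. cnj (\<psi> T r $ k) * \<psi> T c $ k)"
  have "progress T = ?W True + ?W False"
    unfolding progress_def ip_def split by (simp add: distrib_left sum.distrib)
  moreover have "2 * ?W True \<le> \<beta> * (7 / 10 * a True + e True / (7 / 10))"
    unfolding a_def e_def by (rule form_le_complex[OF le]) simp
  moreover have "2 * ?W False \<le> \<beta> * (10 / 7 * a False + e False / (10 / 7))"
    unfolding a_def e_def by (rule form_le_complex[OF le]) simp
  ultimately have W: "2 * progress T \<le> \<beta> * (7 / 10 * a True + 10 / 7 * e True + 10 / 7 * a False + 7 / 10 * e False)"
    by (simp add: algebra_simps)
  have "a True + a False = 1"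
    unfolding a_def split[symmetric] using \<psi>_norm
    by (subst sum.swap) (simp add: sum_distrib_left[symmetric] norm_R)
  moreover have "e True + e False = 1"
    unfolding e_def split[symmetric] using \<psi>_norm
    by (subst sum.swap) (simp add: sum_distrib_left[symmetric] norm_C)
  moreover have "a False \<le> 1 / 3"
  proof -
    have "a False = (\<Sum>r\<in>R. (w r)\<^sup>2 * output_prob N m U A T (lab r) False)"
      unfolding a_def output_prob_def \<psi>_def by (subst sum.swap) (simp add: sum_distrib_left)
    also have "\<dots> \<le> (\<Sum>r\<in>R. (w r)\<^sup>2 * (1 / 3))" by (intro sum_mono mult_left_mono R) auto
    also have "\<dots> = 1 / 3" unfolding sum_distrib_right[symmetric] norm_R by simp
    finally show ?thesis .
  qed
  moreover have "e True \<le> 1 / 3"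
  proof -
    have "e True = (\<Sum>c\<in>C. (w c)\<^sup>2 * output_prob N m U A T (lab c) True)"
      unfolding e_def output_prob_def \<psi>_def by (subst sum.swap) (simp add: sum_distrib_left)
    also have "\<dots> \<le> (\<Sum>c\<in>C. (w c)\<^sup>2 * (1 / 3))" by (intro sum_mono mult_left_mono C) auto
    also have "\<dots> = 1 / 3" unfolding sum_distrib_right[symmetric] norm_C by simp
    finally show ?thesis .
  qed
  \<comment> \<open>The worst case has both error weights equal to \<open>1 / 3\<close>, where the
    sum is \<open>14 / 15 + 20 / 21\<close>.\<close>
  ultimately have "7 / 10 * a True + 10 / 7 * e True + 10 / 7 * a False + 7 / 10 * e False \<le> 2 * (943 / 1000)"
    by linarith
  then have "\<beta> * (7 / 10 * a True + 10 / 7 * e True + 10 / 7 * a False + 7 / 10 * e False) \<le> \<beta> * (2 * (943 / 1000))"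
    using \<beta> by (intro mult_left_mono)
  then show ?thesis using W by linarith
qed

end

text \<open>From start to end the progress falls by at least \<open>57 / 1000 * \<beta>\<close>, and
  by at most \<open>5 / 2 * \<mu>\<close> per query; 50 exceeds the quotient of the two
  constants.\<close>

theorem adversary_bound:
  assumes adv: "adversary {1..N} f R C lab G w \<beta> \<mu>" and N: "N > 0"
    and cube: "\<And>c. c \<in> R \<union> C \<Longrightarrow> lab c \<in> cube N"
    and T: "quantum_computes N f T"
  shows "\<beta> \<le> 50 * \<mu> * real T"
proof -
  obtain m U A where m: "m > 0" and U: "\<forall>t\<le>T. unitary_mat (2 * N * m) (U t)"
    and out: "\<And>x. x \<in> cube N \<Longrightarrow> output_prob N m U A T x (\<not> f x) \<le> 1 / 3"
    using T unfolding quantum_computes_def by blast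
  interpret adversary "{1..N}" f R C lab G w \<beta> \<mu> by fact
  interpret query_algorithm N f R C lab G w \<beta> \<mu> m U T by unfold_locales (use m N U in auto)
  have "progress T \<le> 943 / 1000 * \<beta>"
    by (rule progress_final[where A = A]) (use out cube lab_R lab_C in \<open>fastforce+\<close>)
  moreover have "0 \<le> \<mu> * real T"
    using adversary_rate_nonneg(2)[OF adversary_axioms, of 1] N by simp
  ultimately show ?thesis using progress_le[of T] by linarith
qed



section \<open>Norm attaining vectors\<close>

text \<open>In the composition every inner function contributes its weight vector, so the value must equal
  the norm exactly; an approximately optimal vector would lose a factor for each coordinate.\<close>

lemma norm_attained:
  fixes R C :: "'c set" and G :: "'c \<Rightarrow> 'c \<Rightarrow> real"
  assumes fin: "finite R" "finite C" and disj: "R \<inter> C = {}" and ne: "R \<noteq> {}" "C \<noteq> {}"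
  obtains w \<beta> where "(\<Sum>r\<in>R. (w r)\<^sup>2) = 1" "(\<Sum>c\<in>C. (w c)\<^sup>2) = 1" "bil R C G w w = \<beta>"
    "form_le R C G \<beta>"
    "\<And>u v. bil R C G u v \<le> \<beta> * sqrt (\<Sum>r\<in>R. (u r)\<^sup>2) * sqrt (\<Sum>c\<in>C. (v c)\<^sup>2)"
proof -
  \<comment> \<open>A compact box in the function space over the whole type: coordinates outside
    \<open>R \<union> C\<close> are pinned to 0. The two unit sphere conditions cut out the compact
    set \<open>K\<close>.\<close>
  define B where "B = PiE UNIV (\<lambda>c. if c \<in> R \<union> C then {-1..1::real} else {0})"
  define N where "N = (\<lambda>S (w :: 'c \<Rightarrow> real). \<Sum>c\<in>S. (w c)\<^sup>2)"
  define K where "K = B \<inter> {w. N R w = 1} \<inter> {w. N C w = 1}"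
  have coord: "continuous_on UNIV (\<lambda>w :: 'c \<Rightarrow> real. w c)" for c
    by (rule continuous_on_product_coordinates)
  have contN: "continuous_on UNIV (N S)" for S
    unfolding N_def by (intro continuous_on_sum continuous_on_power coord)
  have "compactin (product_topology (\<lambda>_. euclidean) UNIV) B"
    unfolding B_def compactin_PiE by auto
  then have "compact B" by (simp add: euclidean_product_topology compactin_euclidean_iff)
  moreover have "closed {w. N S w = 1}" for S
    by (intro closed_Collect_eq contN continuous_on_const)
  ultimately have "compact K" unfolding K_def by (intro compact_Int_closed) auto
  moreover have "K \<noteq> {}"
  proof -
    obtain r c where rc: "r \<in> R" "c \<in> C" using ne by blast
    let ?w = "\<lambda>x. if x = r \<or> x = c then 1 else 0 :: real"
    have "N R ?w = (\<Sum>x\<in>R. if x = r then 1 else 0)"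
      unfolding N_def using rc disj by (intro sum.cong) auto
    moreover have "N C ?w = (\<Sum>x\<in>C. if x = c then 1 else 0)"
      unfolding N_def using rc disj by (intro sum.cong) auto
    ultimately have "?w \<in> K" using rc fin by (auto simp: K_def B_def PiE_UNIV_domain)
    then show ?thesis by blast
  qed
  moreover have "continuous_on K (\<lambda>w. bil R C G w w)"
  proof (rule continuous_on_subset)
    show "continuous_on UNIV (\<lambda>w. bil R C G w w)"
      unfolding bil_def by (intro continuous_on_sum continuous_on_mult coord continuous_on_const)
  qed simp
  ultimately obtain w where w: "w \<in> K" and max: "\<And>z. z \<in> K \<Longrightarrow> bil R C G z z \<le> bil R C G w w"
    using continuous_attains_sup[of K "\<lambda>w. bil R C G w w"] by blast
  define \<beta> where "\<beta> = bil R C G w w"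
  have zero: "u c = 0" if "finite S" "N S u = 0" "c \<in> S" for S u c
    using that unfolding N_def by (simp add: sum_nonneg_eq_0_iff)
  have le: "bil R C G u v \<le> \<beta> * sqrt (N R u) * sqrt (N C v)" for u v
  proof (cases "N R u = 0 \<or> N C v = 0")
    case True
    then have "bil R C G u v = 0"
      unfolding bil_def using zero fin by (intro sum.neutral ballI) auto
    then show ?thesis using True by auto
  next
    case False
    define a b where "a = sqrt (N R u)" and "b = sqrt (N C v)"
    have "0 \<le> N R u" "0 \<le> N C v" by (simp_all add: N_def sum_nonneg)
    with False have pos: "a > 0" "b > 0" and sq: "a\<^sup>2 = N R u" "b\<^sup>2 = N C v"
      by (auto simp: a_def b_def)
    \<comment> \<open>As \<open>R\<close> and \<open>C\<close> are disjoint, the normalised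
      \<open>u\<close> and \<open>v\<close> can be glued into one vector, to which the maximality of
      \<open>w\<close> applies.\<close>
    define z where "z = (\<lambda>c. if c \<in> R then 1 / a * u c else if c \<in> C then 1 / b * v c else 0)"
    have "N R z = (\<Sum>c\<in>R. (u c)\<^sup>2 / a\<^sup>2)"
      unfolding N_def by (intro sum.cong) (auto simp: z_def power_divide)
    then have NR: "N R z = 1" using sq False by (simp add: sum_divide_distrib[symmetric] N_def)
    have "N C z = (\<Sum>c\<in>C. (v c)\<^sup>2 / b\<^sup>2)"
      unfolding N_def using disj by (intro sum.cong) (auto simp: z_def power_divide)
    then have NC: "N C z = 1" using sq False by (simp add: sum_divide_distrib[symmetric] N_def)
    have bd: "\<bar>z c\<bar> \<le> 1" if "finite S" "N S z = 1" "c \<in> S" for S c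
    proof -
      have "(z c)\<^sup>2 \<le> N S z" unfolding N_def using that by (intro member_le_sum) auto
      then show ?thesis using that by (simp add: abs_square_le_1)
    qed
    have "z \<in> B" unfolding B_def
    proof (intro PiE_I)
      fix c
      have "- 1 \<le> z c \<and> z c \<le> 1" if "c \<in> R \<union> C"
        using bd[OF fin(1) NR, of c] bd[OF fin(2) NC, of c] that by (auto simp: abs_le_iff)
      moreover have "z c = 0" if "c \<notin> R \<union> C" using that by (simp add: z_def)
      ultimately show "z c \<in> (if c \<in> R \<union> C then {- 1..1} else {0})" by simp
    qed simp
    then have "z \<in> K" using NR NC by (simp add: K_def)
    then have "bil R C G z z \<le> \<beta>" unfolding \<beta>_def by (rule max)
    moreover have "bil R C G z z = bil R C G (\<lambda>c. 1 / a * u c) (\<lambda>c. 1 / b * v c)"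
      using disj by (intro bil_cong) (auto simp: z_def)
    ultimately have "bil R C G u v / (a * b) \<le> \<beta>" unfolding bil_scale by simp
    then have "bil R C G u v \<le> \<beta> * (a * b)" using pos by (simp add: divide_le_eq)
    then show ?thesis by (simp add: a_def b_def mult.assoc)
  qed
  have nonneg: "0 \<le> \<beta>"
  proof -
    have "- \<beta> \<le> \<beta> * sqrt (N R w) * sqrt (N C w)"
      using le[of "\<lambda>c. - w c" w] by (simp add: bil_uminus \<beta>_def N_def)
    then show ?thesis using w by (simp add: K_def)
  qed
  have "form_le R C G \<beta>"
  proof (rule form_leI)
    fix u v
    have "2 * (sqrt (N R u) * sqrt (N C v)) \<le> (sqrt (N R u))\<^sup>2 + (sqrt (N C v))\<^sup>2"
      using sum_squares_bound[of "sqrt (N R u)" "sqrt (N C v)"] by simp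
    then have "2 * (sqrt (N R u) * sqrt (N C v)) \<le> N R u + N C v"
      by (simp add: N_def sum_nonneg)
    then have "\<beta> * (2 * (sqrt (N R u) * sqrt (N C v))) \<le> \<beta> * (N R u + N C v)"
      using nonneg by (intro mult_left_mono)
    then show "2 * bil R C G u v \<le> \<beta> * ((\<Sum>r\<in>R. (u r)\<^sup>2) + (\<Sum>c\<in>C. (v c)\<^sup>2))"
      using le[of u v] unfolding N_def by (simp add: algebra_simps)
  qed
  with w le show ?thesis
    by (intro that[of w \<beta>]) (auto simp: K_def N_def \<beta>_def)
qed

text \<open>The entries kept form two blocks, with \<open>p\<close> true and \<open>q\<close> false
  or the reverse. The blocks share neither rows nor columns, so their squared norms add up to those
  of \<open>u\<close> and \<open>v\<close> without a factor 2.\<close>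

lemma form_le_query_part:
  fixes p :: "'r \<Rightarrow> bool" and q :: "'c \<Rightarrow> bool"
  assumes "form_le R C M \<beta>"
  shows "form_le R C (\<lambda>r c. if p r \<noteq> q c then M r c else 0) \<beta>"
proof (rule form_leI)
  fix u :: "_ \<Rightarrow> real" and v :: "_ \<Rightarrow> real"
  let ?u = "\<lambda>b r. if p r = b then u r else 0"
  let ?v = "\<lambda>b c. if q c = b then v c else 0"
  have "bil R C (\<lambda>r c. if p r \<noteq> q c then M r c else 0) u v =
      bil R C M (?u True) (?v False) + bil R C M (?u False) (?v True)"
    unfolding bil_def sum.distrib[symmetric] by (intro sum.cong refl) auto
  then have "2 * bil R C (\<lambda>r c. if p r \<noteq> q c then M r c else 0) u v \<le>
     \<beta> * ((\<Sum>r\<in>R. (?u True r)\<^sup>2) + (\<Sum>c\<in>C. (?v False c)\<^sup>2)) + 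
     \<beta> * ((\<Sum>r\<in>R. (?u False r)\<^sup>2) + (\<Sum>c\<in>C. (?v True c)\<^sup>2))"
    using form_leD[OF assms, of "?u True" "?v False"] form_leD[OF assms, of "?u False" "?v True"] by linarith
  also have "\<dots> = \<beta> * (((\<Sum>r\<in>R. (?u True r)\<^sup>2) + (\<Sum>r\<in>R. (?u False r)\<^sup>2)) +
      ((\<Sum>c\<in>C. (?v True c)\<^sup>2) + (\<Sum>c\<in>C. (?v False c)\<^sup>2)))"
    by (simp add: algebra_simps)
  also have "(\<Sum>r\<in>R. (?u True r)\<^sup>2) + (\<Sum>r\<in>R. (?u False r)\<^sup>2) = (\<Sum>r\<in>R. (u r)\<^sup>2)"
    unfolding sum.distrib[symmetric] by (intro sum.cong) auto
  also have "(\<Sum>c\<in>C. (?v True c)\<^sup>2) + (\<Sum>c\<in>C. (?v False c)\<^sup>2) = (\<Sum>c\<in>C. (v c)\<^sup>2)"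
    unfolding sum.distrib[symmetric] by (intro sum.cong) auto
  finally show "2 * bil R C (\<lambda>r c. if p r \<noteq> q c then M r c else 0) u v \<le>
     \<beta> * ((\<Sum>r\<in>R. (u r)\<^sup>2) + (\<Sum>c\<in>C. (v c)\<^sup>2))" .
qed

section \<open>Characters of the power set\<close>

definition chi :: "'a set \<Rightarrow> 'a set \<Rightarrow> real" where
  "chi f y = (-1) ^ card (f \<inter> y)"

lemma chi_commute: "chi f y = chi y f"
  by (simp add: chi_def Int_commute)

lemma chi_empty [simp]: "chi {} y = 1" "chi f {} = 1"
  by (simp_all add: chi_def)

lemma chi_square [simp]: "chi f y * chi f y = 1"
  by (simp add: chi_def power_mult_distrib[symmetric])

lemma chi_Un:
  assumes "finite f" "finite g" "f \<inter> g = {}"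
  shows "chi (f \<union> g) y = chi f y * chi g y"
proof -
  have "card ((f \<union> g) \<inter> y) = card (f \<inter> y) + card (g \<inter> y)"
    unfolding Int_Un_distrib2 by (rule card_Un_disjoint) (use assms in auto)
  then show ?thesis by (simp add: chi_def power_add)
qed

lemma chi_sym_diff:
  assumes "finite f" "finite g"
  shows "chi (sym_diff f g) y = chi f y * chi g y"
proof -
  have f: "chi f y = chi (f - g) y * chi (f \<inter> g) y"
    by (subst chi_Un[symmetric]) (use assms in \<open>auto intro!: arg_cong[of _ _ "\<lambda>a. chi a y"]\<close>)
  have g: "chi g y = chi (g - f) y * chi (f \<inter> g) y"
    by (subst chi_Un[symmetric]) (use assms in \<open>auto intro!: arg_cong[of _ _ "\<lambda>a. chi a y"]\<close>)
  have "chi (sym_diff f g) y = chi (f - g) y * chi (g - f) y"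
    using assms by (intro chi_Un) auto
  also have "\<dots> = chi (f - g) y * chi (g - f) y * (chi (f \<inter> g) y * chi (f \<inter> g) y)"
    by simp
  finally show ?thesis unfolding f g by (simp only: mult_ac)
qed

lemma chi_sym_diff_right:
  assumes "finite x" "finite y"
  shows "chi f (sym_diff x y) = chi f x * chi f y"
  using chi_sym_diff[OF assms, of f] by (simp only: chi_commute[of f])

text \<open>Toggling an element of a nonempty \<open>f\<close> in \<open>y\<close> reverses every
  sign.\<close>

lemma sum_chi:
  assumes "finite A" "f \<subseteq> A"
  shows "(\<Sum>y\<in>Pow A. chi f y) = (if f = {} then 2 ^ card A else 0)"
proof (cases "f = {}")
  case True
  then show ?thesis using assms by (simp add: card_Pow)
next
  case False
  then obtain e where e: "e \<in> f" by blast
  have inv: "sym_diff (sym_diff y {e}) {e} = y" for y by auto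
  have "(\<Sum>y\<in>Pow A. chi f y) = (\<Sum>y\<in>Pow A. chi f (sym_diff y {e}))"
    by (rule sum.reindex_bij_witness[where i = "\<lambda>y. sym_diff y {e}" and j = "\<lambda>y. sym_diff y {e}"])
       (use e assms in \<open>simp_all only: inv\<close>, auto)
  also have "\<dots> = (\<Sum>y\<in>Pow A. - chi f y)"
  proof (intro sum.cong refl)
    fix y assume "y \<in> Pow A"
    then have "finite y" using assms finite_subset by auto
    moreover have "chi f {e} = -1" using e by (simp add: chi_def)
    ultimately show "chi f (sym_diff y {e}) = - chi f y" by (simp add: chi_sym_diff_right)
  qed
  finally show ?thesis using False by (simp add: sum_negf)
qed

lemma parseval:
  assumes A: "finite A" and Y: "Y \<subseteq> Pow A"
  shows "(\<Sum>f\<in>Pow A. (\<Sum>y\<in>Y. v y * chi f y)\<^sup>2) = 2 ^ card A * (\<Sum>y\<in>Y. (v y)\<^sup>2)"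
proof -
  have finY: "finite Y" using A Y by (meson finite_Pow_iff finite_subset)
  have fin: "finite y" if "y \<in> Y" for y using that A Y by (meson PowD finite_subset in_mono)
  have "(\<Sum>f\<in>Pow A. (\<Sum>y\<in>Y. v y * chi f y)\<^sup>2) =
      (\<Sum>f\<in>Pow A. \<Sum>y\<in>Y. \<Sum>z\<in>Y. v y * v z * chi f (sym_diff y z))"
    unfolding power2_eq_square sum_product
    by (intro sum.cong refl) (simp add: chi_sym_diff_right fin mult_ac)
  also have "\<dots> = (\<Sum>y\<in>Y. \<Sum>f\<in>Pow A. \<Sum>z\<in>Y. v y * v z * chi f (sym_diff y z))"
    by (rule sum.swap)
  also have "\<dots> = (\<Sum>y\<in>Y. \<Sum>z\<in>Y. \<Sum>f\<in>Pow A. v y * v z * chi f (sym_diff y z))"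
    by (rule sum.cong[OF refl], rule sum.swap)
  also have "\<dots> = (\<Sum>y\<in>Y. \<Sum>z\<in>Y. if y = z then 2 ^ card A * (v y)\<^sup>2 else 0)"
  proof (intro sum.cong refl)
    fix y z assume "y \<in> Y" "z \<in> Y"
    then have "sym_diff y z \<subseteq> A" using Y by auto
    then have "(\<Sum>f\<in>Pow A. v y * v z * chi f (sym_diff y z)) = v y * v z * (if sym_diff y z = {} then 2 ^ card A else 0)"
      unfolding sum_distrib_left[symmetric] chi_commute[of _ "sym_diff y z"] by (simp only: sum_chi[OF A])
    then show "(\<Sum>f\<in>Pow A. v y * v z * chi f (sym_diff y z)) = (if y = z then 2 ^ card A * (v y)\<^sup>2 else 0)"
      by (auto simp: power2_eq_square)
  qed
  also have "\<dots> = 2 ^ card A * (\<Sum>y\<in>Y. (v y)\<^sup>2)" using finY by (simp add: sum_distrib_left)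
  finally show ?thesis .
qed



section \<open>An adversary matrix for k-XOR\<close>

text \<open>The first condition makes the low characters orthogonal on the solutions of each choice.
  The third bounds the choices at the threshold, with 3 standing for the number e. The last makes at
  most half of all inputs solvable, by a union bound over the \<open>r ^ k\<close> choices.\<close>

locale kxor =
  fixes k r L h :: nat
  assumes h: "2 * h < k" and r: "0 < r" and rh: "3 * r\<^sup>2 \<le> 2 ^ h" and L: "2 * r ^ k \<le> 2 ^ L"
begin

text \<open>An input is encoded as the set of its bits equal to 1; \<open>(a, i, j)\<close> is bit
  \<open>j\<close> of letter \<open>i\<close> in group \<open>a\<close>.\<close>

definition cells :: "(nat \<times> nat \<times> nat) set" where
  "cells = {..<k} \<times> {..<r} \<times> {..<L}"

definition letters :: "(nat \<times> nat \<times> nat) set \<Rightarrow> (nat \<times> nat) set" where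
  "letters f = (\<lambda>e. (fst e, fst (snd e))) ` f"

definition choices :: "(nat \<Rightarrow> nat) set" where
  "choices = PiE {..<k} (\<lambda>_. {..<r})"

definition hits :: "(nat \<Rightarrow> nat) \<Rightarrow> (nat \<times> nat) set \<Rightarrow> nat" where
  "hits S W = card {a. a < k \<and> (a, S a) \<in> W}"

definition block :: "(nat \<Rightarrow> nat) \<Rightarrow> nat set \<Rightarrow> (nat \<times> nat \<times> nat) set" where
  "block S T = (\<lambda>(j, a). (a, S a, j)) ` (T \<times> {..<k})"

text \<open>The bitwise sum of the letters chosen by \<open>S\<close>, given as the set of its
  ones.\<close>

definition odd_at :: "(nat \<Rightarrow> nat) \<Rightarrow> (nat \<times> nat \<times> nat) set \<Rightarrow> nat set" where
  "odd_at S x = {j. odd (card {a. a < k \<and> (a, S a, j) \<in> x})}"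

definition solutions :: "(nat \<Rightarrow> nat) \<Rightarrow> (nat \<times> nat \<times> nat) set set" where
  "solutions S = {x \<in> Pow cells. odd_at S x \<inter> {..<L} = {}}"

lemma finite_cells [simp]: "finite cells"
  by (simp add: cells_def)

lemma finite_choices [simp]: "finite choices"
  by (simp add: choices_def finite_PiE)

lemma card_choices: "card choices = r ^ k"
  by (simp add: choices_def card_PiE)

lemma finite_letters: "finite f \<Longrightarrow> finite (letters f)"
  by (simp add: letters_def)

lemma solutions_subset: "solutions S \<subseteq> Pow cells"
  by (auto simp: solutions_def)

lemma finite_solutions [simp]: "finite (solutions S)"
  using solutions_subset by (rule finite_subset) simp

lemma hits_mono: "W \<subseteq> W' \<Longrightarrow> hits S W \<le> hits S W'"
  unfolding hits_def by (intro card_mono) auto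

lemma hits_Un: "hits S (W \<union> W') \<le> hits S W + hits S W'"
proof -
  have "{a. a < k \<and> (a, S a) \<in> W \<union> W'} = {a. a < k \<and> (a, S a) \<in> W} \<union> {a. a < k \<and> (a, S a) \<in> W'}"
    by auto
  then show ?thesis by (simp add: hits_def card_Un_le)
qed

lemma hits_insert: "hits S (insert l W) \<le> hits S W + 1"
proof -
  have "hits S {l} \<le> 1"
  proof -
    have "{a. a < k \<and> (a, S a) \<in> {l}} \<subseteq> {fst l}" by auto
    then show ?thesis unfolding hits_def using card_mono[of "{fst l}"] by fastforce
  qed
  then show ?thesis using hits_Un[of S "{l}" W] by simp
qed

lemma hits_all:
  assumes "\<And>a. a < k \<Longrightarrow> (a, S a) \<in> W"
  shows "hits S W = k"
proof -
  have "{a. a < k \<and> (a, S a) \<in> W} = {..<k}" using assms by auto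
  then show ?thesis by (simp add: hits_def)
qed

lemma block_empty [simp]: "block S {} = {}"
  by (simp add: block_def)

lemma in_block_iff: "(a, i, j) \<in> block S T \<longleftrightarrow> a < k \<and> i = S a \<and> j \<in> T"
  by (auto simp: block_def)

lemma finite_block: "finite T \<Longrightarrow> finite (block S T)"
  by (simp add: block_def)

lemma block_subset: "S \<in> choices \<Longrightarrow> T \<subseteq> {..<L} \<Longrightarrow> block S T \<subseteq> cells"
  by (auto simp: in_block_iff cells_def choices_def)

lemma hits_letters_block: "T \<noteq> {} \<Longrightarrow> hits S (letters (block S T)) = k"
  by (rule hits_all) (force simp: letters_def block_def)

text \<open>The character factors over \<open>T\<close>, and its factor at bit \<open>j\<close> is
  the sign of the parity of bit \<open>j\<close> over the chosen letters.\<close>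

lemma chi_block:
  assumes "finite T"
  shows "chi (block S T) x = chi T (odd_at S x)"
proof -
  let ?c = "\<lambda>j. {a. a < k \<and> (a, S a, j) \<in> x}"
  have "block S T \<inter> x = (\<lambda>(j, a). (a, S a, j)) ` (SIGMA j:T. ?c j)"
    by (auto simp: block_def)
  moreover have "inj_on (\<lambda>(j, a). (a, S a, j)) (SIGMA j:T. ?c j)" by (auto simp: inj_on_def)
  ultimately have "card (block S T \<inter> x) = (\<Sum>j\<in>T. card (?c j))"
    using assms by (simp add: card_image)
  then have "chi (block S T) x = (\<Prod>j\<in>T. (-1) ^ card (?c j))"
    by (simp add: chi_def power_sum)
  also have "\<dots> = (\<Prod>j\<in>T. if j \<in> odd_at S x then -1 else 1)"
    by (intro prod.cong) (auto simp: odd_at_def)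
  also have "\<dots> = (\<Prod>j\<in>T \<inter> odd_at S x. -1)"
    by (rule prod.inter_restrict[OF assms, symmetric])
  finally show ?thesis by (simp add: chi_def)
qed

text \<open>The characters \<open>block S T\<close> are those that are trivial on \<open>solutions S\<close>.\<close>

lemma sum_chi_block:
  assumes "x \<subseteq> cells"
  shows "(\<Sum>T\<in>Pow {..<L}. chi (block S T) x) = (if x \<in> solutions S then 2 ^ L else 0)"
proof -
  have "(\<Sum>T\<in>Pow {..<L}. chi (block S T) x) = (\<Sum>T\<in>Pow {..<L}. chi (odd_at S x \<inter> {..<L}) T)"
  proof (intro sum.cong refl)
    fix T assume T: "T \<in> Pow {..<L}"
    then have "finite T" by (auto intro: finite_subset)
    moreover have "odd_at S x \<inter> {..<L} \<inter> T = T \<inter> odd_at S x" using T by auto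
    ultimately show "chi (block S T) x = chi (odd_at S x \<inter> {..<L}) T"
      by (simp add: chi_block) (simp add: chi_def)
  qed
  also have "\<dots> = (if odd_at S x \<inter> {..<L} = {} then 2 ^ card {..<L} else 0)"
    by (rule sum_chi) auto
  finally show ?thesis using assms by (simp add: solutions_def)
qed

lemma chi_block_solutions:
  assumes "x \<in> solutions S" "T \<subseteq> {..<L}"
  shows "chi (block S T) x = 1"
proof -
  have "finite T" using assms by (auto intro: finite_subset)
  moreover have "T \<inter> odd_at S x = {}" using assms by (auto simp: solutions_def)
  ultimately show ?thesis by (simp add: chi_block) (simp add: chi_def)
qed

text \<open>The indicator of \<open>solutions S\<close> is the average of the block characters. By
  orthogonality only \<open>f = block S T\<close> could contribute, and for nonempty
  \<open>T\<close> that character hits \<open>k > h\<close> letters of \<open>S\<close>.\<close>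

lemma sum_solutions_chi:
  assumes S: "S \<in> choices" and f: "f \<subseteq> cells" and hit: "hits S (letters f) \<le> h"
  shows "2 ^ L * (\<Sum>x\<in>solutions S. chi f x) = (if f = {} then 2 ^ card cells else 0)"
proof -
  have fin: "finite f" using f by (rule finite_subset) simp
  have "2 ^ L * (\<Sum>x\<in>solutions S. chi f x) = (\<Sum>x\<in>Pow cells. if x \<in> solutions S then 2 ^ L * chi f x else 0)"
  proof -
    have "Pow cells \<inter> solutions S = solutions S" using solutions_subset[of S] by blast
    then show ?thesis by (simp add: sum_distrib_left sum.inter_restrict[symmetric])
  qed
  also have "\<dots> = (\<Sum>x\<in>Pow cells. \<Sum>T\<in>Pow {..<L}. chi (block S T) x * chi f x)"
    by (intro sum.cong refl) (simp add: sum_distrib_right[symmetric] sum_chi_block)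
  also have "\<dots> = (\<Sum>T\<in>Pow {..<L}. \<Sum>x\<in>Pow cells. chi (block S T) x * chi f x)"
    by (rule sum.swap)
  also have "\<dots> = (\<Sum>T\<in>Pow {..<L}. if T = {} then (if f = {} then 2 ^ card cells else 0) else 0)"
  proof (intro sum.cong refl)
    fix T assume T: "T \<in> Pow {..<L}"
    have finb: "finite (block S T)" using T by (auto intro: finite_subset finite_block)
    have "(\<Sum>x\<in>Pow cells. chi (block S T) x * chi f x) = (\<Sum>x\<in>Pow cells. chi (sym_diff (block S T) f) x)"
      by (simp add: chi_sym_diff fin finb)
    also have "\<dots> = (if sym_diff (block S T) f = {} then 2 ^ card cells else 0)"
      using block_subset[OF S, of T] f T by (intro sum_chi) auto
    also have "sym_diff (block S T) f = {} \<longleftrightarrow> f = {} \<and> T = {}"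
    proof
      assume "sym_diff (block S T) f = {}"
      then have "f = block S T" by blast
      then have "T = {}" using hits_letters_block[of T S] hit h by (cases "T = {}") auto
      then show "f = {} \<and> T = {}" using \<open>f = block S T\<close> by simp
    qed simp
    finally show "(\<Sum>x\<in>Pow cells. chi (block S T) x * chi f x) = (if T = {} then (if f = {} then 2 ^ card cells else 0) else 0)"
      by simp
  qed
  also have "\<dots> = (if f = {} then 2 ^ card cells else 0)"
    by (simp add: sum.delta)
  finally show ?thesis .
qed

lemma card_solutions:
  assumes "S \<in> choices"
  shows "2 ^ L * real (card (solutions S)) = 2 ^ card cells"
  using sum_solutions_chi[OF assms, of "{}"] by (simp add: letters_def hits_def)

lemma letters_sym_diff_block:
  assumes "sym_diff f (block S T) = sym_diff g (block S T')" "j \<in> sym_diff T T'" "a < k"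
  shows "(a, S a) \<in> letters f \<union> letters g"
proof -
  have "(a, S a, j) \<in> sym_diff (block S T) (block S T')" using assms by (auto simp: in_block_iff)
  then have "(a, S a, j) \<in> f \<union> g" using assms(1) by blast
  then show ?thesis by (force simp: letters_def)
qed

text \<open>Two characters that agree up to some \<open>block S T\<close> with nonempty \<open>T\<close> together touch all \<open>k > 2 * h\<close>
  letters of \<open>S\<close>. Hence each of the characters considered here has \<open>2 ^ L\<close> translates with the same
  coefficient, and the translates of different ones are distinct.\<close>

lemma bessel:
  fixes u :: "(nat \<times> nat \<times> nat) set \<Rightarrow> real"
  assumes S: "S \<in> choices"
  shows "2 ^ L * (\<Sum>f | f \<subseteq> cells \<and> hits S (letters f) \<le> h. (\<Sum>x\<in>solutions S. u x * chi f x)\<^sup>2)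
         \<le> 2 ^ card cells * (\<Sum>x\<in>solutions S. (u x)\<^sup>2)"
proof -
  let ?F = "{f. f \<subseteq> cells \<and> hits S (letters f) \<le> h}"
  let ?q = "\<lambda>f. (\<Sum>x\<in>solutions S. u x * chi f x)\<^sup>2"
  let ?m = "\<lambda>(f, T). sym_diff f (block S T)"
  have finF: "finite ?F" by (rule finite_subset[of _ "Pow cells"]) auto
  have inj: "inj_on ?m (?F \<times> Pow {..<L})"
  proof (rule inj_onI, clarify)
    fix f T g T'
    assume f: "hits S (letters f) \<le> h" and g: "hits S (letters g) \<le> h"
      and eq: "sym_diff f (block S T) = sym_diff g (block S T')"
    have "T = T'"
    proof (rule ccontr)
      assume "T \<noteq> T'"
      then obtain j where "j \<in> sym_diff T T'" by blast
      then have "hits S (letters f \<union> letters g) = k"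
        using letters_sym_diff_block[OF eq] by (intro hits_all) blast
      then show False using hits_Un[of S "letters f" "letters g"] f g h by linarith
    qed
    then show "f = g \<and> T = T'" using eq by blast
  qed
  have sub: "?m ` (?F \<times> Pow {..<L}) \<subseteq> Pow cells"
  proof
    fix z assume "z \<in> ?m ` (?F \<times> Pow {..<L})"
    then obtain f T where "z = sym_diff f (block S T)" "f \<subseteq> cells" "T \<subseteq> {..<L}" by auto
    then show "z \<in> Pow cells" using block_subset[OF S, of T] by blast
  qed
  have "2 ^ L * (\<Sum>f\<in>?F. ?q f) = (\<Sum>f\<in>?F. \<Sum>T\<in>Pow {..<L}. ?q f)"
    by (simp add: card_Pow sum_distrib_left)
  also have "\<dots> = (\<Sum>f\<in>?F. \<Sum>T\<in>Pow {..<L}. ?q (sym_diff f (block S T)))"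
  proof (intro sum.cong refl)
    fix f T assume f: "f \<in> ?F" and T: "T \<in> Pow {..<L}"
    have "finite f" using f by (auto intro: finite_subset[of _ cells])
    moreover have "finite (block S T)" using T by (auto intro: finite_subset finite_block)
    ultimately have "chi (sym_diff f (block S T)) x = chi f x" if "x \<in> solutions S" for x
      using that T by (simp add: chi_sym_diff chi_block_solutions)
    then show "?q f = ?q (sym_diff f (block S T))" by simp
  qed
  also have "\<dots> = (\<Sum>z\<in>?F \<times> Pow {..<L}. ?q (?m z))"
    by (simp add: sum.cartesian_product case_prod_unfold)
  also have "\<dots> = (\<Sum>g\<in>?m ` (?F \<times> Pow {..<L}). ?q g)"
    by (rule sum.reindex[OF inj, symmetric, unfolded o_def])
  also have "\<dots> \<le> (\<Sum>g\<in>Pow cells. ?q g)"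
    by (rule sum_mono2[OF _ sub]) auto
  also have "\<dots> = 2 ^ card cells * (\<Sum>x\<in>solutions S. (u x)\<^sup>2)"
    by (rule parseval) (auto simp: solutions_subset)
  finally show ?thesis .
qed

text \<open>In the row block of \<open>S\<close> this is a convolution operator with Fourier
  coefficients \<open>a S f\<close>, up to normalisation, restricted to the given rows and
  columns.\<close>

definition kernel :: "((nat \<Rightarrow> nat) \<Rightarrow> (nat \<times> nat \<times> nat) set \<Rightarrow> real) \<Rightarrow>
    (nat \<Rightarrow> nat) \<times> (nat \<times> nat \<times> nat) set \<Rightarrow> (nat \<Rightarrow> nat) \<times> (nat \<times> nat \<times> nat) set \<Rightarrow> real" where
  "kernel a s c = (\<Sum>f\<in>Pow cells. a (fst s) f * chi f (snd s) * chi f (snd c))"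

lemma sum_Sigma_choices: "(\<Sum>z\<in>Sigma choices solutions. g z) = (\<Sum>S\<in>choices. \<Sum>x\<in>solutions S. g (S, x))"
  for g :: "_ \<Rightarrow> real"
  by (subst sum.Sigma) auto

lemma sum_singleton_Times: "(\<Sum>z\<in>{s} \<times> Y. g z) = (\<Sum>y\<in>Y. g (s, y))"
  for g :: "_ \<Rightarrow> real"
proof -
  have "{s} \<times> Y = Pair s ` Y" by auto
  then show ?thesis by (simp add: sum.reindex inj_on_def)
qed

lemma bil_kernel:
  "bil (Sigma choices solutions) ({s0} \<times> Y) (kernel a) u v =
    (\<Sum>S\<in>choices. \<Sum>f\<in>Pow cells. a S f * (\<Sum>x\<in>solutions S. u (S, x) * chi f x) * (\<Sum>y\<in>Y. v (s0, y) * chi f y))"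
proof -
  have "(\<Sum>x\<in>solutions S. \<Sum>y\<in>Y. u (S, x) * kernel a (S, x) (s0, y) * v (s0, y)) =
     (\<Sum>f\<in>Pow cells. a S f * (\<Sum>x\<in>solutions S. u (S, x) * chi f x) * (\<Sum>y\<in>Y. v (s0, y) * chi f y))" for S
  proof -
    have "(\<Sum>x\<in>solutions S. \<Sum>y\<in>Y. u (S, x) * kernel a (S, x) (s0, y) * v (s0, y)) =
      (\<Sum>x\<in>solutions S. \<Sum>y\<in>Y. \<Sum>f\<in>Pow cells. a S f * ((u (S, x) * chi f x) * (v (s0, y) * chi f y)))"
      by (intro sum.cong refl) (simp add: kernel_def sum_distrib_left sum_distrib_right mult_ac)
    also have "\<dots> = (\<Sum>x\<in>solutions S. \<Sum>f\<in>Pow cells. \<Sum>y\<in>Y. a S f * ((u (S, x) * chi f x) * (v (s0, y) * chi f y)))"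
      by (rule sum.cong[OF refl], rule sum.swap)
    also have "\<dots> = (\<Sum>f\<in>Pow cells. \<Sum>x\<in>solutions S. \<Sum>y\<in>Y. a S f * ((u (S, x) * chi f x) * (v (s0, y) * chi f y)))"
      by (rule sum.swap)
    also have "\<dots> = (\<Sum>f\<in>Pow cells. a S f * ((\<Sum>x\<in>solutions S. u (S, x) * chi f x) * (\<Sum>y\<in>Y. v (s0, y) * chi f y)))"
      unfolding sum_product by (simp add: sum_distrib_left)
    finally show ?thesis by (simp add: mult.assoc)
  qed
  moreover have "bil (Sigma choices solutions) ({s0} \<times> Y) (kernel a) u v =
      (\<Sum>S\<in>choices. \<Sum>x\<in>solutions S. \<Sum>y\<in>Y. u (S, x) * kernel a (S, x) (s0, y) * v (s0, y))"
    unfolding bil_def sum_Sigma_choices sum_singleton_Times by simp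
  ultimately show ?thesis by simp
qed

text \<open>Young's inequality separates the Fourier coefficients of \<open>u\<close> and
  \<open>v\<close>. Because of the support condition \<open>bessel\<close> bounds those of
  \<open>u\<close> in each row block, gaining \<open>2 ^ L\<close> over \<open>parseval\<close>,
  which is all that is available for \<open>v\<close>. The columns meet all row blocks at once,
  hence the sum of squares over \<open>S\<close>.\<close>

lemma form_le_kernel:
  assumes supp: "\<And>S f. S \<in> choices \<Longrightarrow> f \<subseteq> cells \<Longrightarrow> a S f \<noteq> 0 \<Longrightarrow> hits S (letters f) \<le> h"
    and sq: "\<And>f. f \<subseteq> cells \<Longrightarrow> (\<Sum>S\<in>choices. (a S f)\<^sup>2) \<le> \<nu>\<^sup>2"
    and \<nu>: "\<nu> > 0" and Y: "Y \<subseteq> Pow cells"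
  shows "form_le (Sigma choices solutions) ({s0} \<times> Y) (kernel a) (2 ^ card cells * \<nu> / sqrt (2 ^ L))"
proof (rule form_leI)
  fix u v :: "(nat \<Rightarrow> nat) \<times> (nat \<times> nat \<times> nat) set \<Rightarrow> real"
  \<comment> \<open>This scaling makes the Bessel and Parseval contributions equal.\<close>
  define s where "s = sqrt (2 ^ L :: real)"
  have s: "s > 0" "s\<^sup>2 = 2 ^ L" by (simp_all add: s_def)
  define p where "p = (\<lambda>S f. \<Sum>x\<in>solutions S. u (S, x) * chi f x)"
  define q where "q = (\<lambda>f. \<Sum>y\<in>Y. v (s0, y) * chi f y)"
  let ?F = "\<lambda>S. {f. f \<subseteq> cells \<and> hits S (letters f) \<le> h}"
  have young: "2 * (a S f * p S f * q f) \<le>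
      \<nu> * s * (if hits S (letters f) \<le> h then (p S f)\<^sup>2 else 0) + (a S f)\<^sup>2 * (q f)\<^sup>2 / (\<nu> * s)"
    if "S \<in> choices" "f \<in> Pow cells" for S f
  proof (cases "hits S (letters f) \<le> h")
    case True
    have "0 \<le> (\<nu> * s * p S f - a S f * q f)\<^sup>2" by simp
    also have "\<dots> = \<nu> * s * (\<nu> * s * (p S f)\<^sup>2 - 2 * (a S f * p S f * q f) + (a S f)\<^sup>2 * (q f)\<^sup>2 / (\<nu> * s))"
      using \<nu> s by (simp add: power2_eq_square field_simps)
    finally have "0 \<le> \<nu> * s * (p S f)\<^sup>2 - 2 * (a S f * p S f * q f) + (a S f)\<^sup>2 * (q f)\<^sup>2 / (\<nu> * s)"
      using mult_pos_pos[OF \<nu> s(1)] by (simp only: zero_le_mult_iff) linarith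
    then show ?thesis using True by simp
  next
    case False
    then have "a S f = 0" using supp that by blast
    then show ?thesis using False by simp
  qed
  have "2 * bil (Sigma choices solutions) ({s0} \<times> Y) (kernel a) u v = (\<Sum>S\<in>choices. \<Sum>f\<in>Pow cells. 2 * (a S f * p S f * q f))"
    unfolding bil_kernel p_def q_def by (simp add: sum_distrib_left)
  also have "\<dots> \<le> (\<Sum>S\<in>choices. \<Sum>f\<in>Pow cells. \<nu> * s * (if hits S (letters f) \<le> h then (p S f)\<^sup>2 else 0) + (a S f)\<^sup>2 * (q f)\<^sup>2 / (\<nu> * s))"
    by (intro sum_mono young)
  also have "\<dots> = (\<Sum>S\<in>choices. \<nu> * s * (\<Sum>f\<in>?F S. (p S f)\<^sup>2)) + (\<Sum>S\<in>choices. \<Sum>f\<in>Pow cells. (a S f)\<^sup>2 * (q f)\<^sup>2 / (\<nu> * s))"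
    by (simp add: sum.distrib sum_distrib_left[symmetric] sum.inter_filter[symmetric])
  also have "(\<Sum>S\<in>choices. \<Sum>f\<in>Pow cells. (a S f)\<^sup>2 * (q f)\<^sup>2 / (\<nu> * s)) =
      (\<Sum>f\<in>Pow cells. \<Sum>S\<in>choices. (a S f)\<^sup>2 * (q f)\<^sup>2 / (\<nu> * s))"
    by (rule sum.swap)
  also have "\<dots> = (\<Sum>f\<in>Pow cells. (\<Sum>S\<in>choices. (a S f)\<^sup>2) * (q f)\<^sup>2 / (\<nu> * s))"
    by (simp add: sum_divide_distrib sum_distrib_right)
  also have "\<dots> \<le> (\<Sum>f\<in>Pow cells. \<nu>\<^sup>2 * (q f)\<^sup>2 / (\<nu> * s))"
    using \<nu> s by (intro sum_mono divide_right_mono mult_right_mono sq) auto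
  also have "\<dots> = \<nu> / s * (\<Sum>f\<in>Pow cells. (q f)\<^sup>2)"
    using \<nu> s by (simp add: sum_distrib_left power2_eq_square)
  also have "(\<Sum>f\<in>Pow cells. (q f)\<^sup>2) = 2 ^ card cells * (\<Sum>y\<in>Y. (v (s0, y))\<^sup>2)"
    unfolding q_def by (rule parseval[OF _ Y]) simp
  also have "(\<Sum>S\<in>choices. \<nu> * s * (\<Sum>f\<in>?F S. (p S f)\<^sup>2)) \<le> 
      (\<Sum>S\<in>choices. \<nu> * s * (2 ^ card cells / s\<^sup>2 * (\<Sum>x\<in>solutions S. (u (S, x))\<^sup>2)))"
  proof (intro sum_mono mult_left_mono)
    fix S assume "S \<in> choices"
    from bessel[OF this, of "\<lambda>x. u (S, x)"]
    show "(\<Sum>f\<in>?F S. (p S f)\<^sup>2) \<le> 2 ^ card cells / s\<^sup>2 * (\<Sum>x\<in>solutions S. (u (S, x))\<^sup>2)"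
      unfolding p_def s(2) by (simp add: field_simps)
  qed (use \<nu> s in auto)
  also have "\<dots> = 2 ^ card cells * \<nu> / s * (\<Sum>S\<in>choices. \<Sum>x\<in>solutions S. (u (S, x))\<^sup>2)"
  proof -
    have "\<nu> * s * (2 ^ card cells / s\<^sup>2 * z) = 2 ^ card cells * \<nu> / s * z" for z
      using s(1) by (simp add: power2_eq_square)
    then show ?thesis by (simp only: sum_distrib_left)
  qed
  finally show "2 * bil (Sigma choices solutions) ({s0} \<times> Y) (kernel a) u v \<le>
     2 ^ card cells * \<nu> / sqrt (2 ^ L) * ((\<Sum>z\<in>Sigma choices solutions. (u z)\<^sup>2) + (\<Sum>z\<in>{s0} \<times> Y. (v z)\<^sup>2))"
    unfolding sum_Sigma_choices sum_singleton_Times s_def[symmetric] by (simp add: algebra_simps)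
qed

end



text \<open>\<open>x (a, i, j, b)\<close> says that bit \<open>j\<close> of letter \<open>i\<close> in group \<open>a\<close> is not \<open>b\<close>.\<close>

definition kxor_fun :: "nat \<Rightarrow> nat \<Rightarrow> nat \<Rightarrow> (nat \<times> nat \<times> nat \<times> bool \<Rightarrow> bool) \<Rightarrow> bool" where
  "kxor_fun k r L x \<longleftrightarrow> (\<exists>S v. (\<forall>a<k. S a < r) \<and> (\<forall>j<L. even (card {a. a < k \<and> v a j})) \<and>
     (\<forall>a<k. \<forall>j<L. \<not> x (a, S a, j, v a j)))"

definition positions :: "nat \<Rightarrow> nat \<Rightarrow> nat \<Rightarrow> (nat \<times> nat \<times> nat \<times> bool) set" where
  "positions k r L = {..<k} \<times> {..<r} \<times> {..<L} \<times> UNIV"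

context kxor
begin

text \<open>The sum of all characters of one letter vanishes at \<open>z\<close>, so the nontrivial ones contribute minus
  the trivial one.\<close>

lemma sum_letter:
  fixes \<alpha> :: "(nat \<times> nat) set \<Rightarrow> real"
  assumes z: "z \<subseteq> cells" "(a, i, j) \<in> z"
  shows "(\<Sum>f\<in>Pow cells. \<alpha> (letters f) * chi f z) = (\<Sum>f\<in>Pow cells. 
    (if (a, i) \<in> letters f then 0 else \<alpha> (letters f) - \<alpha> (insert (a, i) (letters f))) * chi f z)"
proof -
  define B where "B = {e \<in> cells. (fst e, fst (snd e)) = (a, i)}"
  have finB: "finite B" by (simp add: B_def)
  have zB: "z \<inter> B \<noteq> {}" using z by (auto simp: B_def)
  let ?l = "(a, i)"
  have letters: "letters (f \<union> g) = (if g = {} then letters f else insert ?l (letters f))"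
    if "g \<subseteq> B" for f g
  proof (cases "g = {}")
    case False
    then obtain e where e: "e \<in> g" by blast
    have "letters g = {?l}" using that e by (force simp: letters_def B_def)
    then show ?thesis using False by (simp add: letters_def image_Un)
  qed simp
  have sumB: "(\<Sum>g\<in>Pow B. chi g z) = 0"
  proof -
    have "chi g z = chi (z \<inter> B) g" if "g \<in> Pow B" for g
    proof -
      have "g \<inter> z = z \<inter> B \<inter> g" using that by auto
      then show ?thesis by (simp add: chi_def)
    qed
    then have "(\<Sum>g\<in>Pow B. chi g z) = (\<Sum>g\<in>Pow B. chi (z \<inter> B) g)" by simp
    also have "\<dots> = 0" using sum_chi[OF finB, of "z \<inter> B"] zB by simp
    finally show ?thesis .
  qed
  have "(\<Sum>f\<in>Pow cells. \<alpha> (letters f) * chi f z) =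
      (\<Sum>(f, g)\<in>Pow (cells - B) \<times> Pow B. \<alpha> (letters (f \<union> g)) * chi (f \<union> g) z)"
    by (rule sum.reindex_bij_witness[where i = "\<lambda>(f, g). f \<union> g" and j = "\<lambda>f. (f - B, f \<inter> B)"])
       (auto simp: B_def Un_Diff_Int)
  also have "\<dots> = (\<Sum>f\<in>Pow (cells - B). \<Sum>g\<in>Pow B. \<alpha> (letters (f \<union> g)) * chi (f \<union> g) z)"
    by (simp add: sum.cartesian_product)
  also have "\<dots> = (\<Sum>f\<in>Pow (cells - B). (\<alpha> (letters f) - \<alpha> (insert ?l (letters f))) * chi f z)"
  proof (intro sum.cong refl)
    fix f assume f: "f \<in> Pow (cells - B)"
    then have finf: "finite f" by (auto intro: finite_subset[of _ cells])
    \<comment> \<open>Every nonempty \<open>g\<close> gives the letter set with \<open>?l\<close>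
      inserted. Writing the weight at \<open>g = {}\<close> as that same weight plus
      \<open>?d\<close> leaves only \<open>?d\<close>, by \<open>sumB\<close>.\<close>
    let ?d = "\<alpha> (letters f) - \<alpha> (insert ?l (letters f))"
    have "(\<Sum>g\<in>Pow B. \<alpha> (letters (f \<union> g)) * chi (f \<union> g) z) =
       (\<Sum>g\<in>Pow B. chi f z * (\<alpha> (insert ?l (letters f)) * chi g z + (if g = {} then ?d else 0)))"
    proof (intro sum.cong refl)
      fix g assume g: "g \<in> Pow B"
      then have "finite g" "f \<inter> g = {}" using finB f by (auto intro: finite_subset)
      then have "chi (f \<union> g) z = chi f z * chi g z" using finf by (intro chi_Un)
      then show "\<alpha> (letters (f \<union> g)) * chi (f \<union> g) z =
          chi f z * (\<alpha> (insert ?l (letters f)) * chi g z + (if g = {} then ?d else 0))"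
        using g by (simp add: letters algebra_simps)
    qed
    also have "\<dots> = chi f z * (\<alpha> (insert ?l (letters f)) * (\<Sum>g\<in>Pow B. chi g z) + (\<Sum>g\<in>Pow B. if g = {} then ?d else 0))"
      by (simp only: sum_distrib_left[symmetric] sum.distrib)
    also have "\<dots> = ?d * chi f z" using finB by (simp add: sumB)
    finally show "(\<Sum>g\<in>Pow B. \<alpha> (letters (f \<union> g)) * chi (f \<union> g) z) = ?d * chi f z" .
  qed
  also have "\<dots> = (\<Sum>f\<in>Pow cells. 
    (if ?l \<in> letters f then 0 else \<alpha> (letters f) - \<alpha> (insert ?l (letters f))) * chi f z)"
  proof (rule sum.mono_neutral_cong_left)
    show "Pow (cells - B) \<subseteq> Pow cells" by auto
    have mem: "?l \<in> letters f \<longleftrightarrow> \<not> f \<subseteq> cells - B" if "f \<subseteq> cells" for f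
      using that by (force simp: letters_def B_def)
    show "\<forall>f\<in>Pow cells - Pow (cells - B). (if ?l \<in> letters f then 0 else \<alpha> (letters f) - \<alpha> (insert ?l (letters f))) * chi f z = 0"
      using mem by auto
    show "(\<alpha> (letters f) - \<alpha> (insert ?l (letters f))) * chi f z =
      (if ?l \<in> letters f then 0 else \<alpha> (letters f) - \<alpha> (insert ?l (letters f))) * chi f z"
      if "f \<in> Pow (cells - B)" for f
      using mem[of f] that by auto
  qed simp
  finally show ?thesis .
qed

section \<open>The weights and the effect of a query on them\<close>

definition weight :: "(nat \<Rightarrow> nat) \<Rightarrow> (nat \<times> nat) set \<Rightarrow> real" where
  "weight S W = (if hits S W \<le> h then real (r - card W) else 0)"

text \<open>The coefficient that \<open>sum_letter\<close> leaves after a query to letter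
  \<open>l\<close>.\<close>

definition weight_diff :: "nat \<times> nat \<Rightarrow> (nat \<Rightarrow> nat) \<Rightarrow> (nat \<times> nat) set \<Rightarrow> real" where
  "weight_diff l S W = (if l \<in> W then 0 else weight S W - weight S (insert l W))"

abbreviation "G \<equiv> kernel (\<lambda>S f. weight S (letters f))"

text \<open>An entry depends on \<open>x\<close> and \<open>y\<close> only through their symmetric
  difference, to which \<open>sum_letter\<close> applies as soon as it contains a cell of the
  letter.\<close>

lemma kernel_weight_diff:
  assumes "x \<subseteq> cells" "y \<subseteq> cells" "(a, i, j) \<in> sym_diff x y"
  shows "G (S, x) (s0, y) = kernel (\<lambda>S f. weight_diff (a, i) S (letters f)) (S, x) (s0, y)"
proof -
  have "finite x" "finite y" using assms(1,2) by (auto intro: finite_subset[of _ cells])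
  then have chi: "c * chi f x * chi f y = c * chi f (sym_diff x y)" for c f
    by (simp add: chi_sym_diff_right)
  show ?thesis
    unfolding kernel_def fst_conv snd_conv chi weight_diff_def
    by (rule sum_letter) (use assms in auto)
qed

text \<open>An exponential moment bound. The groups are chosen independently, so the sum of
  \<open>2 ^ hits S W\<close> is the product of the \<open>r + c a\<close>, at most
  \<open>r * exp (c a / r)\<close> each; the \<open>c a\<close> sum to at most
  \<open>r\<close>.\<close>

lemma count_hits:
  assumes W: "finite W" "card W \<le> r"
  shows "2 ^ h * real (card {S \<in> choices. h \<le> hits S W}) \<le> 3 * real r ^ k"
proof -
  define c where "c = (\<lambda>a. card {i. i < r \<and> (a, i) \<in> W})"
  have "2 ^ h * real (card {S \<in> choices. h \<le> hits S W}) = (\<Sum>S | S \<in> choices \<and> h \<le> hits S W. 2 ^ h)"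
    by simp
  also have "\<dots> \<le> (\<Sum>S | S \<in> choices \<and> h \<le> hits S W. 2 ^ hits S W)"
    by (intro sum_mono power_increasing) auto
  also have "\<dots> \<le> (\<Sum>S\<in>choices. 2 ^ hits S W)"
    by (intro sum_mono2) auto
  also have "\<dots> = (\<Sum>S\<in>choices. \<Prod>a<k. if (a, S a) \<in> W then 2 else 1 :: real)"
  proof (intro sum.cong refl)
    fix S
    have "{a. a < k \<and> (a, S a) \<in> W} = {a \<in> {..<k}. (a, S a) \<in> W}" by auto
    then show "2 ^ hits S W = (\<Prod>a<k. if (a, S a) \<in> W then 2 else 1 :: real)"
      unfolding hits_def by (simp only: prod.inter_filter[symmetric] finite_lessThan prod_constant)
  qed
  also have "\<dots> = (\<Prod>a<k. \<Sum>i<r. if (a, i) \<in> W then 2 else 1)"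
    unfolding choices_def by (rule prod_sum_PiE[symmetric]) auto
  also have "\<dots> \<le> (\<Prod>a<k. real r * exp (real (c a) / real r))"
  proof (rule prod_mono, intro conjI)
    fix a
    have "(\<Sum>i<r. if (a, i) \<in> W then 2 else 1 :: real) = (\<Sum>i<r. 1 + (if (a, i) \<in> W then 1 else 0))"
      by (intro sum.cong) auto
    also have "\<dots> = real r + real (c a)"
      by (simp add: sum.distrib c_def sum.If_cases Collect_conj_eq[symmetric] lessThan_def)
    also have "\<dots> = real r * (1 + real (c a) / real r)" using r by (simp add: distrib_left)
    also have "\<dots> \<le> real r * exp (real (c a) / real r)"
      by (intro mult_left_mono exp_ge_add_one_self) auto
    finally show "(\<Sum>i<r. if (a, i) \<in> W then 2 else 1) \<le> real r * exp (real (c a) / real r)" .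
  qed (auto intro: sum_nonneg)
  also have "\<dots> = real r ^ k * exp ((\<Sum>a<k. real (c a)) / real r)"
    by (simp add: prod.distrib exp_sum[symmetric] sum_divide_distrib)
  also have "\<dots> \<le> real r ^ k * 3"
  proof -
    have "(\<Sum>a<k. c a) = card (SIGMA a:{..<k}. {i. i < r \<and> (a, i) \<in> W})"
      unfolding c_def by simp
    also have "\<dots> \<le> card W" using W by (intro card_mono) auto
    finally have "(\<Sum>a<k. real (c a)) \<le> real r" using W by (simp add: of_nat_sum[symmetric] del: of_nat_sum)
    then have "(\<Sum>a<k. real (c a)) / real r \<le> 1" using r by simp
    then have "exp ((\<Sum>a<k. real (c a)) / real r) \<le> exp 1" by simp
    also have "\<dots> \<le> 3" by (rule exp_le)
    finally show ?thesis by (intro mult_left_mono) auto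
  qed
  finally show ?thesis by simp
qed

text \<open>Below the threshold the weight drops by 0 or 1, and above it both weights vanish. Only
  if \<open>l\<close> lifts the hits from \<open>h\<close> to \<open>h + 1\<close> is the whole
  weight \<open>r - card W\<close> lost.\<close>

lemma weight_diff_square:
  assumes W: "finite W"
  shows "(weight_diff l S W)\<^sup>2 \<le> 1 + (if card W \<le> r \<and> h \<le> hits S W then (real r)\<^sup>2 else 0)"
proof (cases "l \<in> W \<or> h < hits S W")
  case True
  have "h < hits S (insert l W)" if "h < hits S W"
    using hits_mono[OF subset_insertI[of W l], of S] that by linarith
  then show ?thesis using True by (auto simp: weight_diff_def weight_def)
next
  case False
  show ?thesis
  proof (cases "hits S (insert l W) \<le> h")
    case True
    then have "weight_diff l S W = real (r - card W) - real (r - Suc (card W))"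
      using False W by (simp add: weight_diff_def weight_def)
    then have "weight_diff l S W = 0 \<or> weight_diff l S W = 1" by (cases "card W < r") auto
    then show ?thesis by auto
  next
    case ins: False
    then have hit: "h \<le> hits S W" using hits_insert[of S l W] by simp
    have wd: "weight_diff l S W = real (r - card W)"
      using False ins by (simp add: weight_diff_def weight_def)
    have "(weight_diff l S W)\<^sup>2 \<le> (real r)\<^sup>2" unfolding wd by (intro power_mono) auto
    then have "(weight_diff l S W)\<^sup>2 \<le> 1 + (real r)\<^sup>2" by linarith
    moreover have "weight_diff l S W = 0" if "\<not> card W \<le> r" using wd that by simp
    ultimately show ?thesis using hit by (cases "card W \<le> r") (simp_all only: simp_thms if_True if_False, simp)
  qed
qed

text \<open>The jumps cost \<open>r ^ 2\<close> on at most a fraction \<open>3 / 2 ^ h\<close> of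
  the choices, no more in total than the unit differences on all of them.\<close>

lemma sum_weight_diff_square:
  assumes W: "finite W"
  shows "(\<Sum>S\<in>choices. (weight_diff l S W)\<^sup>2) \<le> 2 * real r ^ k"
proof -
  have "(\<Sum>S\<in>choices. (weight_diff l S W)\<^sup>2) \<le>
      (\<Sum>S\<in>choices. 1 + (if card W \<le> r \<and> h \<le> hits S W then (real r)\<^sup>2 else 0))"
    by (intro sum_mono weight_diff_square W)
  also have "\<dots> = real r ^ k + (\<Sum>S\<in>choices. if card W \<le> r \<and> h \<le> hits S W then (real r)\<^sup>2 else 0)"
    by (simp add: sum.distrib card_choices)
  also have "(\<Sum>S\<in>choices. if card W \<le> r \<and> h \<le> hits S W then (real r)\<^sup>2 else 0) \<le> real r ^ k"
  proof (cases "card W \<le> r")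
    case True
    let ?n = "real (card {S \<in> choices. h \<le> hits S W})"
    have "3 * (real r)\<^sup>2 * ?n \<le> 2 ^ h * ?n"
    proof (rule mult_right_mono)
      show "3 * (real r)\<^sup>2 \<le> 2 ^ h" using rh of_nat_mono[OF rh, where 'a = real] by simp
    qed simp
    also have "\<dots> \<le> 3 * real r ^ k" by (rule count_hits[OF W True])
    finally have "(real r)\<^sup>2 * ?n \<le> real r ^ k" by simp
    moreover have "(\<Sum>S\<in>choices. if card W \<le> r \<and> h \<le> hits S W then (real r)\<^sup>2 else 0) = (real r)\<^sup>2 * ?n"
      using True by (simp add: sum.inter_filter[symmetric])
    ultimately show ?thesis by simp
  qed simp
  finally show ?thesis by simp
qed

text \<open>For every bit exactly its wrong value is excluded, so the input determines all
  letters.\<close>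

definition lab :: "(nat \<Rightarrow> nat) \<times> (nat \<times> nat \<times> nat) set \<Rightarrow> nat \<times> nat \<times> nat \<times> bool \<Rightarrow> bool" where
  "lab s = (\<lambda>(a, i, j, b). ((a, i, j) \<in> snd s) \<noteq> b)"

definition unsolvable :: "(nat \<times> nat \<times> nat) set set" where
  "unsolvable = Pow cells - (\<Union>S\<in>choices. solutions S)"

lemma kxor_fun_lab:
  assumes "y \<subseteq> cells"
  shows "kxor_fun k r L (lab (s, y)) \<longleftrightarrow> (\<exists>S\<in>choices. y \<in> solutions S)"
proof
  assume "kxor_fun k r L (lab (s, y))"
  then obtain S v where S: "\<forall>a<k. S a < r" and even: "\<forall>j<L. even (card {a. a < k \<and> v a j})"
    and v: "\<forall>a<k. \<forall>j<L. v a j \<longleftrightarrow> (a, S a, j) \<in> y"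
    unfolding kxor_fun_def lab_def by auto
  define S' where "S' = restrict S {..<k}"
  have "S' \<in> choices" using S by (auto simp: S'_def choices_def)
  moreover have "{a. a < k \<and> (a, S' a, j) \<in> y} = {a. a < k \<and> v a j}" if "j < L" for j
    using v that by (auto simp: S'_def)
  then have "y \<in> solutions S'" using assms even by (auto simp: solutions_def odd_at_def)
  ultimately show "\<exists>S\<in>choices. y \<in> solutions S" by blast
next
  assume "\<exists>S\<in>choices. y \<in> solutions S"
  then obtain S where "S \<in> choices" "y \<in> solutions S" by blast
  then show "kxor_fun k r L (lab (s, y))"
    unfolding kxor_fun_def lab_def
    by (intro exI[of _ S] exI[of _ "\<lambda>a j. (a, S a, j) \<in> y"]) (auto simp: solutions_def odd_at_def choices_def)
qed

text \<open>Each of the \<open>r ^ k\<close> choices is solved by a fraction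
  \<open>1 / 2 ^ L\<close> of the inputs.\<close>

lemma card_unsolvable: "2 ^ card cells \<le> 2 * real (card unsolvable)"
proof -
  have fin: "finite (\<Union>S\<in>choices. solutions S)" by simp
  have "real (card (\<Union>S\<in>choices. solutions S)) \<le> (\<Sum>S\<in>choices. real (card (solutions S)))"
    unfolding of_nat_sum[symmetric] of_nat_le_iff by (rule card_UN_le) simp
  then have "2 ^ L * real (card (\<Union>S\<in>choices. solutions S)) \<le> (\<Sum>S\<in>choices. 2 ^ L * real (card (solutions S)))"
    by (simp add: sum_distrib_left[symmetric])
  also have "\<dots> = real r ^ k * 2 ^ card cells" by (simp add: card_solutions card_choices)
  finally have "2 * (2 ^ L * real (card (\<Union>S\<in>choices. solutions S))) \<le> (2 * real r ^ k) * 2 ^ card cells"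
    by simp
  also have "\<dots> \<le> 2 ^ L * 2 ^ card cells"
    using of_nat_mono[OF L, where 'a = real] by (intro mult_right_mono) simp_all
  finally have "2 * real (card (\<Union>S\<in>choices. solutions S)) \<le> 2 ^ card cells" by simp
  moreover have "real (card unsolvable) = 2 ^ card cells - real (card (\<Union>S\<in>choices. solutions S))"
  proof -
    have sub: "(\<Union>S\<in>choices. solutions S) \<subseteq> Pow cells" using solutions_subset by blast
    then have "card (\<Union>S\<in>choices. solutions S) \<le> card (Pow cells)" by (intro card_mono) auto
    then show ?thesis unfolding unsolvable_def using card_Diff_subset[OF fin sub] by (simp add: card_Pow of_nat_diff)
  qed
  ultimately show ?thesis by simp
qed

text \<open>The columns need no choice; they carry the dummy \<open>\<lambda>_. 0\<close> to have the same type as the rows.\<close>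

theorem kxor_adversary:
  obtains w \<beta> \<mu> where
    "adversary (positions k r L) (kxor_fun k r L) (Sigma choices solutions) ({\<lambda>_. 0} \<times> unsolvable) lab G w \<beta> \<mu>"
    "\<mu> > 0" "\<beta> \<ge> real r / 2 * \<mu>"
proof -
  let ?R = "Sigma choices solutions" and ?C = "{\<lambda>_. 0} \<times> unsolvable"
  have fin_unsolvable: "finite unsolvable" and unsolvable_subset: "unsolvable \<subseteq> Pow cells" by (simp_all add: unsolvable_def)
  have labR: "kxor_fun k r L (lab s)" if "s \<in> ?R" for s
    using that solutions_subset kxor_fun_lab by (cases s) blast
  have labC: "\<not> kxor_fun k r L (lab s)" if "s \<in> ?C" for s
    using that kxor_fun_lab by (cases s) (auto simp: unsolvable_def)
  have "0 < (2 :: real) ^ card cells" by simp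
  then have "0 < real (card unsolvable)" using card_unsolvable by linarith
  then have "card unsolvable \<noteq> 0" by simp
  then have neC: "?C \<noteq> {}" by auto
  have "real (card choices) > 0" using r by (simp add: card_choices)
  then obtain S where S: "S \<in> choices" by fastforce
  have "{} \<in> solutions S" by (simp add: solutions_def odd_at_def)
  with S have neR: "?R \<noteq> {}" by blast
  have disj: "?R \<inter> ?C = {}" using labR labC by blast
  obtain w \<beta> where w: "(\<Sum>r\<in>?R. (w r)\<^sup>2) = 1" "(\<Sum>c\<in>?C. (w c)\<^sup>2) = 1" "bil ?R ?C G w w = \<beta>"
    "form_le ?R ?C G \<beta>"
    and max: "\<And>u v. bil ?R ?C G u v \<le> \<beta> * sqrt (\<Sum>r\<in>?R. (u r)\<^sup>2) * sqrt (\<Sum>c\<in>?C. (v c)\<^sup>2)"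
    by (rule norm_attained[of ?R ?C G]) (use disj neR neC fin_unsolvable in auto)
  define \<nu> where "\<nu> = sqrt (2 * real r ^ k)"
  have \<nu>: "\<nu> > 0" "\<nu>\<^sup>2 = 2 * real r ^ k" using r by (simp_all add: \<nu>_def)
  define s where "s = sqrt (2 ^ L :: real)"
  have s: "s > 0" "s\<^sup>2 = 2 ^ L" by (simp_all add: s_def)
  define \<mu> where "\<mu> = 2 ^ card cells * \<nu> / s"
  have \<mu>: "\<mu> > 0" using \<nu> s by (simp add: \<mu>_def)
  have "adversary (positions k r L) (kxor_fun k r L) ?R ?C lab G w \<beta> \<mu>"
  proof
    show "finite (positions k r L)" "finite ?R" "finite ?C"
      using fin_unsolvable by (auto simp: positions_def)
    fix p assume "p \<in> positions k r L"
    obtain a i j b where p: "p = (a, i, j, b)" by (cases p)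
    let ?K = "kernel (\<lambda>S f. weight_diff (a, i) S (letters f))"
    have "form_le ?R ?C ?K \<mu>"
      unfolding \<mu>_def s_def
    proof (rule form_le_kernel)
      show "hits S (letters f) \<le> h" if "weight_diff (a, i) S (letters f) \<noteq> 0" for S f
        using that hits_mono[of "letters f" "insert (a, i) (letters f)" S]
        by (auto simp: weight_diff_def weight_def split: if_splits)
      show "(\<Sum>S\<in>choices. (weight_diff (a, i) S (letters f))\<^sup>2) \<le> \<nu>\<^sup>2" if "f \<subseteq> cells" for f
        unfolding \<nu>(2) using that
        by (intro sum_weight_diff_square finite_letters) (auto intro: finite_subset[of _ cells])
    qed (use \<nu> unsolvable_subset in auto)
    \<comment> \<open>\<open>G\<close> is known to agree with the kernel of differences only at
      entries that differ in the queried bit; restricting the latter to these keeps its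
      bound.\<close>
    then have "form_le ?R ?C (\<lambda>s c. if ((a, i, j) \<in> snd s) \<noteq> ((a, i, j) \<in> snd c) then ?K s c else 0) \<mu>"
      by (rule form_le_query_part)
    moreover have "query_part lab p G s c = (if ((a, i, j) \<in> snd s) \<noteq> ((a, i, j) \<in> snd c) then ?K s c else 0)"
      if "s \<in> ?R" "c \<in> ?C" for s c
    proof -
      obtain S x s0 y where sc: "s = (S, x)" "c = (s0, y)" by (cases s; cases c)
      then have "x \<subseteq> cells" "y \<subseteq> cells" using that solutions_subset unsolvable_subset by auto
      then show ?thesis
        using kernel_weight_diff[of x y a i j S s0] by (auto simp: sc query_part_def lab_def p)
    qed
    ultimately show "form_le ?R ?C (query_part lab p G) \<mu>"
      by (subst form_le_cong) auto
  qed (use w labR labC in auto)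
  moreover have "\<beta> \<ge> real r / 2 * \<mu>"
  proof -
    define n where "n = real r ^ k * 2 ^ card cells / 2 ^ L"
    define m where "m = real (card unsolvable)"
    have n: "n > 0" using r by (simp add: n_def)
    have m: "m > 0" "2 ^ card cells \<le> 2 * m" using card_unsolvable by (simp_all add: m_def) (use \<open>card unsolvable \<noteq> 0\<close> in simp)
    \<comment> \<open>The all-ones vectors see only the trivial character, of weight
      \<open>r\<close>: up to \<open>h\<close> hits the others sum to 0 over
      \<open>solutions S\<close>, and beyond that their weight is 0. The numbers of rows and columns
      are \<open>n\<close> and \<open>m\<close>.\<close>
    have bil: "bil ?R ?C G (\<lambda>_. 1) (\<lambda>_. 1) = real r * n * m"
    proof -
      have "(\<Sum>f\<in>Pow cells. weight S (letters f) * (\<Sum>x\<in>solutions S. 1 * chi f x) * (\<Sum>y\<in>unsolvable. 1 * chi f y)) = 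
          real r * (2 ^ card cells / 2 ^ L) * m" if "S \<in> choices" for S
      proof -
        have "(\<Sum>f\<in>Pow cells. weight S (letters f) * (\<Sum>x\<in>solutions S. 1 * chi f x) * (\<Sum>y\<in>unsolvable. 1 * chi f y)) =
            (\<Sum>f\<in>Pow cells. if f = {} then real r * (2 ^ card cells / 2 ^ L) * m else 0)"
        proof (intro sum.cong refl)
          fix f assume f: "f \<in> Pow cells"
          show "weight S (letters f) * (\<Sum>x\<in>solutions S. 1 * chi f x) * (\<Sum>y\<in>unsolvable. 1 * chi f y) =
              (if f = {} then real r * (2 ^ card cells / 2 ^ L) * m else 0)"
          proof (cases "hits S (letters f) \<le> h")
            case True
            have "(\<Sum>x\<in>solutions S. chi f x) = (if f = {} then 2 ^ card cells / 2 ^ L else 0)"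
              using sum_solutions_chi[OF that, of f] f True by (cases "f = {}") (simp_all add: field_simps)
            then show ?thesis by (auto simp: weight_def letters_def hits_def m_def)
          next
            case False
            then have "f \<noteq> {}" by (auto simp: letters_def hits_def)
            then show ?thesis using False by (simp add: weight_def)
          qed
        qed
        then show ?thesis by simp
      qed
      then show ?thesis unfolding bil_kernel by (simp add: card_choices n_def)
    qed
    have norms: "(\<Sum>z\<in>?R. 1\<^sup>2 :: real) = n" "(\<Sum>z\<in>?C. 1\<^sup>2 :: real) = m"
    proof -
      have "real (card (solutions S)) = 2 ^ card cells / 2 ^ L" if "S \<in> choices" for S
        using card_solutions[OF that] by (simp add: field_simps)
      then show "(\<Sum>z\<in>?R. 1\<^sup>2 :: real) = n"
        unfolding sum_Sigma_choices by (simp add: card_choices n_def)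
      show "(\<Sum>z\<in>?C. 1\<^sup>2 :: real) = m" unfolding sum_singleton_Times by (simp add: m_def)
    qed
    have "real r * n * m \<le> \<beta> * sqrt n * sqrt m"
      using max[of "\<lambda>_. 1" "\<lambda>_. 1"] unfolding bil norms .
    moreover have "(sqrt n * sqrt m)\<^sup>2 = n * m" using n m by (simp add: power_mult_distrib)
    ultimately have "(real r * (sqrt n * sqrt m)) * (sqrt n * sqrt m) \<le> \<beta> * (sqrt n * sqrt m)"
      by (simp only: power2_eq_square mult.assoc)
    then have "real r * (sqrt n * sqrt m) \<le> \<beta>" by (rule mult_right_le_imp_le) (use n m in simp)
    \<comment> \<open>Exactly half of \<open>2 ^ card cells\<close> enters here, and at least that
      many inputs are unsolvable.\<close>
    moreover have "\<mu> / 2 \<le> sqrt n * sqrt m"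
    proof (rule power2_le_imp_le)
      have "(\<mu> / 2)\<^sup>2 = (2 ^ card cells)\<^sup>2 * real r ^ k / (2 * 2 ^ L)"
        unfolding \<mu>_def power_divide power_mult_distrib \<nu>(2) s(2) by simp
      also have "\<dots> = n * (2 ^ card cells / 2)" by (simp add: n_def power2_eq_square mult_ac)
      also have "\<dots> \<le> n * m" using n m by (intro mult_left_mono) auto
      also have "\<dots> = (sqrt n * sqrt m)\<^sup>2" using n m by (simp add: power_mult_distrib)
      finally show "(\<mu> / 2)\<^sup>2 \<le> (sqrt n * sqrt m)\<^sup>2" .
    qed (use n m in simp)
    then have "real r * (\<mu> / 2) \<le> real r * (sqrt n * sqrt m)" by (intro mult_left_mono) auto
    ultimately show ?thesis by (simp add: mult.assoc)
  qed
  ultimately show ?thesis using \<mu> that by blast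
qed

end



section \<open>Querying all variables\<close>

text \<open>Without an algorithm for \<open>f\<close>, the \<open>LEAST\<close> in the definition of the quantum query complexity would
  be an unspecified number.\<close>

definition perm_mat :: "nat \<Rightarrow> (nat \<Rightarrow> nat) \<Rightarrow> complex mat" where
  "perm_mat d \<pi> = mat d d (\<lambda>(r, c). if r = \<pi> c then 1 else 0)"

lemma perm_mat_unitary:
  assumes "bij_betw \<pi> {..<d} {..<d}"
  shows "unitary_mat d (perm_mat d \<pi>)"
proof -
  have inj: "\<pi> i = \<pi> j \<longleftrightarrow> i = j" if "i < d" "j < d" for i j
    using assms that by (auto simp: bij_betw_def inj_on_def)
  have im: "\<pi> i < d" if "i < d" for i using assms that by (auto simp: bij_betw_def)
  have carrier: "perm_mat d \<pi> \<in> carrier_mat d d" by (simp add: perm_mat_def)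
  have dims: "dim_row (mat_adjoint (perm_mat d \<pi>)) = d" "dim_col (mat_adjoint (perm_mat d \<pi>)) = d"
    by (simp_all add: mat_adjoint_def perm_mat_def)
  have adj: "mat_adjoint (perm_mat d \<pi>) $$ (i, j) = (if j = \<pi> i then 1 else 0)" if "i < d" "j < d" for i j
    using that by (simp add: mat_adjoint_index[OF carrier]) (simp add: perm_mat_def)
  have entry: "perm_mat d \<pi> $$ (i, j) = (if i = \<pi> j then 1 else 0)" if "i < d" "j < d" for i j
    using that by (simp add: perm_mat_def)
  have "(mat_adjoint (perm_mat d \<pi>) * perm_mat d \<pi>) $$ (i, j) = 1\<^sub>m d $$ (i, j)" if "i < d" "j < d" for i j
  proof -
    have "(mat_adjoint (perm_mat d \<pi>) * perm_mat d \<pi>) $$ (i, j) =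
        (\<Sum>k<d. mat_adjoint (perm_mat d \<pi>) $$ (i, k) * perm_mat d \<pi> $$ (k, j))"
      using that dims carrier by (simp add: scalar_prod_def atLeast0LessThan)
    also have "\<dots> = (\<Sum>k<d. if k = \<pi> i then (if i = j then 1 else 0) else 0)"
      by (intro sum.cong refl) (use that in \<open>auto simp: adj entry inj\<close>)
    finally show ?thesis using that im by simp
  qed
  moreover have "(perm_mat d \<pi> * mat_adjoint (perm_mat d \<pi>)) $$ (i, j) = 1\<^sub>m d $$ (i, j)" if "i < d" "j < d" for i j
  proof -
    have "i \<in> \<pi> ` {..<d}" using that by (simp add: bij_betw_imp_surj_on[OF assms])
    then obtain i' where i': "i' < d" "i = \<pi> i'" by auto
    have "(perm_mat d \<pi> * mat_adjoint (perm_mat d \<pi>)) $$ (i, j) =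
        (\<Sum>k<d. perm_mat d \<pi> $$ (i, k) * mat_adjoint (perm_mat d \<pi>) $$ (k, j))"
      using that dims carrier by (simp add: scalar_prod_def atLeast0LessThan)
    also have "\<dots> = (\<Sum>k<d. if k = i' then (if i = j then 1 else 0) else 0)"
      by (intro sum.cong refl) (use that i' in \<open>auto simp: adj entry inj\<close>)
    finally show ?thesis using that i' by simp
  qed
  ultimately have "mat_adjoint (perm_mat d \<pi>) * perm_mat d \<pi> = 1\<^sub>m d"
      "perm_mat d \<pi> * mat_adjoint (perm_mat d \<pi>) = 1\<^sub>m d"
    using dims carrier by (auto intro!: eq_matI)
  with carrier show ?thesis by (simp add: unitary_mat_def)
qed

lemma perm_mat_unit_vec:
  assumes "c < d" "\<pi> c < d"
  shows "perm_mat d \<pi> *\<^sub>v unit_vec d c = unit_vec d (\<pi> c)"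
proof (rule eq_vecI)
  fix k assume "k < dim_vec (unit_vec d (\<pi> c) :: complex vec)"
  then have k: "k < d" by simp
  have "(perm_mat d \<pi> *\<^sub>v unit_vec d c) $ k = (\<Sum>j<d. perm_mat d \<pi> $$ (k, j) * unit_vec d c $ j)"
    using k by (simp add: scalar_prod_def atLeast0LessThan perm_mat_def)
  also have "\<dots> = (\<Sum>j<d. if j = c then (if k = \<pi> c then 1 else 0) else 0)"
    by (intro sum.cong refl) (use k assms in \<open>auto simp: perm_mat_def\<close>)
  finally have "(perm_mat d \<pi> *\<^sub>v unit_vec d c) $ k = (\<Sum>j<d. if j = c then (if k = \<pi> c then 1 else 0) else 0)" .
  then show "(perm_mat d \<pi> *\<^sub>v unit_vec d c) $ k = unit_vec d (\<pi> c) $ k"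
    using k assms by simp
qed (simp add: perm_mat_def)

lemma query_mat_unit_vec:
  assumes "c < 2 * N * m"
  shows "query_mat N m x *\<^sub>v unit_vec (2 * N * m) c =
    unit_vec (2 * N * m) (if x (query_index N c) then flip_bit c else c)"
proof (rule eq_vecI)
  let ?c = "if x (query_index N c) then flip_bit c else c"
  have c': "?c < 2 * N * m" using assms flip_bit_less[of c "N * m"] by (simp add: mult.assoc)
  fix k assume "k < dim_vec (unit_vec (2 * N * m) ?c :: complex vec)"
  then have k: "k < 2 * N * m" by simp
  let ?k = "if x (query_index N k) then flip_bit k else k"
  have k': "?k < 2 * N * m" using k flip_bit_less[of k "N * m"] by (simp add: mult.assoc)
  have "?k = c \<longleftrightarrow> k = ?c"
  proof
    assume "?k = c" then show "k = ?c" by (auto split: if_splits)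
  next
    assume "k = ?c" then show "?k = c" by (auto split: if_splits)
  qed
  then show "(query_mat N m x *\<^sub>v unit_vec (2 * N * m) c) $ k = unit_vec (2 * N * m) ?c $ k"
    using k k' c' assms by (subst query_mat_vec) auto
qed (simp add: query_mat_def)

text \<open>The workspace stores the set of ones found so far; after each query the answer bit is
  swapped into it.\<close>

lemma quantum_computes_all_queries:
  assumes N: "N > 0"
  shows "quantum_computes N f N"
proof -
  define d where "d = 2 * N * 2 ^ N"
  define B where "B = (UNIV :: bool set) \<times> {1..N} \<times> Pow {1..N}"
  obtain W where W: "bij_betw W {..<2 ^ N :: nat} (Pow {1..N})"
  proof -
    have "card {..<2 ^ N :: nat} = card (Pow {1..N})" by (simp add: card_Pow)
    then show ?thesis using that finite_same_card_bij[of "{..<2 ^ N :: nat}" "Pow {1..N}"] by auto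
  qed
  define dec where "dec = (\<lambda>k. (odd k, query_index N k, W (k div 2 div N)))"
  have lt: "k div 2 div N < 2 ^ N" if "k < d" for k
    using that N by (simp add: d_def div_less_iff_less_mult mult_ac less_mult_imp_div_less)
  have dec_in: "dec k \<in> B" if "k < d" for k
    using lt[OF that] W N by (auto simp: dec_def B_def bij_betw_def query_index_def Suc_le_eq)
  have "inj_on dec {..<d}"
  proof (rule inj_onI)
    fix k l assume k: "k \<in> {..<d}" and l: "l \<in> {..<d}" and eq: "dec k = dec l"
    have "k div 2 div N = l div 2 div N"
      using eq W lt k l by (auto simp: dec_def bij_betw_def inj_on_def)
    moreover have "k div 2 mod N = l div 2 mod N" using eq by (simp add: dec_def query_index_def)
    ultimately have "k div 2 = l div 2" by (metis div_mult_mod_eq)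
    moreover have "odd k = odd l" using eq by (simp add: dec_def)
    ultimately show "k = l" by (metis div_2_inj)
  qed
  moreover have "card B = card {..<d}" by (simp add: B_def card_cartesian_product card_Pow d_def)
  moreover have "dec ` {..<d} \<subseteq> B" using dec_in by auto
  moreover have "finite B" by (simp add: B_def)
  ultimately have dec: "bij_betw dec {..<d} B"
    by (simp add: bij_betw_def card_image card_subset_eq)
  \<comment> \<open>Exchanging the answer bit with the membership of \<open>i\<close> in
    \<open>w\<close> is reversible and resets the answer bit to 0 if \<open>i\<close> was not yet
    stored. The query register advances cyclically, to remain a bijection.\<close>
  define \<sigma> where "\<sigma> = (\<lambda>(b, i, w). (i \<in> w, if i = N then 1 else Suc i, if b then insert i w else w - {i}))"
  have \<sigma>_in: "\<sigma> ` B \<subseteq> B"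
    using N by (auto simp: \<sigma>_def B_def split: if_splits)
  have "inj_on \<sigma> B"
  proof (rule inj_onI)
    fix z z' assume z: "z \<in> B" "z' \<in> B" and eq: "\<sigma> z = \<sigma> z'"
    obtain b i w b' i' w' where zz: "z = (b, i, w)" "z' = (b', i', w')" by (metis prod.exhaust)
    note e = eq[unfolded zz \<sigma>_def prod.case prod.inject]
    note w = e[THEN conjunct1] and nxt = e[THEN conjunct2, THEN conjunct1]
      and ins = e[THEN conjunct2, THEN conjunct2]
    have "0 < i" "0 < i'" using z by (auto simp: zz B_def)
    then have i: "i' = i" using nxt by (cases "i = N"; cases "i' = N") simp_all
    have "i \<in> (if b then insert i w else w - {i}) \<longleftrightarrow> b" "i \<in> (if b' then insert i w' else w' - {i}) \<longleftrightarrow> b'"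
      by simp_all
    then have b: "b' = b" using ins unfolding i by simp
    have "w - {i} = w' - {i}" using ins unfolding i b by (cases b) auto
    then have "w' = w" using w unfolding i by blast
    then show "z = z'" using i b by (simp add: zz)
  qed
  then have \<sigma>: "bij_betw \<sigma> B B"
    using \<sigma>_in \<open>finite B\<close> by (simp add: bij_betw_def endo_inj_surj)
  define enc where "enc = inv_into {..<d} dec"
  have enc: "bij_betw enc B {..<d}" unfolding enc_def by (rule bij_betw_inv_into[OF dec])
  have dec_enc: "dec (enc z) = z" if "z \<in> B" for z
    unfolding enc_def using dec that by (rule bij_betw_inv_into_right)
  have enc_less: "enc z < d" if "z \<in> B" for z using enc that by (auto simp: bij_betw_def)
  define \<pi> where "\<pi> = enc \<circ> \<sigma> \<circ> dec"
  have \<pi>: "bij_betw \<pi> {..<d} {..<d}"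
    unfolding \<pi>_def comp_assoc by (intro bij_betw_trans[OF _ enc] bij_betw_trans[OF dec \<sigma>])
  \<comment> \<open>\<open>W\<close> is an arbitrary enumeration, so the encoded initial
    configuration need not have index 0; the first unitary moves the initial basis vector
    there.\<close>
  define start where "start = enc (False, 1, {})"
  have start: "start < d" "dec start = (False, 1, {})"
    using N by (auto simp: start_def B_def intro!: enc_less dec_enc)
  have d: "0 < d" using N by (simp add: d_def)
  have \<tau>: "bij_betw (transpose 0 start) {..<d} {..<d}"
    using permutes_swap_id[of 0 "{..<d}" start] d start by (auto intro: permutes_imp_bij)
  define U where "U = (\<lambda>t :: nat. if t = 0 then perm_mat d (transpose 0 start) else perm_mat d \<pi>)"
  have U: "unitary_mat d (U t)" for t
    unfolding U_def using perm_mat_unitary[OF \<tau>] perm_mat_unitary[OF \<pi>] by simp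
  have state: "\<exists>c<d. query_state N (2 ^ N) U x t = unit_vec d c \<and>
      dec c = (False, if t = N then 1 else Suc t, {i \<in> {1..t}. x i})" if "t \<le> N" for t x
    using that
  proof (induction t)
    case 0
    have "query_state N (2 ^ N) U x 0 = unit_vec d start"
      using perm_mat_unit_vec[of 0 d "transpose 0 start"] d start by (simp add: U_def d_def[symmetric])
    then show ?case using start N by auto
  next
    case (Suc t)
    then obtain c where c: "c < d" "query_state N (2 ^ N) U x t = unit_vec d c"
      "dec c = (False, Suc t, {i \<in> {1..t}. x i})" by auto
    define c' where "c' = (if x (query_index N c) then flip_bit c else c)"
    have c': "c' < d" using c(1) flip_bit_less[of c "N * 2 ^ N"] by (simp add: c'_def d_def mult.assoc)
    have "dec c' = (x (Suc t), Suc t, {i \<in> {1..t}. x i})"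
      using c(3) by (auto simp: c'_def dec_def)
    then have "\<sigma> (dec c') = (False, if Suc t = N then 1 else Suc (Suc t), {i \<in> {1..Suc t}. x i})"
      by (auto simp: \<sigma>_def le_Suc_eq)
    moreover have "\<sigma> (dec c') \<in> B" using \<sigma>_in dec_in[OF c'] by blast
    ultimately have "dec (\<pi> c') = (False, if Suc t = N then 1 else Suc (Suc t), {i \<in> {1..Suc t}. x i})"
      by (simp add: \<pi>_def dec_enc)
    moreover have "\<pi> c' < d" using \<open>\<sigma> (dec c') \<in> B\<close> by (simp add: \<pi>_def enc_less)
    moreover have "query_state N (2 ^ N) U x (Suc t) = unit_vec d (\<pi> c')"
    proof -
      have "query_mat N (2 ^ N) x *\<^sub>v unit_vec d c = unit_vec d c'"
        using query_mat_unit_vec[of c N "2 ^ N" x] c(1) by (simp only: d_def[symmetric] c'_def)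
      then show ?thesis using perm_mat_unit_vec[of c' d \<pi>, OF c' \<open>\<pi> c' < d\<close>] c(2) by (simp add: U_def)
    qed
    ultimately show ?case by blast
  qed
  define A where "A = {k. f (restrict (\<lambda>i. i \<in> snd (snd (dec k))) {1..N})}"
  have "output_prob N (2 ^ N) U A N x (\<not> f x) \<le> 1 / 3" if "x \<in> cube N" for x
  proof -
    obtain c where c: "c < d" "query_state N (2 ^ N) U x N = unit_vec d c"
      "snd (snd (dec c)) = {i \<in> {1..N}. x i}" using state[of N x] by auto
    have "restrict (\<lambda>i. i \<in> snd (snd (dec c))) {1..N} = x"
      using that by (auto simp: c(3) cube_def fun_eq_iff PiE_def extensional_def restrict_def)
    then have "c \<in> A \<longleftrightarrow> f x" by (simp add: A_def)
    then have "output_prob N (2 ^ N) U A N x (\<not> f x) = 0"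
      unfolding output_prob_def c(2) d_def[symmetric] using c(1) by (intro sum.neutral) auto
    then show ?thesis by simp
  qed
  then show ?thesis
    unfolding quantum_computes_def using U unfolding d_def
    by (intro exI[of _ "2 ^ N"] exI[of _ U] exI[of _ A]) auto
qed



section \<open>Symmetry and certificates\<close>

lemma kxor_fun_cong:
  assumes "\<And>p. p \<in> positions k r L \<Longrightarrow> x p = y p"
  shows "kxor_fun k r L x = kxor_fun k r L y"
proof -
  have "kxor_fun k r L y" if xy: "\<And>p. p \<in> positions k r L \<Longrightarrow> x p = y p" and x: "kxor_fun k r L x" for x y
  proof -
    obtain S v where S: "\<forall>a<k. S a < r" "\<forall>j<L. even (card {a. a < k \<and> v a j})"
      "\<forall>a<k. \<forall>j<L. \<not> x (a, S a, j, v a j)"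
      using x unfolding kxor_fun_def by blast
    then have "\<forall>a<k. \<forall>j<L. \<not> y (a, S a, j, v a j)"
      using xy by (auto simp: positions_def)
    with S show ?thesis unfolding kxor_fun_def by blast
  qed
  from this[of x y] this[of y x] show ?thesis using assms by metis
qed

text \<open>Groups, letters and bits are permuted by transpositions, and if necessary the value is
  flipped everywhere. Flipping replaces a count of ones by its complement in \<open>k\<close>, which
  preserves parity because \<open>k\<close> is even. As the map is an involution, one implication
  gives the equivalence.\<close>

lemma kxor_fun_symmetric:
  assumes k: "even k" and p: "p \<in> positions k r L" and q: "q \<in> positions k r L"
  obtains \<pi> where "\<pi> p = q" "\<pi> \<circ> \<pi> = id" "\<pi> ` positions k r L \<subseteq> positions k r L"
    "\<And>x. kxor_fun k r L (x \<circ> \<pi>) = kxor_fun k r L x"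
proof -
  obtain a0 i0 j0 b0 where p': "p = (a0, i0, j0, b0)" by (cases p)
  obtain a1 i1 j1 b1 where q': "q = (a1, i1, j1, b1)" by (cases q)
  define \<alpha> \<iota> \<kappa> where "\<alpha> = transpose a0 a1" and "\<iota> = transpose i0 i1" and "\<kappa> = transpose j0 j1"
  define d where "d \<longleftrightarrow> b0 \<noteq> b1"
  define \<pi> where "\<pi> = (\<lambda>(a, i, j, b). (\<alpha> a, \<iota> i, \<kappa> j, b \<noteq> d))"
  have inv: "\<alpha> (\<alpha> a) = a" "\<iota> (\<iota> a) = a" "\<kappa> (\<kappa> a) = a" for a by (simp_all add: \<alpha>_def \<iota>_def \<kappa>_def)
  have bd: "\<alpha> a < k \<longleftrightarrow> a < k" "\<iota> a < r \<longleftrightarrow> a < r" "\<kappa> a < L \<longleftrightarrow> a < L" for a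
    using p q by (auto simp: p' q' positions_def \<alpha>_def \<iota>_def \<kappa>_def transpose_def)
  have \<pi>\<pi>: "\<pi> \<circ> \<pi> = id" by (auto simp: \<pi>_def fun_eq_iff inv)
  have imp: "kxor_fun k r L x" if xp: "kxor_fun k r L (x \<circ> \<pi>)" for x
  proof -
    obtain S v where S: "\<forall>a<k. S a < r" and ev: "\<forall>j<L. even (card {a. a < k \<and> v a j})"
      and x: "\<forall>a<k. \<forall>j<L. \<not> x (\<alpha> a, \<iota> (S a), \<kappa> j, v a j \<noteq> d)"
      using xp unfolding kxor_fun_def \<pi>_def by auto
    define S' where "S' = (\<lambda>a. \<iota> (S (\<alpha> a)))"
    define v' where "v' = (\<lambda>a j. v (\<alpha> a) (\<kappa> j) \<noteq> d)"
    have "\<forall>a<k. S' a < r" using S bd by (simp add: S'_def)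
    moreover have "even (card {a. a < k \<and> v' a j})" if "j < L" for j
    proof -
      let ?V = "{a. a < k \<and> v a (\<kappa> j)}"
      have "bij_betw \<alpha> {a. a < k \<and> v' a j} {a. a < k \<and> (v a (\<kappa> j) \<noteq> d)}"
        by (rule bij_betwI[where g = \<alpha>]) (auto simp: bd inv v'_def)
      then have "card {a. a < k \<and> v' a j} = card {a. a < k \<and> (v a (\<kappa> j) \<noteq> d)}"
        by (rule bij_betw_same_card)
      moreover have evV: "even (card ?V)" using ev bd that by simp
      moreover have "card {a. a < k \<and> \<not> v a (\<kappa> j)} = k - card ?V"
      proof -
        have "{a. a < k \<and> \<not> v a (\<kappa> j)} = {..<k} - ?V" by auto
        moreover have "card ({..<k} - ?V) = card {..<k} - card ?V" by (intro card_Diff_subset) auto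
        ultimately show ?thesis by simp
      qed
      ultimately show ?thesis using k by (cases d) simp_all
    qed
    moreover have "\<not> x (a, S' a, j, v' a j)" if "a < k" "j < L" for a j
      using x[rule_format, of "\<alpha> a" "\<kappa> j"] that bd by (simp add: inv S'_def v'_def)
    ultimately show ?thesis unfolding kxor_fun_def by blast
  qed
  show ?thesis
  proof
    show "\<pi> p = q" by (cases b0; cases b1) (simp_all add: \<pi>_def p' q' \<alpha>_def \<iota>_def \<kappa>_def d_def)
    show "\<pi> ` positions k r L \<subseteq> positions k r L" by (auto simp: \<pi>_def positions_def bd)
    show "kxor_fun k r L (x \<circ> \<pi>) = kxor_fun k r L x" for x
    proof
      assume "kxor_fun k r L x"
      then have "kxor_fun k r L ((x \<circ> \<pi>) \<circ> \<pi>)" by (simp add: comp_assoc \<pi>\<pi>)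
      then show "kxor_fun k r L (x \<circ> \<pi>)" by (rule imp)
    qed (rule imp)
  qed (rule \<pi>\<pi>)
qed

section \<open>Certificates and symmetry of the composition\<close>

definition self_compose :: "(('p \<Rightarrow> bool) \<Rightarrow> bool) \<Rightarrow> ('p \<times> 'p \<Rightarrow> bool) \<Rightarrow> bool" where
  "self_compose f x = f (\<lambda>p. f (\<lambda>q. x (p, q)))"

lemma self_compose_cong:
  assumes f: "\<And>x y. (\<And>p. p \<in> P \<Longrightarrow> x p = y p) \<Longrightarrow> f x = f y"
    and xy: "\<And>z. z \<in> P \<times> P \<Longrightarrow> x z = y z"
  shows "self_compose f x = self_compose f y"
  unfolding self_compose_def by (intro f xy) auto

text \<open>All entries used carry the value opposite to that of the function; in the composition
  this fixes which kind of inner certificate each of them needs. For value 0 all ones of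
  \<open>x\<close> suffice, since turning zeros into ones never creates a solution.\<close>

lemma kxor_certificate:
  "\<exists>s\<subseteq>positions k r L. (\<forall>p\<in>s. x p \<noteq> kxor_fun k r L x) \<and>
     card s \<le> (if kxor_fun k r L x then k * L else 2 * k * r * L) \<and>
     (\<forall>y. (\<forall>p\<in>s. y p = x p) \<longrightarrow> kxor_fun k r L y = kxor_fun k r L x)"
proof (cases "kxor_fun k r L x")
  case True
  then obtain S v where S: "\<forall>a<k. S a < r" "\<forall>j<L. even (card {a. a < k \<and> v a j})"
    "\<forall>a<k. \<forall>j<L. \<not> x (a, S a, j, v a j)"
    unfolding kxor_fun_def by blast
  define s where "s = (\<lambda>(a, j). (a, S a, j, v a j :: bool)) ` ({..<k} \<times> {..<L})"
  have "card s \<le> card ({..<k} \<times> {..<L})" unfolding s_def by (rule card_image_le) simp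
  then have "card s \<le> k * L" by (simp add: card_cartesian_product)
  moreover have "s \<subseteq> positions k r L" using S(1) by (auto simp: s_def positions_def)
  moreover have "\<forall>p\<in>s. \<not> x p" using S(3) by (auto simp: s_def)
  moreover have "kxor_fun k r L y" if y: "\<forall>p\<in>s. y p = x p" for y
  proof -
    have "\<forall>a<k. \<forall>j<L. \<not> y (a, S a, j, v a j)"
    proof (intro allI impI)
      fix a j assume aj: "a < k" "j < L"
      then have "(a, S a, j, v a j) \<in> s" by (force simp: s_def)
      then show "\<not> y (a, S a, j, v a j)" using y S(3) aj by simp
    qed
    with S(1,2) show ?thesis unfolding kxor_fun_def by blast
  qed
  ultimately show ?thesis using True by (intro exI[of _ s]) simp
next
  case False
  define s where "s = {p \<in> positions k r L. x p}"
  have "card s \<le> card (positions k r L)"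
    unfolding s_def by (rule card_mono) (auto simp: positions_def)
  then have "card s \<le> 2 * k * r * L" by (simp add: positions_def card_cartesian_product mult_ac)
  moreover have "\<not> kxor_fun k r L y" if y: "\<forall>p\<in>s. y p = x p" for y
  proof
    assume "kxor_fun k r L y"
    then obtain S v where S: "\<forall>a<k. S a < r" "\<forall>j<L. even (card {a. a < k \<and> v a j})"
      "\<forall>a<k. \<forall>j<L. \<not> y (a, S a, j, v a j)"
      unfolding kxor_fun_def by blast
    have "\<forall>a<k. \<forall>j<L. \<not> x (a, S a, j, v a j)"
    proof (intro allI impI notI)
      fix a j assume aj: "a < k" "j < L" and "x (a, S a, j, v a j)"
      then have "(a, S a, j, v a j) \<in> s" using S(1) by (simp add: s_def positions_def)
      then show False using y S(3) aj \<open>x (a, S a, j, v a j)\<close> by auto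
    qed
    with S(1,2) have "kxor_fun k r L x" unfolding kxor_fun_def by blast
    with False show False ..
  qed
  ultimately show ?thesis using False by (intro exI[of _ s]) (auto simp: s_def)
qed

lemma self_compose_kxor_certificate:
  "\<exists>s\<subseteq>positions k r L \<times> positions k r L. card s \<le> (k * L) * (2 * k * r * L) \<and>
     (\<forall>y. (\<forall>p\<in>s. y p = x p) \<longrightarrow> self_compose (kxor_fun k r L) y = self_compose (kxor_fun k r L) x)"
proof -
  let ?f = "kxor_fun k r L" and ?P = "positions k r L"
  let ?x = "\<lambda>p. ?f (\<lambda>q. x (p, q))"
  let ?c = "\<lambda>b. if b then k * L else 2 * k * r * L"
  obtain s where s: "s \<subseteq> ?P" "\<forall>p\<in>s. ?x p \<noteq> ?f ?x" "card s \<le> ?c (?f ?x)"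
    "\<forall>y. (\<forall>p\<in>s. y p = ?x p) \<longrightarrow> ?f y = ?f ?x"
    using kxor_certificate[of k r L ?x] by (elim exE conjE) (rule that)
  have "\<forall>p. \<exists>t\<subseteq>?P. card t \<le> ?c (?x p) \<and>
     (\<forall>y. (\<forall>q\<in>t. y q = x (p, q)) \<longrightarrow> ?f y = ?x p)"
  proof
    fix p
    show "\<exists>t\<subseteq>?P. card t \<le> ?c (?x p) \<and> (\<forall>y. (\<forall>q\<in>t. y q = x (p, q)) \<longrightarrow> ?f y = ?x p)"
      using kxor_certificate[of k r L "\<lambda>q. x (p, q)"] by (elim exE conjE) (intro exI conjI)
  qed
  then obtain t where t: "\<And>p. t p \<subseteq> ?P" "\<And>p. card (t p) \<le> ?c (?x p)"
    "\<And>p y. (\<forall>q\<in>t p. y q = x (p, q)) \<Longrightarrow> ?f y = ?x p"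
    by metis
  have finP: "finite ?P" by (simp add: positions_def)
  have fins: "finite s" using s(1) finP by (rule finite_subset)
  have fint: "finite (t p)" for p using t(1) finP by (rule finite_subset)
  have "card (Sigma s t) = (\<Sum>p\<in>s. card (t p))" using fins fint by simp
  also have "\<dots> \<le> (\<Sum>p\<in>s. ?c (\<not> ?f ?x))"
  proof (rule sum_mono)
    fix p assume "p \<in> s"
    then have "?x p = (\<not> ?f ?x)" using s(2) by blast
    then show "card (t p) \<le> ?c (\<not> ?f ?x)" using t(2)[of p] by (simp only:)
  qed
  also have "\<dots> = card s * ?c (\<not> ?f ?x)" by simp
  also have "\<dots> \<le> ?c (?f ?x) * ?c (\<not> ?f ?x)" by (intro mult_right_mono s(3)) simp
  also have "\<dots> = (k * L) * (2 * k * r * L)" by (simp add: mult_ac)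
  finally have "card (Sigma s t) \<le> (k * L) * (2 * k * r * L)" .
  moreover have "Sigma s t \<subseteq> ?P \<times> ?P" using s(1) t(1) by blast
  moreover have "self_compose ?f y = self_compose ?f x" if y: "\<forall>z\<in>Sigma s t. y z = x z" for y
    unfolding self_compose_def
  proof (rule s(4)[rule_format])
    fix p assume "p \<in> s"
    then show "?f (\<lambda>q. y (p, q)) = ?x p" using y by (intro t(3)) auto
  qed
  ultimately show ?thesis by blast
qed

lemma certificate_complexity_le:
  assumes "\<And>x. x \<in> cube N \<Longrightarrow> \<exists>s\<subseteq>{1..N}. card s \<le> B \<and> (\<forall>y\<in>cube N. (\<forall>i\<in>s. y i = x i) \<longrightarrow> f y = f x)"
  shows "certificate_complexity N f \<le> B"
proof -
  have "finite (cube N)" unfolding cube_def by (intro finite_PiE) auto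
  moreover have "cube N \<noteq> {}" by (simp add: cube_def PiE_eq_empty_iff)
  moreover have "certificate_complexity_at N f x \<le> B" if x: "x \<in> cube N" for x
  proof -
    obtain s where s: "s \<subseteq> {1..N}" "card s \<le> B" "\<forall>y\<in>cube N. (\<forall>i\<in>s. y i = x i) \<longrightarrow> f y = f x"
      using assms[OF x] by blast
    define p where "p = (\<lambda>i. if i \<in> s then Some (x i) else None)"
    have dom: "dom p = s" by (auto simp: p_def split: if_splits)
    have con: "consistent p y \<longleftrightarrow> (\<forall>i\<in>s. y i = x i)" for y
      unfolding consistent_def dom by (auto simp: p_def)
    have "certificate N f (f x) p" using s by (simp add: certificate_def dom con)
    then have "certificate_complexity_at N f x \<le> card s"
      unfolding certificate_complexity_at_def by (intro Least_le exI[of _ p]) (simp add: dom con)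
    with s(2) show ?thesis by simp
  qed
  ultimately show ?thesis unfolding certificate_complexity_def by (simp add: Max_le_iff)
qed

text \<open>The full symmetry group of \<open>f\<close> serves as the transitive group, so that
  single permutations are enough.\<close>

lemma transitive_functionI:
  assumes ex: "\<And>i j. i \<in> {1..N} \<Longrightarrow> j \<in> {1..N} \<Longrightarrow>
    \<exists>\<sigma>. \<sigma> permutes {1..N} \<and> \<sigma> i = j \<and> (\<forall>x\<in>cube N. f (x \<circ> \<sigma>) = f x)"
  shows "transitive_function N f"
proof -
  define G where "G = {\<sigma>. \<sigma> permutes {1..N} \<and> (\<forall>x\<in>cube N. f (x \<circ> \<sigma>) = f x)}"
  have cube: "x \<circ> \<sigma> \<in> cube N" if "x \<in> cube N" "\<sigma> permutes {1..N}" for x \<sigma>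
    using that permutes_in_image[OF that(2)] permutes_not_in[OF that(2)]
    by (auto simp: cube_def PiE_iff extensional_def)
  have "subgroup G (sym_group N)"
  proof
    show "G \<subseteq> carrier (sym_group N)" by (auto simp: G_def sym_group_carrier)
    show "\<one>\<^bsub>sym_group N\<^esub> \<in> G" by (simp add: G_def sym_group_one permutes_id)
    show "\<sigma> \<otimes>\<^bsub>sym_group N\<^esub> \<tau> \<in> G" if "\<sigma> \<in> G" "\<tau> \<in> G" for \<sigma> \<tau>
      using that cube by (auto simp: G_def sym_group_mult permutes_compose comp_assoc[symmetric])
    show "inv\<^bsub>sym_group N\<^esub> \<sigma> \<in> G" if "\<sigma> \<in> G" for \<sigma>
    proof -
      have \<sigma>: "\<sigma> permutes {1..N}" "\<And>x. x \<in> cube N \<Longrightarrow> f (x \<circ> \<sigma>) = f x" using that by (auto simp: G_def)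
      let ?\<tau> = "Hilbert_Choice.inv \<sigma>"
      have \<tau>: "?\<tau> permutes {1..N}" using \<sigma>(1) by (rule permutes_inv)
      have "f (x \<circ> ?\<tau>) = f x" if "x \<in> cube N" for x
        using \<sigma>(2)[OF cube[OF that \<tau>]] permutes_inv_o(2)[OF \<sigma>(1)] by (simp add: comp_assoc)
      moreover have "inv\<^bsub>sym_group N\<^esub> \<sigma> = ?\<tau>"
        using \<sigma>(1) by (simp add: sym_group_inv_equality sym_group_carrier)
      ultimately show ?thesis using \<tau> by (simp add: G_def)
    qed
  qed
  moreover have "\<exists>\<sigma>\<in>G. \<sigma> i = j" if "i \<in> {1..N}" "j \<in> {1..N}" for i j
    using ex[OF that] by (auto simp: G_def)
  ultimately have "transitive_group N G" by (simp add: transitive_group_def)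
  then show ?thesis unfolding transitive_function_def by (auto simp: G_def)
qed

lemma adversary_relabel:
  fixes e :: "nat \<Rightarrow> 'q"
  assumes adv: "adversary Q f R C lab G w \<beta> \<mu>" and e: "bij_betw e {1..N} Q"
    and dep: "\<And>x y. (\<And>q. q \<in> Q \<Longrightarrow> x q = y q) \<Longrightarrow> f x = f y"
  shows "adversary {1..N} (\<lambda>x. f (\<lambda>q. x (inv_into {1..N} e q))) R C (\<lambda>c. restrict (lab c \<circ> e) {1..N}) G w \<beta> \<mu>"
proof -
  interpret adversary Q f R C lab G w \<beta> \<mu> by fact
  \<comment> \<open>The inverse of \<open>e\<close> is arbitrary off \<open>Q\<close>;
    \<open>dep\<close> makes those values irrelevant.\<close>
  have val: "f (\<lambda>q. restrict (lab c \<circ> e) {1..N} (inv_into {1..N} e q)) = f (lab c)" for c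
  proof (rule dep)
    fix q assume "q \<in> Q"
    then have "inv_into {1..N} e q \<in> {1..N}" "e (inv_into {1..N} e q) = q"
      using e bij_betw_inv_into_right[OF e] bij_betw_inv_into[OF e] by (auto simp: bij_betw_def)
    then show "restrict (lab c \<circ> e) {1..N} (inv_into {1..N} e q) = lab c q" by (simp add: restrict_def)
  qed
  show ?thesis
  proof
    fix i assume i: "i \<in> {1..N}"
    then have "e i \<in> Q" using e by (auto simp: bij_betw_def)
    moreover have "query_part (\<lambda>c. restrict (lab c \<circ> e) {1..N}) i G = query_part lab (e i) G"
      using i by (simp add: query_part_def fun_eq_iff)
    ultimately show "form_le R C (query_part (\<lambda>c. restrict (lab c \<circ> e) {1..N}) i G) \<mu>"
      using le_query by simp
  qed (use finite lab_R lab_C norm_R norm_C attained le val in auto)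
qed

text \<open>For the ratio of value to query norm the composition gives at least
  \<open>(r / 2)\<^sup>2\<close>, and \<open>adversary_bound\<close> costs a factor 50, hence
  200.\<close>

theorem kxor_composed:
  assumes par: "kxor k r L h" and k: "even k"
  defines "N \<equiv> (2 * k * r * L)\<^sup>2"
  shows "\<exists>F. transitive_function N F \<and> certificate_complexity N F \<le> (k * L) * (2 * k * r * L) \<and>
     r\<^sup>2 \<le> 200 * quantum_query_complexity N F"
proof -
  interpret kxor k r L h by fact
  let ?f = "kxor_fun k r L" and ?P = "positions k r L"
  let ?h = "self_compose ?f" and ?Q = "?P \<times> ?P"
  have Lpos: "L > 0"
  proof (rule ccontr)
    assume "\<not> L > 0"
    then have "2 * r ^ k \<le> 1" using L by simp
    moreover have "1 \<le> r ^ k" using r by simp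
    ultimately show False by linarith
  qed
  have cardP: "card ?P = 2 * k * r * L" by (simp add: positions_def card_cartesian_product mult_ac)
  have Ppos: "card ?P > 0" using h r Lpos unfolding cardP by simp
  have finP: "finite ?P" by (simp add: positions_def)
  have N: "card ?Q = N" by (simp add: card_cartesian_product N_def cardP power2_eq_square)
  have Npos: "N > 0" using Ppos unfolding N_def cardP by simp
  have fdep: "?f x = ?f y" if "\<And>p. p \<in> ?P \<Longrightarrow> x p = y p" for x y
    using that by (rule kxor_fun_cong)
  have dep: "?h x = ?h y" if "\<And>q. q \<in> ?Q \<Longrightarrow> x q = y q" for x y
    using fdep that by (rule self_compose_cong)
  obtain e where e: "bij_betw e {1..N} ?Q"
    using finite_same_card_bij[of "{1..N}" ?Q] finP N by auto
  let ?g = "inv_into {1..N} e"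
  have g: "bij_betw ?g ?Q {1..N}" by (rule bij_betw_inv_into[OF e])
  have eg: "e (?g q) = q" if "q \<in> ?Q" for q by (rule bij_betw_inv_into_right[OF e that])
  have ge: "?g (e i) = i" if "i \<in> {1..N}" for i by (rule bij_betw_inv_into_left[OF e that])
  have g_in: "?g q \<in> {1..N}" if "q \<in> ?Q" for q using bij_betwE[OF g] that by blast
  have e_in: "e i \<in> ?Q" if "i \<in> {1..N}" for i using bij_betwE[OF e] that by blast
  define F where "F = (\<lambda>x. ?h (\<lambda>q. x (?g q)))"
  have "transitive_function N F"
  proof (rule transitive_functionI)
    fix i j assume ij: "i \<in> {1..N}" "j \<in> {1..N}"
    obtain p p' where p: "e i = (p, p')" by (cases "e i")
    obtain q q' where q: "e j = (q, q')" by (cases "e j")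
    have in_P: "p \<in> ?P" "p' \<in> ?P" "q \<in> ?P" "q' \<in> ?P" using e_in[OF ij(1)] e_in[OF ij(2)] p q by auto
    obtain \<pi> where \<pi>: "\<pi> p = q" "\<pi> \<circ> \<pi> = id" "\<pi> ` ?P \<subseteq> ?P" "\<And>x. ?f (x \<circ> \<pi>) = ?f x"
      using kxor_fun_symmetric[OF k in_P(1,3)] by blast
    obtain \<pi>' where \<pi>': "\<pi>' p' = q'" "\<pi>' \<circ> \<pi>' = id" "\<pi>' ` ?P \<subseteq> ?P" "\<And>x. ?f (x \<circ> \<pi>') = ?f x"
      using kxor_fun_symmetric[OF k in_P(2,4)] by blast
    define \<rho> where "\<rho> = map_prod \<pi> \<pi>'"
    have \<rho>\<rho>: "\<rho> (\<rho> z) = z" for z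
      using \<pi>(2) \<pi>'(2) by (cases z) (auto simp: \<rho>_def fun_eq_iff)
    have \<rho>_in: "\<rho> z \<in> ?Q" if "z \<in> ?Q" for z 
      using that \<pi>(3)[unfolded image_subset_iff] \<pi>'(3)[unfolded image_subset_iff]
      by (cases z) (simp add: \<rho>_def)
    have h\<rho>: "?h (x \<circ> \<rho>) = ?h x" for x
    proof -
      have "?h (x \<circ> \<rho>) = ?f (\<lambda>p. ?f ((\<lambda>q. x (\<pi> p, q)) \<circ> \<pi>'))"
        by (simp add: self_compose_def \<rho>_def o_def)
      also have "\<dots> = ?f ((\<lambda>p. ?f (\<lambda>q. x (p, q))) \<circ> \<pi>)" unfolding \<pi>'(4) by (simp add: o_def)
      also have "\<dots> = ?h x" unfolding \<pi>(4) self_compose_def ..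
      finally show ?thesis .
    qed
    define \<sigma> where "\<sigma> = (\<lambda>n. if n \<in> {1..N} then ?g (\<rho> (e n)) else n)"
    have \<sigma>_in: "\<sigma> n \<in> {1..N}" if "n \<in> {1..N}" for n
      using that by (simp only: \<sigma>_def if_True) (intro g_in \<rho>_in e_in that)
    have \<sigma>\<sigma>: "\<sigma> (\<sigma> n) = n" for n
    proof (cases "n \<in> {1..N}")
      case True
      have "e (\<sigma> n) = \<rho> (e n)" using True by (simp only: \<sigma>_def if_True eg[OF \<rho>_in[OF e_in[OF True]]])
      then have "\<sigma> (\<sigma> n) = ?g (\<rho> (\<rho> (e n)))" using \<sigma>_in[OF True] by (simp only: \<sigma>_def[of] if_True)
      then show ?thesis using ge[OF True] by (simp only: \<rho>\<rho>)
    next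
      case False
      then have "\<sigma> n = n" by (simp only: \<sigma>_def if_False)
      then show ?thesis by simp
    qed
    have "bij_betw \<sigma> {1..N} {1..N}"
      by (rule bij_betwI[where g = \<sigma>]) (use \<sigma>_in \<sigma>\<sigma> in auto)
    then have "\<sigma> permutes {1..N}" by (rule bij_imp_permutes) (auto simp: \<sigma>_def)
    moreover have "\<sigma> i = j" 
    proof -
      have "\<rho> (e i) = e j" by (simp add: p q \<rho>_def \<pi>(1) \<pi>'(1))
      then show ?thesis using ij ge[OF ij(2)] by (simp only: \<sigma>_def if_True)
    qed
    moreover have "F (x \<circ> \<sigma>) = F x" for x
    proof -
      have "F (x \<circ> \<sigma>) = ?h ((\<lambda>q. x (?g q)) \<circ> \<rho>)"
        unfolding F_def
      proof (rule dep)
        fix z assume z: "z \<in> ?Q"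
        have "\<sigma> (?g z) = ?g (\<rho> z)" using g_in[OF z] by (simp only: \<sigma>_def if_True eg[OF z])
        then show "(x \<circ> \<sigma>) (?g z) = ((\<lambda>q. x (?g q)) \<circ> \<rho>) z" by simp
      qed
      then show ?thesis unfolding h\<rho> F_def .
    qed
    ultimately show "\<exists>\<sigma>. \<sigma> permutes {1..N} \<and> \<sigma> i = j \<and> (\<forall>x\<in>cube N. F (x \<circ> \<sigma>) = F x)" by blast
  qed
  moreover have "certificate_complexity N F \<le> (k * L) * (2 * k * r * L)"
  proof (rule certificate_complexity_le)
    fix x :: "nat \<Rightarrow> bool"
    obtain s where s: "s \<subseteq> ?Q" "card s \<le> (k * L) * (2 * k * r * L)"
      "\<forall>y. (\<forall>p\<in>s. y p = x (?g p)) \<longrightarrow> ?h y = F x"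
      using self_compose_kxor_certificate[of k r L "\<lambda>q. x (?g q)"] unfolding F_def by blast
    have "?g ` s \<subseteq> {1..N}" using s(1) g_in by blast
    moreover have "card (?g ` s) \<le> (k * L) * (2 * k * r * L)"
    proof -
      have "finite s" by (rule finite_subset[OF s(1)]) (simp add: finP)
      then have "card (?g ` s) \<le> card s" by (rule card_image_le)
      with s(2) show ?thesis by linarith
    qed
    moreover have "\<forall>y\<in>cube N. (\<forall>i\<in>?g ` s. y i = x i) \<longrightarrow> F y = F x"
    proof (intro ballI impI)
      fix y assume y: "\<forall>i\<in>?g ` s. y i = x i"
      have "?h (\<lambda>q. y (?g q)) = F x" by (rule s(3)[rule_format]) (use y in blast)
      then show "F y = F x" by (simp only: F_def)
    qed
    ultimately show "\<exists>s\<subseteq>{1..N}. card s \<le> (k * L) * (2 * k * r * L) \<and> (\<forall>y\<in>cube N. (\<forall>i\<in>s. y i = x i) \<longrightarrow> F y = F x)"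
      by blast
  qed
  moreover have "r\<^sup>2 \<le> 200 * quantum_query_complexity N F"
  proof -
    define T where "T = quantum_query_complexity N F"
    have T: "quantum_computes N F T"
      unfolding T_def quantum_query_complexity_def
      by (rule LeastI[of _ N]) (rule quantum_computes_all_queries[OF Npos])
    obtain w \<beta> \<mu> where adv: "adversary ?P ?f (Sigma choices solutions) ({\<lambda>_. 0} \<times> unsolvable) lab G w \<beta> \<mu>"
      and \<mu>: "\<mu> > 0" and \<beta>: "\<beta> \<ge> real r / 2 * \<mu>"
      by (rule kxor_adversary)
    have \<beta>pos: "\<beta> > 0"
    proof -
      have "0 < real r / 2 * \<mu>" using r \<mu> by simp
      with \<beta> show ?thesis by linarith
    qed
    note adv2 = adversary_relabel[OF adversary_compose[OF adv adv fdep, folded self_compose_def] e dep, folded F_def]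
    \<comment> \<open>The common factor \<open>\<beta> ^ (card ?P - 1)\<close> is huge but cancels,
      as \<beta> is positive.\<close>
    have "\<beta> * \<beta> ^ card ?P \<le> 50 * (\<mu> * (\<mu> * \<beta> ^ (card ?P - 1))) * real T"
      by (rule adversary_bound[OF adv2 Npos _ T]) (auto simp: cube_def)
    moreover have "\<beta> ^ card ?P = \<beta> * \<beta> ^ (card ?P - 1)" using Ppos by (simp add: power_eq_if)
    ultimately have "\<beta>\<^sup>2 * \<beta> ^ (card ?P - 1) \<le> (50 * \<mu>\<^sup>2 * real T) * \<beta> ^ (card ?P - 1)"
      by (simp add: power2_eq_square mult_ac)
    then have "\<beta>\<^sup>2 \<le> 50 * \<mu>\<^sup>2 * real T"
      by (rule mult_right_le_imp_le) (use \<beta>pos in simp)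
    moreover have "(real r / 2 * \<mu>)\<^sup>2 \<le> \<beta>\<^sup>2" using \<beta> \<mu> by (intro power_mono) auto
    ultimately have "(real r / 2 * \<mu>)\<^sup>2 \<le> 50 * \<mu>\<^sup>2 * real T" by linarith
    moreover have "(real r)\<^sup>2 * \<mu>\<^sup>2 = 4 * (real r / 2 * \<mu>)\<^sup>2"
      by (simp add: power_mult_distrib power_divide)
    ultimately have "(real r)\<^sup>2 * \<mu>\<^sup>2 \<le> (200 * real T) * \<mu>\<^sup>2"
      by (simp add: mult_ac)
    then have "(real r)\<^sup>2 \<le> 200 * real T" by (rule mult_right_le_imp_le) (use \<mu> in simp)
    then have "real (r\<^sup>2) \<le> real (200 * T)" by simp
    then show ?thesis unfolding of_nat_le_iff T_def .
  qed
  ultimately show ?thesis by blast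
qed

section \<open>Choice of the parameters and final estimate\<close>

theorem theorem1p3:
  shows "\<exists>(N :: nat \<Rightarrow> nat) (F :: nat \<Rightarrow> (nat \<Rightarrow> bool) \<Rightarrow> bool).
    (\<forall>i. transitive_function (N i) (F i)) \<and>
    filterlim N at_top sequentially \<and>
    filterlim (\<lambda>i. quantum_query_complexity (N i) (F i)) at_top sequentially \<and>
    tilde_Omega N (\<lambda>i. real (quantum_query_complexity (N i) (F i)))
                  (\<lambda>i. (real (certificate_complexity (N i) (F i)))\<^sup>2)"
proof -
  \<comment> \<open>With \<open>r = 2 ^ i\<close> and \<open>h = 2 * i + 2\<close> one has
    \<open>2 ^ h = 4 * r ^ 2\<close>; the smallest even number above \<open>2 * h\<close> is
    \<open>4 * i + 6\<close>, and \<open>L\<close> is chosen so that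
    \<open>2 * r ^ k = 2 ^ L\<close>.\<close>
  define k where "k = (\<lambda>i :: nat. 4 * i + 6)"
  define L where "L = (\<lambda>i. i * k i + 1)"
  define N where "N = (\<lambda>i. (2 * k i * 2 ^ i * L i)\<^sup>2)"
  have "\<exists>F. transitive_function (N i) F \<and> certificate_complexity (N i) F \<le> (k i * L i) * (2 * k i * 2 ^ i * L i) \<and>
     (2 ^ i)\<^sup>2 \<le> 200 * quantum_query_complexity (N i) F" for i
    unfolding N_def
  proof (rule kxor_composed)
    show "kxor (k i) (2 ^ i) (L i) (2 * i + 2)"
    proof
      show "2 * (2 * i + 2) < k i" by (simp add: k_def)
      show "3 * (2 ^ i)\<^sup>2 \<le> (2 :: nat) ^ (2 * i + 2)" by (simp add: power_add power_mult power2_eq_square power_mult_distrib[symmetric])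
      show "2 * (2 ^ i) ^ k i \<le> (2 :: nat) ^ L i" by (simp add: L_def power_mult[symmetric])
    qed simp
    show "even (k i)" by (simp add: k_def)
  qed
  then obtain F where trans: "\<And>i. transitive_function (N i) (F i)"
    and C: "\<And>i. certificate_complexity (N i) (F i) \<le> (k i * L i) * (2 * k i * 2 ^ i * L i)"
    and Q: "\<And>i. (2 ^ i)\<^sup>2 \<le> 200 * quantum_query_complexity (N i) (F i)"
    by metis
  have N_ge: "2 ^ i \<le> N i" for i
  proof -
    have "1 \<le> 2 * k i * L i" by (simp add: k_def L_def)
    then have "2 ^ i * 1 \<le> 2 ^ i * (2 * k i * L i)" by (intro mult_left_mono) auto
    then have "2 ^ i \<le> 2 * k i * 2 ^ i * L i" by (simp add: mult_ac)
    also have "n \<le> n\<^sup>2" for n :: nat by (simp add: power2_eq_square)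
    finally show ?thesis unfolding N_def .
  qed
  have i_less: "i < 2 ^ i" for i :: nat by (rule less_exp)
  have "filterlim N at_top sequentially"
    unfolding filterlim_at_top eventually_sequentially
  proof (intro allI exI impI)
    fix Z n :: nat assume "Z \<le> n"
    then show "Z \<le> N n" using N_ge[of n] i_less[of n] by linarith
  qed
  moreover have "filterlim (\<lambda>i. quantum_query_complexity (N i) (F i)) at_top sequentially"
    unfolding filterlim_at_top eventually_sequentially
  proof (intro allI exI impI)
    fix Z n :: nat assume "200 * Z \<le> n"
    moreover have "(2 :: nat) ^ n \<le> (2 ^ n)\<^sup>2" by (simp add: power2_eq_square)
    ultimately show "Z \<le> quantum_query_complexity (N n) (F n)" using Q[of n] i_less[of n] by linarith
  qed
  moreover have "tilde_Omega N (\<lambda>i. real (quantum_query_complexity (N i) (F i)))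
                  (\<lambda>i. (real (certificate_complexity (N i) (F i)))\<^sup>2)"
    unfolding tilde_Omega_def
  proof (intro exI conjI)
    \<comment> \<open>The certificate bound is quadratic in \<open>k i * L i\<close>, which is at
      most \<open>110 * i ^ 3\<close>; its square therefore has the factor \<open>i ^ 12\<close> and
      the constant \<open>4 * 110 ^ 4\<close>. Replacing \<open>i\<close> by twice the logarithm of
      \<open>N i\<close> gives the factor \<open>2 ^ 12\<close> and the exponent 12.\<close>
    define M :: real where "M = 4 * 10 ^ 4 * 11 ^ 4 * 2 ^ 12"
    show "0 < 1 / (200 * M)" by (simp add: M_def)
    show "(0 :: real) \<le> 12" by simp
    show "\<forall>\<^sub>F i in sequentially. 1 / (200 * M) * (real (certificate_complexity (N i) (F i)))\<^sup>2 / ln (real (N i)) powr 12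
      \<le> real (quantum_query_complexity (N i) (F i))"
    \<comment> \<open>From \<open>i = 1\<close> on, \<open>k i \<le> 10 * i\<close> and the
      logarithm is positive.\<close>
    proof (rule eventually_sequentiallyI[of 1])
      fix i :: nat assume i: "1 \<le> i"
      have ki: "k i \<le> 10 * i" using i by (simp add: k_def)
      have "i * k i \<le> i * (10 * i)" using ki by (intro mult_left_mono) auto
      moreover have "1 \<le> i\<^sup>2" using i by simp
      ultimately have "L i \<le> i * (10 * i) + i\<^sup>2" unfolding L_def by linarith
      then have Li: "L i \<le> 11 * i\<^sup>2" by (simp add: power2_eq_square)
      define c where "c = real (certificate_complexity (N i) (F i))"
      have "k i * L i \<le> 10 * i * (11 * i\<^sup>2)" using ki Li by (intro mult_mono) auto
      then have kL: "k i * L i \<le> 110 * i ^ 3" by (simp add: power2_eq_square power3_eq_cube)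
      have "certificate_complexity (N i) (F i) \<le> 2 * (k i * L i)\<^sup>2 * 2 ^ i"
        using C[of i] by (simp add: power2_eq_square mult_ac)
      also have "\<dots> \<le> 2 * (110 * i ^ 3)\<^sup>2 * 2 ^ i"
        by (intro mult_right_mono mult_left_mono power_mono kL) simp_all
      finally have "c \<le> real (2 * (110 * i ^ 3)\<^sup>2 * 2 ^ i)" unfolding c_def of_nat_le_iff .
      then have "c \<le> 2 * 110 ^ 2 * real i ^ 6 * 2 ^ i"
        by (simp add: power_mult_distrib power_mult[symmetric])
      then have "c\<^sup>2 \<le> (2 * 110 ^ 2 * real i ^ 6 * 2 ^ i)\<^sup>2"
        by (intro power_mono) (simp_all add: c_def)
      also have "\<dots> = 4 * 10 ^ 4 * 11 ^ 4 * real i ^ 12 * (2 ^ i)\<^sup>2"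
        by (simp add: power_mult_distrib power_mult[symmetric])
      finally have c2: "c\<^sup>2 \<le> 4 * 10 ^ 4 * 11 ^ 4 * real i ^ 12 * (2 ^ i)\<^sup>2" .
      have "real i / 2 \<le> ln (real (N i))"
      proof -
        have "(1 :: real) / 2 \<le> ln 2" using ln_le_minus_one[of "1 / 2 :: real"] by (simp add: ln_div)
        then have "real i * (1 / 2) \<le> real i * ln 2" by (intro mult_left_mono) auto
        also have "\<dots> = ln (2 ^ i)" by (simp add: ln_realpow)
        also have "\<dots> \<le> ln (real (N i))"
        proof (subst ln_le_cancel_iff)
          show "(2 :: real) ^ i \<le> real (N i)" using of_nat_mono[OF N_ge[of i], where 'a = real] by simp
          then show "0 < real (N i)" by (rule less_le_trans[rotated]) simp
        qed simp
        finally show ?thesis by simp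
      qed
      then have "(real i / 2) ^ 12 \<le> ln (real (N i)) ^ 12" by (intro power_mono) auto
      moreover have lnpos: "0 < ln (real (N i))" using \<open>real i / 2 \<le> ln (real (N i))\<close> i by linarith
      ultimately have ln: "real i ^ 12 \<le> 2 ^ 12 * ln (real (N i)) powr 12"
        by (simp add: power_divide powr_numeral)
      have "c\<^sup>2 \<le> 4 * 10 ^ 4 * 11 ^ 4 * (2 ^ 12 * ln (real (N i)) powr 12) * (2 ^ i)\<^sup>2"
        by (rule order_trans[OF c2]) (intro mult_left_mono mult_right_mono ln, auto)
      also have "\<dots> = M * (2 ^ i)\<^sup>2 * ln (real (N i)) powr 12" by (simp add: M_def)
      also have "(2 ^ i)\<^sup>2 \<le> 200 * real (quantum_query_complexity (N i) (F i))"
        using of_nat_mono[OF Q[of i], where 'a = real] by simp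
      finally have "c\<^sup>2 \<le> M * (200 * real (quantum_query_complexity (N i) (F i))) * ln (real (N i)) powr 12"
        by (simp add: M_def mult_right_mono)
      then show "1 / (200 * M) * (real (certificate_complexity (N i) (F i)))\<^sup>2 / ln (real (N i)) powr 12
          \<le> real (quantum_query_complexity (N i) (F i))"
        using lnpos unfolding c_def[symmetric] by (simp add: M_def field_simps)
    qed
  qed
  ultimately show ?thesis using trans by blast
qed


end
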